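(* Let $t$ be a positive integer. For sufficiently large $n$, $$\mathrm{ex}_3(n,\mathcal{F}_5(f_3;t))=e\big(T_3(n,3)^{t+}\big).$$
   Context: All hypergraphs are $3$-uniform. $\mathrm{ex}_3(n,\mathcal{F})$ is the maximum number of hyperedges in an $n$-vertex $3$-graph with no copy of $\mathcal{F}$. $\mathcal{F}_5$ is the $3$-graph on $\{f_1,\dots,f_5\}$ with hyperedges $f_1f_2f_3,f_1f_2f_4,f_3f_4f_5$. $\mathcal{F}_5(f_3;t)$ is obtained by blowing up $f_3$ into $t$ vertices: its vertices are $f_1,f_2,f_4,f_5,h_1,\dots,h_t$ and its hyperedges are $f_1f_2f_4$ and $f_1f_2h_i$, $h_if_4f_5$ for $i=1,\dots,t$. $T_3(n,3)$ is the complete $3$-partite $3$-graph on $n$ vertices with part sizes $\lfloor n/3\rfloor$ or $\lceil n/3\rceil$. $D(N,3,t,2)$ denotes an $N$-vertex $3$-graph with the maximum possible number of hyperedges subject to every pair of vertices lying in at most $t-1$ hyperedges. $T_3(n,3)^{t+}$ is obtained from $T_3(n,3)$ by placing inside each part (of size $N\in\{\lfloor n/3\rfloor,\lceil n/3\rceil\}$) a copy of $D(N,3,t,2)$; thus $e(T_3(n,3)^{t+})$ equals $e(T_3(n,3))$ plus, for each part of size $N$, the maximum number of hyperedges of an $N$-vertex $3$-graph in which every pair lies in at most $t-1$ hyperedges. *)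

theory Defs
  imports Complex_Main
begin

type_synonym 'a hypergraph = "'a set \<times> 'a set set"

abbreviation verts :: "'a hypergraph \<Rightarrow> 'a set" where
  "verts \<equiv> fst"

abbreviation edges :: "'a hypergraph \<Rightarrow> 'a set set" where
  "edges \<equiv> snd"

definition three_graph :: "'a hypergraph \<Rightarrow> bool" where
  "three_graph G \<longleftrightarrow> finite (verts G) \<and> (\<forall>e\<in>edges G. e \<subseteq> verts G \<and> card e = 3)"

text \<open>A copy of \<open>F\<close> is a not necessarily induced subhypergraph isomorphic to \<open>F\<close>.\<close>

definition contains_copy :: "'a hypergraph \<Rightarrow> 'b hypergraph \<Rightarrow> bool" where
  "contains_copy G F \<longleftrightarrow>
     (\<exists>f. inj_on f (verts F) \<and> f ` verts F \<subseteq> verts G \<and> (\<forall>e\<in>edges F. f ` e \<in> edges G))"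

text \<open>The vertex set is fixed to \<open>{..<n}\<close>, which loses nothing up to isomorphism.\<close>

definition ex3 :: "nat \<Rightarrow> 'b hypergraph \<Rightarrow> nat" where
  "ex3 n F = Max {card (edges G) | G :: nat hypergraph.
     three_graph G \<and> verts G = {..<n} \<and> \<not> contains_copy G F}"

datatype F5_vertex = F1 | F2 | F4 | F5 | H nat

definition F5_blowup :: "nat \<Rightarrow> F5_vertex hypergraph" where
  "F5_blowup t = ({F1, F2, F4, F5} \<union> H ` {1..t},
     insert {F1, F2, F4} (\<Union>i\<in>{1..t}. {{F1, F2, H i}, {H i, F4, F5}}))"

text \<open>The truncated subtraction below is harmless, as only \<open>t \<ge> 1\<close> is of interest.\<close>

definition pair_bounded :: "nat \<Rightarrow> 'a hypergraph \<Rightarrow> bool" where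
  "pair_bounded t G \<longleftrightarrow>
     (\<forall>x\<in>verts G. \<forall>y\<in>verts G. x \<noteq> y \<longrightarrow> card {e\<in>edges G. {x, y} \<subseteq> e} \<le> t - 1)"

text \<open>\<open>G\<close> is a \<open>D(N,3,t,2)\<close> where \<open>N\<close> is its number of vertices. Such a hypergraph is in
  general not unique up to isomorphism, hence a predicate.\<close>

definition is_D :: "nat \<Rightarrow> 'a hypergraph \<Rightarrow> bool" where
  "is_D t G \<longleftrightarrow> three_graph G \<and> pair_bounded t G \<and>
     (\<forall>G'. three_graph G' \<and> verts G' = verts G \<and> pair_bounded t G'
        \<longrightarrow> card (edges G') \<le> card (edges G))"

definition balanced_parts :: "nat \<Rightarrow> 'a set \<Rightarrow> 'a set \<Rightarrow> 'a set \<Rightarrow> bool" where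
  "balanced_parts n A B C \<longleftrightarrow>
     finite (A \<union> B \<union> C) \<and> card (A \<union> B \<union> C) = n \<and>
     A \<inter> B = {} \<and> A \<inter> C = {} \<and> B \<inter> C = {} \<and>
     (\<forall>P\<in>{A, B, C}. int (card P) = \<lfloor>real n / 3\<rfloor> \<or> int (card P) = \<lceil>real n / 3\<rceil>)"

definition complete_3partite :: "'a set \<Rightarrow> 'a set \<Rightarrow> 'a set \<Rightarrow> 'a hypergraph" where
  "complete_3partite A B C = (A \<union> B \<union> C, {{a, b, c} | a b c. a \<in> A \<and> b \<in> B \<and> c \<in> C})"

text \<open>\<open>G\<close> is a \<open>T\<^sub>3(n,3)\<^sup>t\<^sup>+\<close>, for some choice of the parts and of the hypergraph placed in
  each part.\<close>

definition is_T3_plus :: "nat \<Rightarrow> nat \<Rightarrow> 'a hypergraph \<Rightarrow> bool" where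
  "is_T3_plus n t G \<longleftrightarrow>
     (\<exists>A B C D\<^sub>A D\<^sub>B D\<^sub>C. balanced_parts n A B C \<and>
        is_D t (A, D\<^sub>A) \<and> is_D t (B, D\<^sub>B) \<and> is_D t (C, D\<^sub>C) \<and>
        G = (A \<union> B \<union> C, edges (complete_3partite A B C) \<union> D\<^sub>A \<union> D\<^sub>B \<union> D\<^sub>C))"

lemma ex_D:
  assumes "finite V"
  shows "\<exists>E. is_D t (V, E)"
proof -
  let ?P = "\<lambda>E. three_graph (V, E) \<and> pair_bounded t (V, E)"
  have "?P {}"
    using assms by (simp add: three_graph_def pair_bounded_def)
  moreover have "card E \<le> card (Pow V)" if "?P E" for E
    using that assms by (intro card_mono) (auto simp: three_graph_def)
  ultimately obtain E where "?P E" "\<forall>E'. ?P E' \<longrightarrow> card E' \<le> card E"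
    using ex_has_greatest_nat[of ?P "{}" card "Suc (card (Pow V))"] le_imp_less_Suc by metis
  then have "is_D t (V, E)"
    by (auto simp: is_D_def)
  then show ?thesis ..
qed

lemma ex_T3_plus: "\<exists>G :: nat hypergraph. is_T3_plus n t G"
proof -
  define a b where "a = n div 3" and "b = (n + 1) div 3"
  have ab: "a \<le> b" "a + b \<le> n"
    by (auto simp: a_def b_def)
  have u: "{..<a} \<union> {a..<a + b} \<union> {a + b..<n} = {..<n}"
    using ab by auto
  have fl: "\<lfloor>real n / 3\<rfloor> = int (n div 3)"
    using floor_divide_of_nat_eq[of n 3, where ?'a = real] by simp
  have ce: "\<lceil>real n / 3\<rceil> = int ((n + 2) div 3)"
    by linarith
  have sz: "b = n div 3 \<or> b = (n + 2) div 3"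
    unfolding b_def by linarith
  have "n = a + b + (n + 2) div 3"
  proof -
    define c where "c = (n + 2) div 3"
    have abc: "3 * a \<le> n" "n < 3 * a + 3" "3 * b \<le> n + 1" "n + 1 < 3 * b + 3"
        "3 * c \<le> n + 2" "n + 2 < 3 * c + 3"
      unfolding a_def b_def c_def by linarith+
    then consider "n = 3 * a" | "n = 3 * a + 1" | "n = 3 * a + 2"
      by linarith
    then have "n = a + b + c"
    proof cases
      case 1
      with abc have "b = a" "c = a" by linarith+
      with 1 show ?thesis by simp
    next
      case 2
      with abc have "b = a" "c = a + 1" by linarith+
      with 2 show ?thesis by simp
    next
      case 3
      with abc have "b = a + 1" "c = a + 1" by linarith+
      with 3 show ?thesis by simp
    qed
    then show ?thesis
      unfolding c_def .
  qed
  then have sz': "n - (a + b) = (n + 2) div 3"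
    by linarith
  have "balanced_parts n {..<a} {a..<a + b} {a + b..<n}"
    unfolding balanced_parts_def u fl ce using sz sz' by (auto simp: a_def)
  then show ?thesis
    unfolding is_T3_plus_def
    by (metis ex_D finite_atLeastLessThan finite_lessThan)
qed

text \<open>The maximum in \<^const>\<open>ex3\<close> is over a finite nonempty set as soon as \<open>F\<close> has an edge.\<close>

lemma ex3_well_defined:
  fixes F :: "'b hypergraph" and n :: nat
  assumes "edges F \<noteq> {}"
  defines "S \<equiv> {card (edges G) | G :: nat hypergraph.
     three_graph G \<and> verts G = {..<n} \<and> \<not> contains_copy G F}"
  shows "finite S" and "S \<noteq> {}"
proof -
  have "card (edges G) \<le> card (Pow {..<n})"
    if "three_graph G" "verts G = {..<n}" for G :: "nat hypergraph"
    using that by (intro card_mono) (auto simp: three_graph_def)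
  then have "S \<subseteq> {..card (Pow {..<n})}"
    unfolding S_def by auto
  then show "finite S"
    by (rule finite_subset) simp
  have "three_graph ({..<n}, {})" "\<not> contains_copy ({..<n}, {}) F"
    using assms(1) by (auto simp: three_graph_def contains_copy_def)
  then show "S \<noteq> {}"
    unfolding S_def mem_Collect_eq ex_in_conv[symmetric]
    by (intro exI[of _ "card (edges ({..<n}, {}))"] CollectI exI[of _ "({..<n}, {})"]) simp
qed

end

theory Submission
  imports Defs
begin

text \<open>If \<open>{a, b, x}\<close> is an edge and \<open>w \<notin> {a, b}\<close>, then fewer than \<open>t\<close> vertices \<open>h\<close> of the
  neighbourhood of \<open>ab\<close> have \<open>h x w\<close> as an edge; so neighbourhoods of pairs span only \<open>O(n\<^sup>2)\<close>
  edges, and no removal lemma is needed. If all degrees are about \<open>n\<^sup>2/9\<close>, take a pair of maximum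
  codegree with neighbourhood \<open>A\<close>, a vertex of \<open>A\<close> in a pair of maximum codegree with
  neighbourhood \<open>B\<close>, and the rest \<open>C\<close>: bounding the links of vertices of \<open>A\<close> forces all three to
  have size about \<open>n/3\<close> and almost all crossing triples to be edges. After each vertex is moved to
  the part where its link is dense, every vertex misses few crossing pairs. Then the edges inside a
  part cover each pair at most \<open>t - 1\<close> times, and an edge meeting exactly two parts forces two
  pairs with linearly many missing crossing triples, so there are fewer such edges than missing
  triples. Vertices of small degree are removed by progressive induction.

  That the parts should be balanced is not automatic: the packing numbers \<open>d\<close> must satisfy
  \<open>d(N + 1) + d(N - 1) - 2 d(N) \<le> N\<close>. This follows from triple packings that miss the trivial
  bound by \<open>N/3 + O(1)\<close>. On \<open>\<int>\<^sub>M\<close> take the triples with sum \<open>s\<close>, for \<open>t - 1\<close> values of \<open>s\<close>; the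
  only uncovered pairs are \<open>{x, s - 2x}\<close>, and these are joined to two further points.\<close>

section \<open>Links and codegrees\<close>

text \<open>In every application of freeness the pair ab is f1f2, x is f4 and w is f5. All vertices
  of the would-be copy are distinct for free, except w against a and b; so each estimate sets aside
  a few vertices, at lower-order cost. The obstacle in the balancing step is that the numbers d(N)
  are not known exactly. The trivial bound (t - 1)N(N - 1)/6 has second difference (t - 1)/3, and
  the lower bound for d enters twice, so any defect below N/2 - O(1) suffices. The triples of sum s
  leave uncovered, for every x, the pair of x and s - 2x: one arc out of each point and on average
  one into it. Over t - 1 sums these are 2(t - 1) arc ends per point, just what two new points can
  absorb with multiplicity t - 1. Sharing the arcs evenly between the two points requires the sums
  to be grouped in pairs; for odd t - 1 one sum is left over and gives up a third of its arcs, which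
  is the term N/3.\<close>

lemma card_swap2:
  assumes "\<And>s u. P s u \<longleftrightarrow> P u s"
  shows "card {(s, u). s \<in> S \<and> u \<in> T \<and> P s u} = card {(s, u). s \<in> T \<and> u \<in> S \<and> P s u}"
proof -
  have "{(s, u). s \<in> S \<and> u \<in> T \<and> P s u} = prod.swap ` {(s, u). s \<in> T \<and> u \<in> S \<and> P s u}"
    using assms by (auto simp: image_iff)
  then show ?thesis
    by (simp add: card_image)
qed

lemma card_swap12:
  assumes "\<And>a b c. P a b c \<longleftrightarrow> P b a c"
  shows "card {(a, b, c). a \<in> A \<and> b \<in> B \<and> c \<in> C \<and> P a b c} =
    card {(a, b, c). a \<in> B \<and> b \<in> A \<and> c \<in> C \<and> P a b c}"
proof -
  have "{(a, b, c). a \<in> A \<and> b \<in> B \<and> c \<in> C \<and> P a b c} =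
      (\<lambda>(a, b, c). (b, a, c)) ` {(a, b, c). a \<in> B \<and> b \<in> A \<and> c \<in> C \<and> P a b c}"
    using assms by (auto simp: image_iff)
  then show ?thesis
    by (simp add: card_image inj_on_def)
qed

lemma card_swap23:
  assumes "\<And>a b c. P a b c \<longleftrightarrow> P a c b"
  shows "card {(a, b, c). a \<in> A \<and> b \<in> B \<and> c \<in> C \<and> P a b c} =
    card {(a, b, c). a \<in> A \<and> b \<in> C \<and> c \<in> B \<and> P a b c}"
proof -
  have "{(a, b, c). a \<in> A \<and> b \<in> B \<and> c \<in> C \<and> P a b c} =
      (\<lambda>(a, b, c). (a, c, b)) ` {(a, b, c). a \<in> A \<and> b \<in> C \<and> c \<in> B \<and> P a b c}"
    using assms by (auto simp: image_iff)
  then show ?thesis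
    by (simp add: card_image inj_on_def)
qed

locale blowup_free =
  fixes V :: "'a set" and E :: "'a set set" and t :: nat
  assumes fin: "finite V"
    and edge: "e \<in> E \<Longrightarrow> e \<subseteq> V \<and> card e = 3"
    and tpos: "t > 0"
    and free: "\<not> contains_copy (V, E) (F5_blowup t)"
begin

definition N :: "'a \<Rightarrow> 'a \<Rightarrow> 'a set" where
  "N x y = {z. {x, y, z} \<in> E}"

text \<open>Ordered pairs are counted, so \<open>lk x V V\<close> is twice the degree of
  \<open>x\<close>; in a balanced complete tripartite 3-graph it is about 2n^2/9, the constant in
  the degree conditions below.\<close>

definition lk :: "'a \<Rightarrow> 'a set \<Rightarrow> 'a set \<Rightarrow> nat" where
  "lk x S T = card {(s, u). s \<in> S \<and> u \<in> T \<and> {x, s, u} \<in> E}"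

definition nlk :: "'a \<Rightarrow> 'a set \<Rightarrow> 'a set \<Rightarrow> nat" where
  "nlk x S T = card {(s, u). s \<in> S \<and> u \<in> T \<and> {x, s, u} \<notin> E}"

definition miss :: "'a set \<Rightarrow> 'a set \<Rightarrow> 'a set \<Rightarrow> nat" where
  "miss A B C = card {(a, b, c). a \<in> A \<and> b \<in> B \<and> c \<in> C \<and> {a, b, c} \<notin> E}"

lemma edge_distinct:
  assumes "{x, y, z} \<in> E"
  shows "x \<noteq> y" "y \<noteq> z" "x \<noteq> z" "x \<in> V" "y \<in> V" "z \<in> V"
proof -
  have "card {x, y, z} = 3" "{x, y, z} \<subseteq> V"
    using edge[OF assms] by auto
  then show "x \<noteq> y" "y \<noteq> z" "x \<noteq> z" "x \<in> V" "y \<in> V" "z \<in> V"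
    by (auto simp: card_insert_if split: if_splits)
qed

lemma N_sub: "N x y \<subseteq> V"
  using edge_distinct by (auto simp: N_def)

lemma N_fin: "finite (N x y)"
  using N_sub fin finite_subset by blast

lemma N_commute: "N x y = N y x"
  by (simp add: N_def insert_commute)

lemma N_card_le: "card (N x y) \<le> card V"
  by (simp add: N_sub card_mono fin)

text \<open>With \<open>t\<close> common vertices one could send \<open>F1\<close>,
  \<open>F2\<close>, \<open>F4\<close>, \<open>F5\<close> to \<open>a\<close>, \<open>b\<close>,
  \<open>x\<close>, \<open>w\<close> and the \<open>H i\<close> to these vertices. Only
  \<open>w\<close> against \<open>a\<close> and \<open>b\<close> needs an assumption; all other
  coincidences are excluded because edges have three elements.\<close>

lemma free_bound:
  assumes "{a, b, x} \<in> E" "w \<notin> {a, b}"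
  shows "card (N a b \<inter> N x w) < t"
proof (rule ccontr)
  assume "\<not> card (N a b \<inter> N x w) < t"
  then obtain K where K: "K \<subseteq> N a b \<inter> N x w" "card K = t"
    by (meson not_less obtain_subset_with_card_n)
  then have "finite K"
    using N_fin finite_subset by blast
  then obtain g where g: "bij_betw g {1..t} K"
    using ex_bij_betw_nat_finite_1 K(2) by blast
  define f where "f v = (case v of F1 \<Rightarrow> a | F2 \<Rightarrow> b | F4 \<Rightarrow> x | F5 \<Rightarrow> w | H i \<Rightarrow> g i)" for v
  have f[simp]: "f F1 = a" "f F2 = b" "f F4 = x" "f F5 = w" "\<And>i. f (H i) = g i"
    by (simp_all add: f_def)
  have gK: "{a, b, g i} \<in> E" "{x, w, g i} \<in> E" if "i \<in> {1..t}" for i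
    using bij_betwE[OF g] K(1) that by (auto simp: N_def)
  have ne: "a \<noteq> g i" "b \<noteq> g i" "x \<noteq> g i" "w \<noteq> g i" "g i \<in> V" if "i \<in> {1..t}" for i
    using edge_distinct[OF gK(1)[OF that]] edge_distinct[OF gK(2)[OF that]] by auto
  \<comment> \<open>Here positivity of \<open>t\<close> enters: \<open>w\<close> lies in an edge
    together with \<open>x\<close>, hence is a vertex other than \<open>x\<close>.\<close>
  have "1 \<in> {1..t}"
    using tpos by simp
  then have xw: "x \<noteq> w" "w \<in> V"
    using edge_distinct(1,5)[OF gK(2)] by blast+
  note ab = edge_distinct[OF assms(1)]
  have ginj: "g i = g j \<longleftrightarrow> i = j" if "i \<in> {1..t}" "j \<in> {1..t}" for i j
    using inj_on_eq_iff[OF bij_betw_imp_inj_on[OF g]] that by blast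
  have inj: "inj_on f (verts (F5_blowup t))"
    unfolding inj_on_def F5_blowup_def
    using ab xw assms(2) ne ne(1-4)[symmetric] ginj by auto
  have img: "f ` verts (F5_blowup t) \<subseteq> verts (V, E)"
    using ab xw ne by (auto simp: F5_blowup_def)
  have edges: "\<forall>e\<in>edges (F5_blowup t). f ` e \<in> edges (V, E)"
    using assms(1) gK by (auto simp: F5_blowup_def insert_commute)
  show False
    using free inj img edges unfolding contains_copy_def by blast
qed

text \<open>To be read for fixed \<open>x\<close> and varying \<open>w\<close>: in the link of
  \<open>x\<close> every \<open>w\<close> has bounded degree into \<open>S\<close>.\<close>

lemma free_bound_le:
  assumes "{a, b, x} \<in> E" "w \<notin> {a, b}" "S \<subseteq> N a b"
  shows "card (N x w \<inter> S) \<le> t - 1"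
proof -
  have "card (N x w \<inter> S) \<le> card (N a b \<inter> N x w)"
    using assms(3) by (intro card_mono) (auto simp: N_fin)
  also have "\<dots> < t"
    using free_bound assms by blast
  finally show ?thesis by simp
qed

section \<open>Counting link pairs and missing triples\<close>

lemma lk_fin: "finite {(s, u). s \<in> S \<and> u \<in> T \<and> {x, s, u} \<in> E}"
  by (rule finite_subset[of _ "V \<times> V"]) (use edge_distinct in \<open>auto simp: fin\<close>)

lemma lk_sum:
  assumes "finite S"
  shows "lk x S T = (\<Sum>s\<in>S. card (N x s \<inter> T))"
proof -
  have "{(s, u). s \<in> S \<and> u \<in> T \<and> {x, s, u} \<in> E} = (SIGMA s:S. N x s \<inter> T)"
    by (auto simp: N_def)
  then show ?thesis
    unfolding lk_def using card_SigmaI[OF assms, of "\<lambda>s. N x s \<inter> T"] N_fin by simp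
qed

lemma lk_commute: "lk x S T = lk x T S"
proof -
  have "{x, s, u} = {x, u, s}" for s u
    by auto
  then show ?thesis
    unfolding lk_def by (intro card_swap2) metis
qed

lemma lk_mono: "S \<subseteq> S' \<Longrightarrow> T \<subseteq> T' \<Longrightarrow> lk x S T \<le> lk x S' T'"
  unfolding lk_def by (intro card_mono lk_fin) auto

lemma lk_Un1: "lk x (S \<union> S') T \<le> lk x S T + lk x S' T"
proof -
  have "{(s, u). s \<in> S \<union> S' \<and> u \<in> T \<and> {x, s, u} \<in> E} =
      {(s, u). s \<in> S \<and> u \<in> T \<and> {x, s, u} \<in> E} \<union> {(s, u). s \<in> S' \<and> u \<in> T \<and> {x, s, u} \<in> E}"
    by auto
  then show ?thesis
    unfolding lk_def by (simp only: card_Un_le)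
qed

lemma lk_Un2: "lk x T (S \<union> S') \<le> lk x T S + lk x T S'"
  using lk_Un1 lk_commute by metis

lemma lk_le:
  assumes "finite S" "\<And>s. s \<in> S \<Longrightarrow> card (N x s \<inter> T) \<le> k"
  shows "lk x S T \<le> card S * k"
  unfolding lk_sum[OF assms(1)] using sum_bounded_above[of S "\<lambda>s. card (N x s \<inter> T)" k] assms(2)
  by simp

lemma lk_le_V:
  assumes "finite S"
  shows "lk x S T \<le> card S * card V"
  by (rule lk_le[OF assms]) (meson N_card_le N_fin card_mono inf_le1 le_trans)

lemma lk_nlk:
  assumes "finite S" "finite T"
  shows "lk x S T + nlk x S T = card S * card T"
proof -
  let ?L = "{(s, u). s \<in> S \<and> u \<in> T \<and> {x, s, u} \<in> E}"
  let ?M = "{(s, u). s \<in> S \<and> u \<in> T \<and> {x, s, u} \<notin> E}"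
  have "?M \<subseteq> S \<times> T" by auto
  then have "finite ?M" using assms finite_subset by blast
  then have "card (?L \<union> ?M) = card ?L + card ?M"
    by (intro card_Un_disjoint lk_fin) auto
  moreover have "?L \<union> ?M = S \<times> T" by auto
  ultimately show ?thesis
    unfolding lk_def nlk_def by (simp add: card_cartesian_product)
qed

lemma miss_sum:
  assumes "finite A" "finite B" "finite C"
  shows "miss A B C = (\<Sum>a\<in>A. nlk a B C)"
proof -
  have f: "finite {(s, u). s \<in> B \<and> u \<in> C \<and> {a, s, u} \<notin> E}" for a
    by (rule finite_subset[of _ "B \<times> C"]) (auto simp: assms)
  have "{(a, b, c). a \<in> A \<and> b \<in> B \<and> c \<in> C \<and> {a, b, c} \<notin> E} =
    (SIGMA a:A. {(s, u). s \<in> B \<and> u \<in> C \<and> {a, s, u} \<notin> E})"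
    by auto
  then show ?thesis
    unfolding miss_def nlk_def by (simp only:) (intro card_SigmaI assms(1) ballI f)
qed

lemma miss_swap12: "miss A B C = miss B A C"
proof -
  have "{a, b, c} = {b, a, c}" for a b c :: 'a
    by auto
  then show ?thesis
    unfolding miss_def by (intro card_swap12) metis
qed

lemma miss_swap23: "miss A B C = miss A C B"
proof -
  have "{a, b, c} = {a, c, b}" for a b c :: 'a
    by auto
  then show ?thesis
    unfolding miss_def by (intro card_swap23) metis
qed

lemma miss_pairs:
  assumes "finite A" "finite B" "finite C"
  shows "miss A B C = (\<Sum>(b, c)\<in>B \<times> C. card (A - N b c))"
proof -
  have "{(a, b, c). a \<in> A \<and> b \<in> B \<and> c \<in> C \<and> {a, b, c} \<notin> E} =
    (\<lambda>((b, c), a). (a, b, c)) ` (SIGMA p:B \<times> C. A - N (fst p) (snd p))"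
    (is "?L = ?f ` ?R")
  proof -
    have "{b, c, a} = {a, b, c}" for a b c :: 'a
      by auto
    then have "?L = {(a, b, c). ((b, c), a) \<in> ?R}"
      by (auto simp: N_def)
    also have "\<dots> = ?f ` ?R"
      by (force simp: image_iff)
    finally show ?thesis .
  qed
  then have "miss A B C = card (SIGMA p:B \<times> C. A - N (fst p) (snd p))"
    unfolding miss_def by (simp add: card_image inj_on_def)
  also have "\<dots> = (\<Sum>p\<in>B \<times> C. card (A - N (fst p) (snd p)))"
    using assms by (intro card_SigmaI) auto
  finally show ?thesis by (simp add: case_prod_unfold)
qed

end

section \<open>An approximate tripartition\<close>

lemma ex_max_nat:
  fixes f :: "'b \<Rightarrow> nat"
  assumes "finite S" "S \<noteq> {}"
  obtains m where "m \<in> S" "\<And>x. x \<in> S \<Longrightarrow> f x \<le> f m"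
proof -
  have "Max (f ` S) \<in> f ` S"
    using assms by (intro Max_in) auto
  then obtain m where "m \<in> S" "Max (f ` S) = f m"
    by auto
  then show ?thesis
    using that assms(1) by (metis Max_ge finite_imageI image_eqI)
qed

text \<open>Writing \<open>b = 1/3 + u\<close> and \<open>a = 1/3 + v\<close>, the second bound reads \<open>v/3 + u\<^sup>2 + uv \<le> 2e\<close>.\<close>

lemma part_density_bounds:
  fixes a b e :: real
  assumes "0 < e" "e \<le> 1/1000" "b \<le> a" "0 \<le> b"
    and h1: "2/9 - 2 * e \<le> (1 - a) * b"
    and h2: "1/9 - 2 * e \<le> (1 - a - b) * b"
  shows "\<bar>a - 1/3\<bar> \<le> 7 * e" "\<bar>b - 1/3\<bar> \<le> 7 * e"
proof -
  define u v where "u = b - 1/3" and "v = a - 1/3"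
  have uv: "b = 1/3 + u" "a = 1/3 + v" "u \<le> v"
    using assms by (auto simp: u_def v_def)
  have "(1 - a) * b \<le> (1 - b) * b"
    using assms by (intro mult_right_mono) auto
  \<comment> \<open>\<open>(1 - b) * b - 2/9\<close> vanishes at 1/3 and 2/3, so \<open>h1\<close>
    keeps \<open>b\<close> from falling far below 1/3 but not from exceeding it; the upper bounds
    come from \<open>h2\<close>.\<close>
  then have q: "(1/3 - b) * (2/3 - b) \<le> 2 * e"
  proof -
    have "(1/3 - b) * (2/3 - b) = 2/9 - (1 - b) * b"
      by (simp add: field_simps)
    then show ?thesis
      using h1 \<open>(1 - a) * b \<le> (1 - b) * b\<close> by linarith
  qed
  have lo: "u \<ge> - 6 * e"
  proof (rule ccontr)
    assume "\<not> ?thesis"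
    then have "6 * e < 1/3 - b" "1/3 \<le> 2/3 - b"
      using assms uv by auto
    then have "6 * e * (1/3) < (1/3 - b) * (2/3 - b)"
      using assms by (intro mult_less_le_imp_less) auto
    with q show False by simp
  qed
  have m: "v / 3 + u\<^sup>2 + u * v \<le> 2 * e"
  proof -
    have "(1 - a - b) * b = 1/9 - v / 3 - u\<^sup>2 - u * v"
      unfolding uv by (simp add: field_simps power2_eq_square)
    then show ?thesis
      using h2 by linarith
  qed
  have v: "v \<le> 7 * e"
  proof (cases "v \<ge> 0")
    case True
    have "- 6 * e * v \<le> u * v"
      using lo True by (intro mult_right_mono) auto
    moreover have "e * v \<le> v / 1000"
      using assms True mult_right_mono[of e "1/1000" v] by simp
    ultimately have "v / 3 - 6 * v / 1000 \<le> 2 * e"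
      using m zero_le_power2[of u] by linarith
    then show ?thesis using assms by linarith
  qed (use assms in linarith)
  show "\<bar>a - 1/3\<bar> \<le> 7 * e" "\<bar>b - 1/3\<bar> \<le> 7 * e"
    using lo v uv assms by auto
qed

context blowup_free
begin

text \<open>The second codegree maximum in the tripartition argument is taken outside two vertices;
  these uncontrolled vertices are charged \<open>card V\<close> each.\<close>

lemma lk_le_max:
  assumes "finite S" "\<And>w. w \<in> S - {y, z} \<Longrightarrow> card (N x w) \<le> k"
  shows "lk x S T \<le> card S * k + 2 * card V"
proof -
  have "lk x S T \<le> lk x ((S - {y, z}) \<union> {y, z}) T"
    by (intro lk_mono) auto
  also have "\<dots> \<le> lk x (S - {y, z}) T + lk x {y, z} T"
    by (rule lk_Un1)
  also have "lk x (S - {y, z}) T \<le> card (S - {y, z}) * k"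
  proof (rule lk_le)
    fix s assume "s \<in> S - {y, z}"
    then show "card (N x s \<inter> T) \<le> k"
      using assms(2) by (meson N_fin card_mono inf_le1 le_trans)
  qed (use assms in simp)
  also have "\<dots> \<le> card S * k"
    by (simp add: assms(1) card_mono)
  also have "lk x {y, z} T \<le> card {y, z} * card V"
    by (rule lk_le_V) simp
  also have "\<dots> \<le> 2 * card V"
    by (simp add: card_insert_if)
  finally show ?thesis by simp
qed

text \<open>Let \<open>a\<close>, \<open>b\<close>, \<open>z\<close> be the densities of the first
  neighbourhood, the second one and the rest. In the link of a vertex \<open>x\<close> of
  \<open>A\<close> few pairs meet \<open>A\<close>, and outside \<open>A\<close> codegrees with
  \<open>x\<close> are at most \<open>b * n\<close>; so 2/9 is at most \<open>(1 - a) * b\<close>.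
  Pairs inside \<open>B\<close> are rare as well, so almost all pairs meet \<open>Z\<close> and,
  counted from there in both orders, give that 2/9 is at most \<open>2 * z * b\<close>.
  \<open>part_density_bounds\<close> resolves these inequalities, and as they are then nearly tight,
  few crossing triples are missing.\<close>

lemma approximate_tripartition:
  fixes \<epsilon> :: real
  assumes eps: "0 < \<epsilon>" "\<epsilon> \<le> 1/1000"
    and big: "10 * real t + 20 \<le> \<epsilon> * card V"
    and deg: "\<And>x. x \<in> V \<Longrightarrow> (2/9 - \<epsilon>) * (real (card V))\<^sup>2 \<le> lk x V V"
  obtains A B C where "A \<union> B \<union> C = V" "A \<inter> B = {}" "A \<inter> C = {}" "B \<inter> C = {}"
    "\<bar>card A - real (card V) / 3\<bar> \<le> 20 * \<epsilon> * card V"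
    "\<bar>card B - real (card V) / 3\<bar> \<le> 20 * \<epsilon> * card V"
    "\<bar>card C - real (card V) / 3\<bar> \<le> 20 * \<epsilon> * card V"
    "miss A B C \<le> 25 * \<epsilon> * (real (card V)) ^ 3"
proof -
  define n where "n = real (card V)"
  have en: "10 * real t + 20 \<le> \<epsilon> * n"
    using big by (simp add: n_def)
  have n_pos: "n > 0"
    using en eps by (auto simp: n_def intro: ccontr)
  have "\<epsilon> * n \<le> 1/1000 * n"
    using eps n_pos by (intro mult_right_mono) auto
  then have n_big: "n \<ge> 20000"
    using en by linarith
  have Vne: "V \<noteq> {}"
    using n_pos by (auto simp: n_def)
  obtain p where p: "p \<in> V \<times> V" "\<And>q. q \<in> V \<times> V \<Longrightarrow> card (N (fst q) (snd q)) \<le> card (N (fst p) (snd p))"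
    using ex_max_nat[of "V \<times> V" "\<lambda>q. card (N (fst q) (snd q))"] fin Vne by blast
  define y0 z0 where "y0 = fst p" and "z0 = snd p"
  define A where "A = N y0 z0"
  define \<Delta> where "\<Delta> = card A"
  have AV: "A \<subseteq> V" and Af: "finite A"
    by (auto simp: A_def N_sub N_fin)
  have max1: "card (N x w) \<le> \<Delta>" for x w
  proof (cases "x \<in> V \<and> w \<in> V")
    case True
    then show ?thesis
      using p(2)[of "(x, w)"] by (simp add: \<Delta>_def A_def y0_def z0_def)
  next
    case False
    then have "N x w = {}"
      using edge_distinct by (auto simp: N_def)
    then show ?thesis by simp
  qed
  obtain v where "v \<in> V" using Vne by auto
  \<comment> \<open>Averaging over one link bounds \<open>\<Delta>\<close> from below. The purpose
    is \<open>\<Delta> \<ge> 3\<close>: some vertex of \<open>A\<close> must avoid both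
    \<open>x0\<close> and \<open>w0\<close>.\<close>
  have "lk v V V \<le> card V * \<Delta>"
    by (rule lk_le[OF fin]) (meson max1 N_fin card_mono inf_le1 le_trans)
  then have "real (lk v V V) \<le> n * \<Delta>"
    unfolding n_def by (metis of_nat_le_iff of_nat_mult)
  then have "(2/9 - \<epsilon>) * n\<^sup>2 \<le> n * \<Delta>"
    using deg[OF \<open>v \<in> V\<close>] by (simp add: n_def)
  then have "n * ((2/9 - \<epsilon>) * n) \<le> n * \<Delta>"
    by (simp add: power2_eq_square algebra_simps)
  then have "(2/9 - \<epsilon>) * n \<le> \<Delta>"
    using n_pos by simp
  moreover have "1/9 * n \<le> (2/9 - \<epsilon>) * n"
    using eps n_pos by (intro mult_right_mono) auto
  ultimately have "\<Delta> \<ge> 3"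
    using n_big by linarith
  have p: "{y0, z0, x} \<in> E" if "x \<in> A" for x
    using that by (simp add: A_def N_def)
  \<comment> \<open>\<open>y0\<close> and \<open>z0\<close> are left out so that
    \<open>free_bound_le\<close> applies with \<open>w0\<close> in the role of \<open>w\<close>;
    this makes \<open>Y\<close> almost disjoint from \<open>A\<close>.\<close>
  define W where "W = V - {y0, z0}"
  have "V - {y0, z0} \<noteq> {}"
  proof
    assume "V - {y0, z0} = {}"
    then have "card V \<le> card {y0, z0}"
      by (intro card_mono) auto
    also have "\<dots> \<le> 2"
      by (simp add: card_insert_if)
    finally show False
      using n_big by (simp add: n_def)
  qed
  then have "A \<times> W \<noteq> {}" "finite (A \<times> W)"
    using \<open>\<Delta> \<ge> 3\<close> Af fin by (auto simp: \<Delta>_def W_def)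
  then obtain q where q: "q \<in> A \<times> W"
      "\<And>r. r \<in> A \<times> W \<Longrightarrow> card (N (fst r) (snd r)) \<le> card (N (fst q) (snd q))"
    using ex_max_nat[of "A \<times> W" "\<lambda>q. card (N (fst q) (snd q))"] by blast
  define x0 w0 where "x0 = fst q" and "w0 = snd q"
  define Y where "Y = N x0 w0"
  define \<Delta>2 where "\<Delta>2 = card Y"
  have x0: "x0 \<in> A" and w0: "w0 \<in> V" "w0 \<notin> {y0, z0}"
    using q(1) by (auto simp: x0_def w0_def W_def)
  have max2: "card (N x w) \<le> \<Delta>2" if "x \<in> A" "w \<in> V - {y0, z0}" for x w
    using q(2)[of "(x, w)"] that by (simp add: \<Delta>2_def Y_def x0_def w0_def W_def)
  have Yf: "finite Y" "Y \<subseteq> V"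
    by (auto simp: Y_def N_fin N_sub)
  have YA: "card (Y \<inter> A) \<le> t - 1"
    unfolding Y_def using free_bound_le[OF p[OF x0] w0(2), of A] by (simp add: A_def)
  define B where "B = Y - A"
  define Z where "Z = V - (A \<union> Y)"
  have part: "A \<union> B \<union> Z = V" "A \<inter> B = {}" "A \<inter> Z = {}" "B \<inter> Z = {}"
    using AV Yf by (auto simp: B_def Z_def)
  have Bf: "finite B" and Zf: "finite Z"
    using Yf fin by (auto simp: B_def Z_def)
  have cB: "card B + card (Y \<inter> A) = \<Delta>2"
    unfolding \<Delta>2_def B_def using card_Un_disjoint[of "Y - A" "Y \<inter> A"] Yf
    by (metis Diff_disjoint Int_Diff_Un finite_Diff finite_Int inf_commute sup_commute Int_Diff_disjoint)
  have cZ: "card Z + \<Delta> + card B = card V"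
  proof -
    have "card V = card (A \<union> B) + card Z"
      using part Af Bf Zf by (metis card_Un_disjoint finite_Un Int_Un_distrib2 Un_empty)
    also have "card (A \<union> B) = card A + card B"
      using part Af Bf by (intro card_Un_disjoint)
    finally show ?thesis by (simp add: \<Delta>_def)
  qed
  have lkA: "lk x V A \<le> (t + 1) * card V" if "x \<in> A" for x
  proof -
    have "lk x V A \<le> lk x ((V - {y0, z0}) \<union> {y0, z0}) A"
      by (intro lk_mono) auto
    also have "\<dots> \<le> lk x (V - {y0, z0}) A + lk x {y0, z0} A"
      by (rule lk_Un1)
    also have "lk x (V - {y0, z0}) A \<le> card (V - {y0, z0}) * (t - 1)"
      using fin free_bound_le[OF p[OF that], of _ A] by (intro lk_le) (auto simp: A_def)
    also have "\<dots> \<le> card V * (t - 1)"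
      by (simp add: fin card_mono)
    also have "lk x {y0, z0} A \<le> card {y0, z0} * card V"
      by (rule lk_le_V) simp
    also have "\<dots> \<le> 2 * card V"
      by (simp add: card_insert_if)
    finally show ?thesis
      using tpos by (cases t) (simp_all add: algebra_simps)
  qed
  have i: "lk x V V \<le> (card Z + card B) * \<Delta>2 + (t + 3) * card V" if "x \<in> A" for x
  proof -
    have "lk x V V \<le> lk x (A \<union> (B \<union> Z)) V"
      using part by (simp add: Un_assoc)
    also have "\<dots> \<le> lk x A V + lk x (B \<union> Z) V"
      by (rule lk_Un1)
    also have "lk x (B \<union> Z) V \<le> card (B \<union> Z) * \<Delta>2 + 2 * card V"
      using max2[OF that] Bf Zf part by (intro lk_le_max[of _ y0 z0]) auto
    also have "card (B \<union> Z) = card Z + card B"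
      using card_Un_disjoint[OF Bf Zf part(4)] by simp
    also have "lk x A V \<le> (t + 1) * card V"
      using lkA[OF that] lk_commute by metis
    finally show ?thesis by (simp add: algebra_simps)
  qed
  have lkZ: "lk x Z S \<le> card Z * \<Delta>2 + 2 * card V" if "x \<in> A" for x S
    using max2[OF that] Zf part by (intro lk_le_max[of _ y0 z0]) auto
  \<comment> \<open>Now \<open>x\<close> itself plays \<open>w\<close> against the edges
    \<open>{x0, w0, y}\<close> and must therefore differ from \<open>x0\<close> and
    \<open>w0\<close>; the gain is that link pairs of \<open>x\<close> inside \<open>B\<close> are
    rare.\<close>
  have ii: "lk x V V \<le> lk x B Z + card Z * \<Delta>2 + (3 * t + 4) * card V" if "x \<in> A" "x \<notin> {x0, w0}" for x
  proof -
    have xw: "{x0, w0, y} \<in> E" if "y \<in> Y" for y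
      using that by (simp add: Y_def N_def)
    have "lk x V V \<le> lk x (A \<union> B \<union> Z) V"
      using part by simp
    also have "\<dots> \<le> lk x A V + lk x B (A \<union> (B \<union> Z)) + lk x Z V"
      using part lk_Un1[of x "A \<union> B" Z V] lk_Un1[of x A B V] by (simp add: Un_assoc)
    also have "lk x B (A \<union> (B \<union> Z)) \<le> lk x B A + lk x B B + lk x B Z"
      using lk_Un2[of x B A "B \<union> Z"] lk_Un2[of x B B Z] by simp
    also have "lk x A V \<le> (t + 1) * card V"
      using lkA[OF that(1)] lk_commute by metis
    also have "lk x B A \<le> lk x V A"
      using part by (intro lk_mono) auto
    also have "\<dots> \<le> (t + 1) * card V"
      by (rule lkA[OF that(1)])
    also have "lk x B B \<le> lk x Y Y"
      by (intro lk_mono) (auto simp: B_def)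
    also have "\<dots> \<le> card Y * (t - 1)"
    proof (rule lk_le[OF Yf(1)])
      fix y assume "y \<in> Y"
      show "card (N x y \<inter> Y) \<le> t - 1"
        using free_bound_le[OF xw[OF \<open>y \<in> Y\<close>] that(2), of Y] by (simp add: Y_def N_commute)
    qed
    also have "\<dots> \<le> card V * t"
      using Yf fin by (intro mult_le_mono card_mono) auto
    also have "lk x Z V \<le> card Z * \<Delta>2 + 2 * card V"
      by (rule lkZ[OF that(1)])
    finally show ?thesis by (simp add: algebra_simps)
  qed
  define a b z where "a = \<Delta> / n" and "b = \<Delta>2 / n" and "z = card Z / n"
  have abz: "real \<Delta> = a * n" "real \<Delta>2 = b * n" "real (card Z) = z * n"
    using n_pos by (auto simp: a_def b_def z_def)
  have ba: "b \<le> a" "0 \<le> b"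
    using max1[of x0 w0] n_pos by (auto simp: a_def b_def \<Delta>2_def Y_def divide_right_mono)
  have z0: "0 \<le> z" using n_pos by (simp add: z_def)
  define b' where "b' = card B / n"
  have b': "real (card B) = b' * n"
    using n_pos by (auto simp: b'_def)
  have tn: "real t \<le> \<epsilon> / 2 * n" "(3 * real t + 6) \<le> \<epsilon> * n"
    using en by auto
  have "real (card B) \<le> real \<Delta>2" "real \<Delta>2 \<le> card B + real t"
    using cB YA tpos by linarith+
  then have "b' * n \<le> b * n" "b * n \<le> (b' + \<epsilon> / 2) * n"
    using tn by (auto simp: abz b' algebra_simps)
  then have bb: "b' \<le> b" "b \<le> b' + \<epsilon> / 2"
    using n_pos by auto
  have "real (card Z) + real \<Delta> + real (card B) = n"
    using cZ unfolding n_def by (metis of_nat_add)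
  then have "(z + a + b') * n = 1 * n"
    by (simp add: abz b' algebra_simps)
  then have zab: "z + a + b' = 1"
    using n_pos by (metis mult_right_cancel less_irrefl)
  \<comment> \<open>All linear error terms have coefficient at most \<open>3 * t + 6\<close> and fit
    into one \<open>\<epsilon> * n^2\<close>.\<close>
  have err: "c * n \<le> \<epsilon> * n\<^sup>2" if "c \<le> 3 * real t + 6" for c
  proof -
    have "c * n \<le> (\<epsilon> * n) * n"
      using that tn n_pos by (intro mult_right_mono) auto
    then show ?thesis by (simp add: power2_eq_square algebra_simps)
  qed
  have deg': "(2/9 - \<epsilon>) * n\<^sup>2 \<le> lk x V V" if "x \<in> A" for x
    using deg[of x] that AV by (auto simp: n_def)
  have "real (lk x0 V V) \<le> (card Z + card B) * real \<Delta>2 + (real t + 3) * n"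
    using of_nat_mono[OF i[OF x0], where 'a = real] by (simp add: n_def)
  also have "\<dots> \<le> (card Z + card B) * real \<Delta>2 + \<epsilon> * n\<^sup>2"
    by (intro add_left_mono err) auto
  also have "(card Z + card B) * real \<Delta>2 = (1 - a) * b * n\<^sup>2"
  proof -
    have "real (card Z + card B) = (z + b') * n"
      by (simp add: abz b' algebra_simps)
    moreover have "z + b' = 1 - a" using zab by simp
    ultimately show ?thesis by (simp add: abz power2_eq_square)
  qed
  finally have "(2/9 - 2 * \<epsilon>) * n\<^sup>2 \<le> (1 - a) * b * n\<^sup>2"
    using deg'[OF x0] by (simp add: algebra_simps)
  then have h1: "2/9 - 2 * \<epsilon> \<le> (1 - a) * b"
    using n_pos by simp
  have lkBZ: "(2/9 - 2 * \<epsilon> - z * b) * n\<^sup>2 \<le> lk x B Z" if "x \<in> A" "x \<notin> {x0, w0}" for x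
  proof -
    have "real (lk x V V) \<le> lk x B Z + card Z * real \<Delta>2 + (3 * real t + 4) * n"
      using of_nat_mono[OF ii[OF that], where 'a = real] by (simp add: n_def)
    also have "(3 * real t + 4) * n \<le> \<epsilon> * n\<^sup>2"
      by (intro err) auto
    also have "card Z * real \<Delta>2 = z * b * n\<^sup>2"
      by (simp add: abz power2_eq_square)
    finally show ?thesis
      using deg'[OF that(1)] by (simp add: algebra_simps)
  qed
  have "card (A - {x0, w0}) > 0"
  proof -
    have "card A \<le> card (A - {x0, w0}) + card {x0, w0}"
      by (metis Diff_Diff_Int Diff_partition card_Un_le diff_card_le_card_Diff finite.emptyI finite_insert le_diff_conv)
    moreover have "card {x0, w0} \<le> 2"
      by (simp add: card_insert_if)
    ultimately show ?thesis
      using \<open>\<Delta> \<ge> 3\<close> by (simp add: \<Delta>_def)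
  qed
  then obtain x1 where x1: "x1 \<in> A" "x1 \<notin> {x0, w0}"
    by (metis DiffE card.empty ex_in_conv less_irrefl)
  \<comment> \<open>The pairs between \<open>B\<close> and \<open>Z\<close> are now counted from
    \<open>Z\<close>, where codegrees are at most \<open>\<Delta>2\<close>; against the lower bound
    \<open>lkBZ\<close> this yields \<open>h2\<close>.\<close>
  have "real (lk x1 B Z) \<le> z * b * n\<^sup>2 + 2 * n"
  proof -
    have "real (lk x1 B Z) \<le> real (card Z) * \<Delta>2 + 2 * n"
      using of_nat_mono[OF lkZ[OF x1(1), of B], where 'a = real] lk_commute[of x1 B Z] by (simp add: n_def)
    then show ?thesis by (simp add: abz power2_eq_square algebra_simps)
  qed
  also have "2 * n \<le> \<epsilon> * n\<^sup>2"
    by (intro err) auto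
  finally have "(2/9 - 2 * \<epsilon> - z * b) * n\<^sup>2 \<le> (z * b + \<epsilon>) * n\<^sup>2"
    using lkBZ[OF x1] by (simp add: algebra_simps)
  then have "2/9 - 2 * \<epsilon> - z * b \<le> z * b + \<epsilon>"
    by (rule mult_right_le_imp_le) (use n_pos in simp)
  then have "2/9 - 3 * \<epsilon> \<le> 2 * (z * b)"
    by linarith
  moreover have "z * b \<le> (1 - a - b) * b + \<epsilon> / 2"
  proof -
    have "z \<le> 1 - a - b + \<epsilon> / 2" using zab bb by simp
    then have "z * b \<le> (1 - a - b + \<epsilon> / 2) * b"
      using ba by (intro mult_right_mono) auto
    moreover have "\<epsilon> * b \<le> \<epsilon> * 1"
      using ba zab z0 bb eps by (intro mult_left_mono) linarith+
    ultimately show ?thesis by (simp add: algebra_simps)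
  qed
  ultimately have h2: "1/9 - 2 * \<epsilon> \<le> (1 - a - b) * b"
    by simp
  note dens = part_density_bounds[OF eps ba h1 h2]
  have zlo: "z \<le> 1/3 + 15 * \<epsilon>" "z \<ge> 1/3 - 14 * \<epsilon>"
    using dens zab bb by linarith+
  have zb: "z * b \<le> 1/9 + 8 * \<epsilon>"
  proof -
    have "z * b \<le> (1/3 + 15 * \<epsilon>) * (1/3 + 7 * \<epsilon>)"
      using zlo dens ba z0 eps by (intro mult_mono) auto
    also have "\<dots> = 1/9 + (22/3 + 105 * \<epsilon>) * \<epsilon>"
      by (simp add: algebra_simps power2_eq_square)
    also have "(22/3 + 105 * \<epsilon>) * \<epsilon> \<le> 8 * \<epsilon>"
      using eps by (intro mult_right_mono) auto
    finally show ?thesis by simp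
  qed
  have nl: "real (nlk x B Z) \<le> 18 * \<epsilon> * n\<^sup>2" if "x \<in> A" "x \<notin> {x0, w0}" for x
  proof -
    have "real (lk x B Z) + nlk x B Z = card B * real (card Z)"
      using lk_nlk[OF Bf Zf, of x] by (metis of_nat_add of_nat_mult)
    also have "\<dots> = b' * z * n\<^sup>2"
      by (simp add: abz b' power2_eq_square)
    also have "\<dots> \<le> b * z * n\<^sup>2"
      using bb z0 by (intro mult_right_mono) auto
    finally have "real (nlk x B Z) \<le> (2 * (z * b) - 2/9 + 2 * \<epsilon>) * n\<^sup>2"
      using lkBZ[OF that] by (simp add: algebra_simps)
    also have "\<dots> \<le> 18 * \<epsilon> * n\<^sup>2"
      using zb by (intro mult_right_mono) auto
    finally show ?thesis .
  qed
  have nl0: "real (nlk x B Z) \<le> n\<^sup>2" for x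
  proof -
    have "nlk x B Z \<le> card B * card Z"
      using lk_nlk[OF Bf Zf, of x] by simp
    also have "\<dots> \<le> card V * card V"
      using part fin by (intro mult_le_mono card_mono) auto
    finally show ?thesis
      unfolding n_def power2_eq_square by (metis of_nat_le_iff of_nat_mult)
  qed
  have "real (miss A B Z) = (\<Sum>x\<in>A. real (nlk x B Z))"
    using miss_sum[OF Af Bf Zf] by simp
  \<comment> \<open>The two exceptional vertices are granted all \<open>n^2\<close> pairs.\<close>
  also have "\<dots> \<le> (\<Sum>x\<in>A. 18 * \<epsilon> * n\<^sup>2 + (if x \<in> {x0, w0} then n\<^sup>2 else 0))"
    using nl nl0 eps by (intro sum_mono) (auto intro: add_increasing)
  also have "\<dots> = card A * (18 * \<epsilon> * n\<^sup>2) + card (A \<inter> {x0, w0}) * n\<^sup>2"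
    using sum.inter_restrict[OF Af, of "\<lambda>_. n\<^sup>2" "{x0, w0}"] by (simp only: sum.distrib sum_constant)
  also have "\<dots> \<le> n * (18 * \<epsilon> * n\<^sup>2) + 2 * n\<^sup>2"
  proof (intro add_mono mult_right_mono)
    show "real (card A) \<le> n" using AV fin by (simp add: n_def card_mono)
    have "card (A \<inter> {x0, w0}) \<le> card {x0, w0}" by (intro card_mono) auto
    also have "\<dots> \<le> 2" by (simp add: card_insert_if)
    finally show "real (card (A \<inter> {x0, w0})) \<le> 2" by simp
  qed (use eps in auto)
  also have "2 * n\<^sup>2 \<le> (\<epsilon> * n) * n\<^sup>2"
    using en by (intro mult_right_mono) auto
  finally have "real (miss A B Z) \<le> 19 * \<epsilon> * n ^ 3"
    by (simp add: power2_eq_square power3_eq_cube algebra_simps)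
  also have "\<dots> \<le> 25 * \<epsilon> * n ^ 3"
    using eps n_pos by (intro mult_right_mono) auto
  finally have m: "real (miss A B Z) \<le> 25 * \<epsilon> * n ^ 3" .
  have sz: "\<bar>c * n - n / 3\<bar> \<le> 20 * \<epsilon> * n" if "\<bar>c - 1/3\<bar> \<le> 20 * \<epsilon>" for c
  proof -
    have "c * n - n / 3 = (c - 1/3) * n"
      by (simp add: algebra_simps)
    then have "\<bar>c * n - n / 3\<bar> = \<bar>c - 1/3\<bar> * n"
      using n_pos by (simp add: abs_mult)
    also have "\<dots> \<le> 20 * \<epsilon> * n"
      using that n_pos by (intro mult_right_mono) auto
    finally show ?thesis .
  qed
  show ?thesis
  proof (rule that[of A B Z])
    show "\<bar>card A - real (card V) / 3\<bar> \<le> 20 * \<epsilon> * card V"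
      using sz[of a] dens eps by (simp add: abz[unfolded \<Delta>_def] n_def[symmetric])
    show "\<bar>card B - real (card V) / 3\<bar> \<le> 20 * \<epsilon> * card V"
      using sz[of b'] dens bb eps by (simp add: b' n_def[symmetric])
    show "\<bar>card Z - real (card V) / 3\<bar> \<le> 20 * \<epsilon> * card V"
      using sz[of z] zlo eps by (simp add: abz n_def[symmetric])
  qed (use part m in \<open>auto simp: n_def\<close>)
qed

end

section \<open>Assigning every vertex to a part\<close>

text \<open>\<open>\<kappa>\<close> is the error of the tripartition, \<open>\<eta>\<close> the link
  density that decides the class of a vertex. The relation
  \<open>4 * \<kappa> \<le> \<eta>^2\<close> makes the number of missing triples found in
  \<open>not_both_dense\<close>, of order \<open>\<eta>^2 * n^3\<close>, too large.\<close>

locale dense_blowup_free = blowup_free +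
  fixes \<kappa> \<eta> :: real
  assumes kappa: "0 < \<kappa>" "\<kappa> \<le> 1/1000"
    and eta: "0 < \<eta>" "\<eta> \<le> 1/100" "4 * \<kappa> \<le> \<eta>\<^sup>2"
    and big: "10 * real t + 20 \<le> \<kappa> * card V"
    and deg: "v \<in> V \<Longrightarrow> (2/9 - \<kappa>) * (real (card V))\<^sup>2 \<le> lk v V V"
begin

abbreviation n :: real where "n \<equiv> real (card V)"

definition near_tripartition :: "'a set \<Rightarrow> 'a set \<Rightarrow> 'a set \<Rightarrow> bool" where
  "near_tripartition A B C \<longleftrightarrow> A \<union> B \<union> C = V \<and> A \<inter> B = {} \<and> A \<inter> C = {} \<and> B \<inter> C = {} \<and>
    (\<forall>P\<in>{A, B, C}. \<bar>card P - n / 3\<bar> \<le> \<kappa> * n) \<and> miss A B C \<le> \<kappa> * n ^ 3"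

text \<open>The part of a vertex is read off from its link: \<open>cls B C\<close> is going to
  replace \<open>A\<close>, \<open>cls A C\<close> to replace \<open>B\<close>, and
  \<open>cls A B\<close> to replace \<open>C\<close>.\<close>

definition cls :: "'a set \<Rightarrow> 'a set \<Rightarrow> 'a set" where
  "cls S T = {v \<in> V. \<eta> * n\<^sup>2 \<le> lk v S T}"

lemma cls_commute: "cls S T = cls T S"
  by (simp add: cls_def lk_commute)

lemma near_swap12: "near_tripartition A B C \<Longrightarrow> near_tripartition B A C"
  unfolding near_tripartition_def using miss_swap12[of A B C] by (simp add: Un_ac Int_commute)

lemma near_swap23: "near_tripartition A B C \<Longrightarrow> near_tripartition A C B"
  unfolding near_tripartition_def using miss_swap23[of A B C] by (simp add: Un_ac Int_commute)

lemma n_big: "n \<ge> 20000"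
proof -
  have "\<kappa> * n \<le> 1/1000 * n"
    using kappa by (intro mult_right_mono) auto
  then show ?thesis
    using big by linarith
qed

lemma near_fin:
  assumes "near_tripartition A B C"
  shows "finite A" "finite B" "finite C" "A \<subseteq> V" "B \<subseteq> V" "C \<subseteq> V"
  using assms fin by (auto simp: near_tripartition_def)

lemma near_size:
  assumes "near_tripartition A B C" "P \<in> {A, B, C}"
  shows "\<bar>card P - n / 3\<bar> \<le> \<kappa> * n" "real (card P) \<ge> 332/1000 * n"
proof -
  show a: "\<bar>card P - n / 3\<bar> \<le> \<kappa> * n"
    using assms by (auto simp: near_tripartition_def)
  have "\<kappa> * n \<le> 1/1000 * n"
    using kappa by (intro mult_right_mono) auto
  then show "real (card P) \<ge> 332/1000 * n"
    using a by linarith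
qed

lemma linear_le_quadratic:
  assumes "c \<le> 10 * real t + 20"
  shows "c * n \<le> \<kappa> * n\<^sup>2"
proof -
  have "c * n \<le> (\<kappa> * n) * n"
    using assms big by (intro mult_right_mono) auto
  then show ?thesis
    by (simp add: power2_eq_square algebra_simps)
qed

lemma card_V_minus_bound:
  assumes "card X \<le> c * n" "X \<subseteq> V"
  shows "real (lk v X T) \<le> c * n\<^sup>2"
proof -
  have "finite X" using assms(2) fin finite_subset by blast
  then have "lk v X T \<le> card X * card V"
    by (rule lk_le_V)
  then have "real (lk v X T) \<le> card X * n"
    by (metis of_nat_le_iff of_nat_mult)
  also have "\<dots> \<le> (c * n) * n"
    using assms by (intro mult_right_mono) auto
  finally show ?thesis by (simp add: power2_eq_square algebra_simps)
qed

text \<open>Some pair \<open>b\<close>, \<open>c\<close> avoiding \<open>v\<close> is joined to all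
  but \<open>20 * \<kappa> * n\<close> vertices of \<open>A\<close>, and with \<open>v\<close> in
  the role of \<open>w\<close> the link of \<open>v\<close> has bounded degrees inside
  \<open>A \<inter> N b c\<close>. The other vertices of \<open>A\<close> cost 20 twice and the
  linear term costs 1, hence 41.\<close>

lemma lk_within_part:
  assumes tri: "near_tripartition A B C"
  shows "real (lk v A A) \<le> 41 * \<kappa> * n\<^sup>2"
proof -
  note f = near_fin[OF tri]
  \<comment> \<open>Otherwise at least \<open>(n/4)^2\<close> pairs would miss
    \<open>20 * \<kappa> * n\<close> vertices each, 5/4 of the permitted
    \<open>\<kappa> * n^3\<close>; this is where the 20 comes from.\<close>
  have "\<exists>b\<in>B - {v}. \<exists>c\<in>C - {v}. card (A - N b c) \<le> 20 * \<kappa> * n"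
  proof (rule ccontr)
    assume "\<not> ?thesis"
    then have h: "20 * \<kappa> * n \<le> card (A - N b c)" if "b \<in> B - {v}" "c \<in> C - {v}" for b c
      using that by force
    have s: "real (card (P - {v})) \<ge> n / 4" if "P \<in> {A, B, C}" for P
    proof -
      have "finite P"
        using f that by auto
      then have "card P \<le> card (P - {v}) + 1"
        using card_Suc_Diff1[of P v] by (cases "v \<in> P") auto
      then have "real (card P) \<le> real (card (P - {v})) + 1"
        by linarith
      then show ?thesis
        using near_size(2)[OF tri that] n_big by linarith
    qed
    have "(n / 4) * (n / 4) * (20 * \<kappa> * n) \<le>
        real (card (B - {v})) * card (C - {v}) * (20 * \<kappa> * n)"
      using s[of B] s[of C] kappa by (intro mult_right_mono mult_mono) auto
    also have "\<dots> = (\<Sum>(b, c)\<in>(B - {v}) \<times> (C - {v}). 20 * \<kappa> * n)"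
      by (simp add: card_cartesian_product)
    also have "\<dots> \<le> (\<Sum>(b, c)\<in>(B - {v}) \<times> (C - {v}). real (card (A - N b c)))"
      using h by (intro sum_mono) auto
    also have "\<dots> \<le> (\<Sum>(b, c)\<in>B \<times> C. real (card (A - N b c)))"
      using f by (intro sum_mono2) auto
    also have "\<dots> = real (miss A B C)"
      using miss_pairs[OF f(1-3)] by (simp add: case_prod_unfold)
    also have "\<dots> \<le> \<kappa> * n ^ 3"
      using tri by (simp add: near_tripartition_def)
    finally have "5/4 * (\<kappa> * n ^ 3) \<le> \<kappa> * n ^ 3"
      by (simp add: power3_eq_cube algebra_simps)
    moreover have "\<kappa> * n ^ 3 > 0"
      using kappa n_big by (intro mult_pos_pos zero_less_power) auto
    ultimately show False by linarith
  qed
  then obtain b c where bc: "b \<noteq> v" "c \<noteq> v" "real (card (A - N b c)) \<le> 20 * \<kappa> * n"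
    by blast
  let ?A0 = "A \<inter> N b c" and ?A1 = "A - N b c"
  have A: "?A0 \<union> ?A1 = A" by auto
  have "lk v ?A0 ?A0 \<le> card ?A0 * (t - 1)"
  proof (rule lk_le)
    fix a assume "a \<in> ?A0"
    then have "{b, c, a} \<in> E" by (simp add: N_def)
    then show "card (N v a \<inter> ?A0) \<le> t - 1"
      using free_bound_le[of b c a v ?A0] bc by (simp add: N_commute)
  qed (use f in auto)
  also have "\<dots> \<le> card V * t"
    using f fin by (intro mult_le_mono card_mono) auto
  finally have "real (lk v ?A0 ?A0) \<le> n * t"
    by (metis of_nat_le_iff of_nat_mult)
  also have "\<dots> = t * n"
    by simp
  also have "\<dots> \<le> \<kappa> * n\<^sup>2"
    by (rule linear_le_quadratic) auto
  finally have 1: "real (lk v ?A0 ?A0) \<le> \<kappa> * n\<^sup>2" .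
  have 2: "real (lk v ?A1 T) \<le> 20 * \<kappa> * n\<^sup>2" for T
    using card_V_minus_bound[OF bc(3), of v T] f by auto
  have "lk v A A \<le> lk v ?A0 A + lk v ?A1 A"
    using lk_Un1[of v ?A0 ?A1 A] A by simp
  moreover have "lk v ?A0 A \<le> lk v ?A0 ?A0 + lk v ?A1 ?A0"
    using lk_Un2[of v ?A0 ?A0 ?A1] A lk_commute[of v ?A0 ?A1] by simp
  ultimately have "real (lk v A A) \<le> real (lk v ?A0 ?A0) + lk v ?A1 ?A0 + lk v ?A1 A"
    by linarith
  then show ?thesis
    using 1 2[of ?A0] 2[of A] by linarith
qed

text \<open>Fix \<open>b'\<close> with at least \<open>\<eta> * n\<close> vertices of
  \<open>A\<close> in \<open>N v b'\<close>. For a link pair \<open>(b, c)\<close> of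
  \<open>v\<close> with \<open>b \<noteq> b'\<close>, freeness puts fewer than \<open>t\<close> of
  these vertices into \<open>N b c\<close>, so nearly all of them form missing triples with
  \<open>b\<close> and \<open>c\<close>. About \<open>\<eta> * n^2\<close> such pairs exceed the
  budget \<open>\<kappa> * n^3\<close>.\<close>

lemma not_both_dense:
  assumes tri: "near_tripartition A B C"
    and d1: "\<eta> * n\<^sup>2 \<le> lk v B C" and d2: "\<eta> * n\<^sup>2 \<le> lk v B A"
  shows False
proof -
  note f = near_fin[OF tri]
  have "\<exists>b\<in>B. \<eta> * n \<le> card (N v b \<inter> A)"
  proof (rule ccontr)
    assume "\<not> ?thesis"
    then have h: "real (card (N v b \<inter> A)) < \<eta> * n" if "b \<in> B" for b
      using that by force
    have "B \<noteq> {}"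
      using near_size(2)[OF tri, of B] n_big by auto
    have "real (lk v B A) = (\<Sum>b\<in>B. real (card (N v b \<inter> A)))"
      using lk_sum[OF f(2)] by simp
    also have "\<dots> < (\<Sum>b\<in>B. \<eta> * n)"
      using h f \<open>B \<noteq> {}\<close> by (intro sum_strict_mono) auto
    also have "\<dots> = card B * (\<eta> * n)"
      by simp
    also have "\<dots> \<le> n * (\<eta> * n)"
      using f fin eta by (intro mult_right_mono) (auto simp: card_mono)
    finally show False
      using d2 by (simp add: power2_eq_square algebra_simps)
  qed
  then obtain b' where b': "b' \<in> B" "\<eta> * n \<le> card (N v b' \<inter> A)"
    by blast
  let ?P = "{(b, c). b \<in> B - {b'} \<and> c \<in> C \<and> {v, b, c} \<in> E}"
  have few: "real (card (A - N b c)) \<ge> \<eta> * n - t" if "(b, c) \<in> ?P" for b c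
  proof -
    have e: "{b, c, v} \<in> E" "b' \<notin> {b, c}"
      using that b' tri by (auto simp: near_tripartition_def insert_commute)
    have "card (N v b' \<inter> N b c) \<le> t - 1"
      using free_bound_le[OF e, of "N b c"] by simp
    moreover have "card (N v b' \<inter> A) \<le> card (A - N b c) + card (N v b' \<inter> N b c)"
    proof -
      have "card (N v b' \<inter> A) \<le> card ((A - N b c) \<union> (N v b' \<inter> N b c))"
        using f by (intro card_mono) (auto simp: N_fin)
      then show ?thesis
        using card_Un_le le_trans by blast
    qed
    ultimately have "real (card (N v b' \<inter> A)) \<le> card (A - N b c) + real t"
      by linarith
    then show ?thesis
      using b'(2) by linarith
  qed
  have t4: "real t \<le> \<eta> * n / 4"
  proof -
    have "\<eta>\<^sup>2 \<le> \<eta> * 1"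
      unfolding power2_eq_square using eta by (intro mult_left_mono) auto
    then have "4 * \<kappa> * n \<le> \<eta> * n"
      using eta by (intro mult_right_mono) auto
    then show ?thesis
      using big by linarith
  qed
  have "n * n * (4 * \<kappa>) \<le> n * n * \<eta>"
  proof -
    have "\<eta>\<^sup>2 \<le> \<eta> * 1"
      unfolding power2_eq_square using eta by (intro mult_left_mono) auto
    then show ?thesis
      using eta by (intro mult_left_mono) auto
  qed
  then have n4: "n \<le> \<eta> * n\<^sup>2 / 4"
    using linear_le_quadratic[of 1] by (simp add: power2_eq_square algebra_simps)
  have "lk v B C \<le> lk v ((B - {b'}) \<union> {b'}) C"
    by (intro lk_mono) auto
  also have "\<dots> \<le> lk v (B - {b'}) C + lk v {b'} C"
    by (rule lk_Un1)
  also have "lk v {b'} C \<le> card {b'} * card V"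
    by (rule lk_le_V) simp
  finally have "real (lk v B C) \<le> lk v (B - {b'}) C + n"
    by simp
  then have "real (card ?P) \<ge> \<eta> * n\<^sup>2 - \<eta> * n\<^sup>2 / 4"
    using d1 n4 unfolding lk_def[symmetric] by linarith
  then have P: "real (card ?P) \<ge> 3/4 * (\<eta> * n\<^sup>2)"
    by simp
  have fP: "?P \<subseteq> B \<times> C" by auto
  have "(3/4 * (\<eta> * n\<^sup>2)) * (3/4 * (\<eta> * n)) \<le> card ?P * (\<eta> * n - t)"
    using P t4 eta by (intro mult_mono) auto
  also have "\<dots> \<le> (\<Sum>p\<in>?P. real (card (A - N (fst p) (snd p))))"
    using sum_bounded_below[of ?P "\<eta> * n - t" "\<lambda>p. real (card (A - N (fst p) (snd p)))"] few by auto
  also have "\<dots> \<le> (\<Sum>p\<in>B \<times> C. real (card (A - N (fst p) (snd p))))"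
    using f fP by (intro sum_mono2) auto
  also have "\<dots> = real (miss A B C)"
    using miss_pairs[OF f(1-3)] by (simp add: case_prod_unfold)
  also have "\<dots> \<le> \<kappa> * n ^ 3"
    using tri by (simp add: near_tripartition_def)
  finally have "9/16 * (\<eta>\<^sup>2 * n ^ 3) \<le> \<kappa> * n ^ 3"
    by (simp add: power2_eq_square power3_eq_cube algebra_simps)
  moreover have "4 * \<kappa> * n ^ 3 \<le> \<eta>\<^sup>2 * n ^ 3"
    using eta by (intro mult_right_mono) auto
  moreover have "\<kappa> * n ^ 3 > 0"
    using kappa n_big by (intro mult_pos_pos zero_less_power) auto
  ultimately show False by linarith
qed

lemma cls_disjoint:
  assumes "near_tripartition A B C"
  shows "cls B C \<inter> cls A C = {}"
  using not_both_dense[OF near_swap23[OF assms]] by (auto simp: cls_def lk_commute)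

text \<open>\<open>lk v V V\<close> counts crossing pairs in both orders, so 2/9 is halved; the
  losses, \<open>\<kappa>\<close> and three times \<open>41 * \<kappa>\<close>, halve to
  \<open>62 * \<kappa>\<close>.\<close>

lemma lk_crossing_total:
  assumes tri: "near_tripartition A B C" and "v \<in> V"
  shows "(1/9 - 63 * \<kappa>) * n\<^sup>2 \<le> real (lk v B C) + lk v A C + lk v A B"
proof -
  have V: "V = A \<union> (B \<union> C)"
    using tri by (auto simp: near_tripartition_def)
  have s: "lk v S V \<le> lk v S A + lk v S B + lk v S C" for S
    unfolding V using lk_Un2[of v S A "B \<union> C"] lk_Un2[of v S B C] by simp
  have "lk v V V \<le> lk v A V + lk v B V + lk v C V"
    using s[of V] lk_commute by metis
  also have "\<dots> \<le> lk v A A + lk v B B + lk v C C + 2 * (lk v B C + lk v A C + lk v A B)"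
    using s[of A] s[of B] s[of C] lk_commute[of v B A] lk_commute[of v C A] lk_commute[of v C B] by simp
  finally have le: "lk v V V \<le> lk v A A + lk v B B + lk v C C + 2 * (lk v B C + lk v A C + lk v A B)" .
  have "real (lk v V V) \<le> real (lk v A A) + lk v B B + lk v C C
      + 2 * (real (lk v B C) + lk v A C + lk v A B)"
    using of_nat_mono[OF le, where 'a = real] by simp
  moreover have "real (lk v A A) \<le> 41 * \<kappa> * n\<^sup>2" "real (lk v B B) \<le> 41 * \<kappa> * n\<^sup>2"
      "real (lk v C C) \<le> 41 * \<kappa> * n\<^sup>2"
    using lk_within_part tri near_swap12 near_swap23 by meson+
  moreover note deg[OF assms(2)]
  moreover have "\<kappa> * n\<^sup>2 \<ge> 0"
    using kappa by simp
  ultimately show ?thesis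
    by (simp add: algebra_simps)
qed

text \<open>A vertex below the threshold for all three pairs of parts would have crossing density at
  most 3/100, against at least 1/9 - 63/1000.\<close>

lemma cls_cover:
  assumes tri: "near_tripartition A B C" and "v \<in> V"
  shows "v \<in> cls B C \<union> cls A C \<union> cls A B"
proof (rule ccontr)
  assume "\<not> ?thesis"
  then have "real (lk v B C) + lk v A C + lk v A B \<le> 3 * \<eta> * n\<^sup>2"
    using assms(2) by (auto simp: cls_def)
  then have "(1/9 - 63 * \<kappa>) * n\<^sup>2 \<le> (3 * \<eta>) * n\<^sup>2"
    using lk_crossing_total[OF assms] by simp
  moreover have "n\<^sup>2 > 0"
    using n_big by (intro zero_less_power) auto
  ultimately have "1/9 - 63 * \<kappa> \<le> 3 * \<eta>"
    by (metis mult_le_cancel_right_pos)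
  then show False
    using kappa eta by linarith
qed

lemma cls_dense:
  assumes tri: "near_tripartition A B C" and v: "v \<in> cls B C"
  shows "(1/9 - 63 * \<kappa> - 2 * \<eta>) * n\<^sup>2 \<le> lk v B C"
proof -
  have "v \<notin> cls A C" "v \<notin> cls A B"
    using cls_disjoint[OF tri] cls_disjoint[OF near_swap23[OF tri]] v by (auto simp: cls_commute[of C B])
  then have "real (lk v A C) \<le> \<eta> * n\<^sup>2" "real (lk v A B) \<le> \<eta> * n\<^sup>2"
    using v by (auto simp: cls_def)
  then show ?thesis
    using lk_crossing_total[OF tri, of v] v by (simp add: cls_def algebra_simps)
qed

text \<open>A vertex of \<open>A\<close> left out of the class misses at least
  \<open>n^2 / 20\<close> crossing pairs, since 0.332^2 - 0.01 exceeds 1/20; the budget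
  \<open>\<kappa> * n^3\<close> pays for at most \<open>20 * \<kappa> * n\<close> of them.\<close>

lemma card_part_minus_cls:
  assumes tri: "near_tripartition A B C"
  shows "real (card (A - cls B C)) \<le> 20 * \<kappa> * n"
proof -
  note f = near_fin[OF tri]
  have h: "n\<^sup>2 / 20 \<le> nlk v B C" if "v \<in> A - cls B C" for v
  proof -
    have "real (lk v B C) < \<eta> * n\<^sup>2"
      using that f by (auto simp: cls_def)
    moreover have "\<eta> * n\<^sup>2 \<le> 1/100 * n\<^sup>2"
      using eta by (intro mult_right_mono) auto
    moreover have "real (lk v B C) + nlk v B C = card B * real (card C)"
      using lk_nlk[OF f(2,3), of v] by (metis of_nat_add of_nat_mult)
    moreover have "(332/1000 * n) * (332/1000 * n) \<le> card B * real (card C)"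
      using near_size(2)[OF tri] by (intro mult_mono) auto
    ultimately show ?thesis
      by (simp add: power2_eq_square)
  qed
  have "card (A - cls B C) * (n\<^sup>2 / 20) \<le> (\<Sum>v\<in>A - cls B C. real (nlk v B C))"
    using sum_bounded_below[of "A - cls B C" "n\<^sup>2 / 20" "\<lambda>v. real (nlk v B C)"] h by auto
  also have "\<dots> \<le> (\<Sum>v\<in>A. real (nlk v B C))"
    using f by (intro sum_mono2) auto
  also have "\<dots> = real (miss A B C)"
    using miss_sum[OF f(1-3)] by simp
  also have "\<dots> \<le> \<kappa> * n ^ 3"
    using tri by (simp add: near_tripartition_def)
  also have "\<dots> = (20 * \<kappa> * n) * (n\<^sup>2 / 20)"
    by (simp add: power2_eq_square power3_eq_cube)
  finally show ?thesis
    by (rule mult_right_le_imp_le) (use n_big in auto)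
qed

text \<open>The class loses at most \<open>20 * \<kappa> * n\<close> vertices of \<open>A\<close>
  and gains only vertices that left \<open>B\<close> or \<open>C\<close>, at most
  \<open>40 * \<kappa> * n\<close>; one more \<open>\<kappa> * n\<close> is the error in the size of
  \<open>A\<close>.\<close>

lemma card_cls:
  assumes tri: "near_tripartition A B C"
  shows "\<bar>card (cls B C) - n / 3\<bar> \<le> 41 * \<kappa> * n"
proof -
  note f = near_fin[OF tri]
  have cf: "finite (cls B C)"
    using fin by (simp add: cls_def)
  have "cls B C - A \<subseteq> (B - cls A C) \<union> (C - cls A B)"
  proof -
    have "cls B C \<inter> cls A B = {}"
      using cls_disjoint[OF near_swap23[OF tri]] by (simp only: cls_commute[of C B])
    moreover have "cls B C \<subseteq> A \<union> B \<union> C"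
      using tri by (simp add: near_tripartition_def cls_def)
    ultimately show ?thesis
      using cls_disjoint[OF tri] by blast
  qed
  then have "card (cls B C - A) \<le> card ((B - cls A C) \<union> (C - cls A B))"
    using f by (intro card_mono) auto
  also have "\<dots> \<le> card (B - cls A C) + card (C - cls A B)"
    by (rule card_Un_le)
  finally have "card (cls B C - A) \<le> card (B - cls A C) + card (C - cls A B)" .
  moreover have "card (B - cls A C) \<le> 20 * \<kappa> * n" "card (C - cls A B) \<le> 20 * \<kappa> * n"
    using card_part_minus_cls[OF near_swap12[OF tri]]
      card_part_minus_cls[OF near_swap12[OF near_swap23[OF tri]]] by auto
  moreover have "card A \<le> card (cls B C) + card (A - cls B C)"
    using cf f card_mono[of "cls B C \<union> (A - cls B C)" A] card_Un_le[of "cls B C" "A - cls B C"]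
    by fastforce
  moreover have "card (cls B C) \<le> card A + card (cls B C - A)"
    using cf f card_mono[of "A \<union> (cls B C - A)" "cls B C"] card_Un_le[of A "cls B C - A"]
    by fastforce
  moreover note card_part_minus_cls[OF tri] near_size(1)[OF tri insertI1]
  ultimately show ?thesis
    by (simp only: insert_iff simp_thms abs_le_iff) (intro conjI; linarith)
qed

text \<open>The reassignment of vertices costs the dense link \<open>40 * \<kappa>\<close>. With 63
  from \<open>cls_dense\<close> and 30 from the product of the new sizes this makes 133, rounded up
  to 150.\<close>

lemma nlk_cls:
  assumes tri: "near_tripartition A B C" and v: "v \<in> cls B C"
  shows "real (nlk v (cls A C) (cls A B)) \<le> (150 * \<kappa> + 2 * \<eta>) * n\<^sup>2"
proof -
  note f = near_fin[OF tri]
  let ?B = "cls A C" and ?C = "cls A B"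
  have cf: "finite ?B" "finite ?C"
    using fin by (auto simp: cls_def)
  have B: "real (card (B - ?B)) \<le> 20 * \<kappa> * n" and C: "real (card (C - ?C)) \<le> 20 * \<kappa> * n"
    using card_part_minus_cls[OF near_swap12[OF tri]]
      card_part_minus_cls[OF near_swap12[OF near_swap23[OF tri]]] by auto
  have "lk v B C \<le> lk v (?B \<union> (B - ?B)) C"
    by (intro lk_mono) auto
  also have "\<dots> \<le> lk v ?B C + lk v (B - ?B) C"
    by (rule lk_Un1)
  also have "lk v ?B C \<le> lk v ?B (?C \<union> (C - ?C))"
    by (intro lk_mono) auto
  also have "\<dots> \<le> lk v ?B ?C + lk v ?B (C - ?C)"
    by (rule lk_Un2)
  finally have "real (lk v B C) \<le> lk v ?B ?C + real (lk v (C - ?C) ?B) + lk v (B - ?B) C"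
    using lk_commute[of v ?B "C - ?C"] by linarith
  moreover have "real (lk v (C - ?C) ?B) \<le> 20 * \<kappa> * n\<^sup>2" "real (lk v (B - ?B) C) \<le> 20 * \<kappa> * n\<^sup>2"
    by (intro card_V_minus_bound B C; use f in blast)+
  moreover note cls_dense[OF assms]
  moreover have "real (lk v ?B ?C) + nlk v ?B ?C = card ?B * real (card ?C)"
    using lk_nlk[OF cf, of v] by (metis of_nat_add of_nat_mult)
  moreover have "card ?B * real (card ?C) \<le> (1/9 + 30 * \<kappa>) * n\<^sup>2"
  proof -
    have "card ?B \<le> (1/3 + 41 * \<kappa>) * n" "card ?C \<le> (1/3 + 41 * \<kappa>) * n"
      using card_cls[OF near_swap12[OF tri]] card_cls[OF near_swap12[OF near_swap23[OF tri]]]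
      by (auto simp: abs_le_iff algebra_simps)
    then have "card ?B * real (card ?C) \<le> ((1/3 + 41 * \<kappa>) * n) * ((1/3 + 41 * \<kappa>) * n)"
      using kappa by (intro mult_mono) auto
    also have "\<dots> = (1/9 + (82/3 + 1681 * \<kappa>) * \<kappa>) * n\<^sup>2"
      by (simp add: power2_eq_square algebra_simps)
    also have "(82/3 + 1681 * \<kappa>) * \<kappa> \<le> 30 * \<kappa>"
      using kappa by (intro mult_right_mono) auto
    finally show ?thesis by (simp add: mult_right_mono)
  qed
  moreover have "\<kappa> * n\<^sup>2 \<ge> 0"
    using kappa by simp
  ultimately show ?thesis
    by (simp add: algebra_simps)
qed

lemma vertexwise_tripartition:
  assumes tri: "near_tripartition A B C"
  obtains A' B' C' where "A' \<union> B' \<union> C' = V" "A' \<inter> B' = {}" "A' \<inter> C' = {}" "B' \<inter> C' = {}"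
    "\<And>P. P \<in> {A', B', C'} \<Longrightarrow> \<bar>card P - n / 3\<bar> \<le> 41 * \<kappa> * n"
    "\<And>v. v \<in> A' \<Longrightarrow> nlk v B' C' \<le> (150 * \<kappa> + 2 * \<eta>) * n\<^sup>2"
    "\<And>v. v \<in> B' \<Longrightarrow> nlk v A' C' \<le> (150 * \<kappa> + 2 * \<eta>) * n\<^sup>2"
    "\<And>v. v \<in> C' \<Longrightarrow> nlk v A' B' \<le> (150 * \<kappa> + 2 * \<eta>) * n\<^sup>2"
proof (rule that[of "cls B C" "cls A C" "cls A B"])
  note p = near_swap12[OF tri] near_swap23[OF tri] near_swap12[OF near_swap23[OF tri]]
  show "cls B C \<union> cls A C \<union> cls A B = V"
    using cls_cover[OF tri] by (auto simp: cls_def)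
  show "cls B C \<inter> cls A C = {}" "cls B C \<inter> cls A B = {}" "cls A C \<inter> cls A B = {}"
    using cls_disjoint[OF tri] cls_disjoint[OF p(2)] cls_disjoint[OF near_swap23[OF p(1)]]
    by (auto simp: cls_commute)
  show "\<bar>card P - n / 3\<bar> \<le> 41 * \<kappa> * n" if "P \<in> {cls B C, cls A C, cls A B}" for P
    using that card_cls[OF tri] card_cls[OF p(1)] card_cls[OF p(3)] by auto
  show "nlk v (cls A C) (cls A B) \<le> (150 * \<kappa> + 2 * \<eta>) * n\<^sup>2" if "v \<in> cls B C" for v
    by (rule nlk_cls[OF tri that])
  show "nlk v (cls B C) (cls A B) \<le> (150 * \<kappa> + 2 * \<eta>) * n\<^sup>2" if "v \<in> cls A C" for v
    using nlk_cls[OF p(1), of v] that by (simp add: cls_commute)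
  show "nlk v (cls B C) (cls A C) \<le> (150 * \<kappa> + 2 * \<eta>) * n\<^sup>2" if "v \<in> cls A B" for v
    using nlk_cls[OF p(3), of v] that by (simp add: cls_commute)
qed

end

section \<open>Exact edge count of a good tripartition\<close>

context blowup_free
begin

lemma nlk_commute: "nlk x S T = nlk x T S"
proof -
  have "{x, s, u} = {x, u, s}" for s u
    by auto
  then show ?thesis
    unfolding nlk_def by (intro card_swap2) metis
qed

lemma nlk_fin: "finite S \<Longrightarrow> finite T \<Longrightarrow> finite {(s, u). s \<in> S \<and> u \<in> T \<and> {x, s, u} \<notin> E}"
  by (rule finite_subset[of _ "S \<times> T"]) auto

lemma nlk_mono:
  assumes "finite S'" "finite T'" "S \<subseteq> S'" "T \<subseteq> T'"
  shows "nlk x S T \<le> nlk x S' T'"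
  unfolding nlk_def by (intro card_mono nlk_fin) (use assms in auto)

text \<open>The name anticipates \<open>mixed_edge_sparse\<close>: in a good tripartition such a
  pair misses linearly many vertices of the third part.\<close>

definition sparse_pairs :: "'a set \<Rightarrow> 'a set \<Rightarrow> ('a \<times> 'a) set" where
  "sparse_pairs X Y = {(x, y). x \<in> X \<and> y \<in> Y \<and> N x y \<inter> X \<noteq> {}}"

text \<open>As edges have three elements, \<open>x\<close> and \<open>x'\<close> are distinct, and
  these are the edges with exactly two vertices in \<open>X\<close>.\<close>

definition mixed :: "'a set \<Rightarrow> 'a set set" where
  "mixed X = {e \<in> E. \<exists>x\<in>X. \<exists>x'\<in>X. \<exists>y. y \<notin> X \<and> e = {x, x', y}}"

lemma E_fin: "finite E"
  by (rule finite_subset[of _ "Pow V"]) (use edge fin in auto)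

end

text \<open>The factor \<open>t + 1\<close> in \<open>mu\<close> is for \<open>t + 1\<close>
  vertices of one part that need a common link pair; \<open>big\<close> absorbs terms of order
  \<open>t\<close> into small multiples of the number of vertices.\<close>

locale good_tripartition = blowup_free +
  fixes A B C :: "'a set" and \<mu> :: real
  assumes parts: "A \<union> B \<union> C = V" "A \<inter> B = {}" "A \<inter> C = {}" "B \<inter> C = {}"
    and size: "P \<in> {A, B, C} \<Longrightarrow> 3/10 * real (card V) \<le> card P"
    and mu: "(real t + 1) * \<mu> \<le> 1/100"
    and nlkA: "v \<in> A \<Longrightarrow> nlk v B C \<le> \<mu> * (real (card V))\<^sup>2"
    and nlkB: "v \<in> B \<Longrightarrow> nlk v A C \<le> \<mu> * (real (card V))\<^sup>2"
    and nlkC: "v \<in> C \<Longrightarrow> nlk v A B \<le> \<mu> * (real (card V))\<^sup>2"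
    and big: "1000 * (real t + 1) \<le> card V"
begin

abbreviation n :: real where "n \<equiv> real (card V)"

lemma swap12: "good_tripartition V E t B A C \<mu>"
  by unfold_locales (use parts size mu nlkA nlkB nlkC big in \<open>auto simp: nlk_commute[of _ B A]\<close>)

lemma swap23: "good_tripartition V E t A C B \<mu>"
  by unfold_locales (use parts size mu nlkA nlkB nlkC big in \<open>auto simp: nlk_commute[of _ C B]\<close>)

lemma fins: "finite A" "finite B" "finite C"
  using parts fin by auto

lemma n_pos: "n \<ge> 1000"
  using big of_nat_0_le_iff[of t, where 'a = real] by argo

lemma size_minus:
  assumes "P \<in> {A, B, C}"
  shows "29/100 * n \<le> card (P - {y})"
proof -
  have "finite P" using assms fins by auto
  then have "card P \<le> card (P - {y}) + 1"
    using card_Suc_Diff1[of P y] by (cases "y \<in> P") auto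
  then have "real (card P) \<le> real (card (P - {y})) + 1"
    by linarith
  then show ?thesis
    using size[OF assms] n_pos by linarith
qed

text \<open>Given \<open>t\<close> vertices \<open>K\<close> of \<open>N x y\<close> in
  \<open>A\<close>, the links of \<open>x\<close> and of \<open>K\<close> together miss at most
  \<open>n^2 / 100\<close> pairs, so some \<open>b\<close> and \<open>c\<close> other than
  \<open>y\<close> are joined to all of them, against \<open>free_bound\<close>. As \<open>y\<close>
  is arbitrary, the bound serves pairs inside \<open>A\<close> as well as pairs leaving it.\<close>

lemma codegree_within:
  assumes "x \<in> A"
  shows "card (N x y \<inter> A) \<le> t - 1"
proof (rule ccontr)
  assume "\<not> ?thesis"
  then have "t \<le> card (N x y \<inter> A)" by simp
  then obtain K where K: "K \<subseteq> N x y \<inter> A" "card K = t"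
    by (meson obtain_subset_with_card_n)
  have Kf: "finite K"
    using K N_fin finite_subset by blast
  have ex: "\<exists>v\<in>insert x K. {v, b, c} \<notin> E" if "b \<in> B - {y}" "c \<in> C - {y}" for b c
  proof (rule ccontr)
    assume "\<not> ?thesis"
    then have e: "{v, b, c} \<in> E" if "v \<in> insert x K" for v
      using that by blast
    have "{b, c, x} \<in> E"
      using e[of x] by (simp add: insert_commute)
    then have "card (N b c \<inter> N x y) < t"
      using that by (intro free_bound) auto
    moreover have "{b, c, v} = {v, b, c}" for v
      by auto
    then have "K \<subseteq> N b c \<inter> N x y"
      using e K by (auto simp: N_def)
    then have "card K \<le> card (N b c \<inter> N x y)"
      by (intro card_mono) (auto simp: N_fin)
    ultimately show False using K by simp
  qed
  let ?M = "\<lambda>v. {(b, c). b \<in> B \<and> c \<in> C \<and> {v, b, c} \<notin> E}"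
  have "(B - {y}) \<times> (C - {y}) \<subseteq> (\<Union>v\<in>insert x K. ?M v)"
    using ex by blast
  then have "card ((B - {y}) \<times> (C - {y})) \<le> card (\<Union>v\<in>insert x K. ?M v)"
    using Kf fins nlk_fin by (intro card_mono) auto
  also have "\<dots> \<le> (\<Sum>v\<in>insert x K. nlk v B C)"
    unfolding nlk_def using Kf by (intro card_UN_le) auto
  finally have "real (card (B - {y}) * card (C - {y})) \<le> (\<Sum>v\<in>insert x K. real (nlk v B C))"
    by (simp only: card_cartesian_product flip: of_nat_sum)
  also have "\<dots> \<le> (\<Sum>v\<in>insert x K. \<mu> * n\<^sup>2)"
    using nlkA K assms by (intro sum_mono) auto
  also have "\<dots> = card (insert x K) * (\<mu> * n\<^sup>2)"
    by simp
  also have "\<dots> \<le> (real t + 1) * (\<mu> * n\<^sup>2)"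
  proof (rule mult_right_mono)
    show "real (card (insert x K)) \<le> real t + 1"
      using Kf K by (simp add: card_insert_if)
    show "0 \<le> \<mu> * n\<^sup>2"
      using nlkA[OF assms] by (rule order_trans[rotated]) simp
  qed
  also have "\<dots> = (real t + 1) * \<mu> * n\<^sup>2"
    by simp
  also have "\<dots> \<le> 1/100 * n\<^sup>2"
    using mu by (intro mult_right_mono) auto
  finally have "real (card (B - {y})) * card (C - {y}) \<le> 1/100 * n\<^sup>2"
    by simp
  moreover have "(29/100 * n) * (29/100 * n) \<le> real (card (B - {y})) * card (C - {y})"
    using size_minus by (intro mult_mono) auto
  ultimately have "n\<^sup>2 * (29/100 * (29/100)) \<le> n\<^sup>2 * (1/100)"
    by (simp add: power2_eq_square algebra_simps)
  moreover have "n\<^sup>2 > 0"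
    using n_pos by (intro zero_less_power) auto
  ultimately show False
    by simp
qed

text \<open>For \<open>b' \<noteq> b\<close> the edge \<open>{x, b, x'}\<close> leaves fewer than
  \<open>t\<close> vertices of \<open>N x b\<close> to \<open>N x' b'\<close>. So the link of
  \<open>x'\<close> is nearly empty between \<open>B\<close> and \<open>N x b \<inter> C\<close>;
  since it misses few pairs, that set is small.\<close>

lemma mixed_edge_sparse:
  assumes "x \<in> A" "x' \<in> A" "b \<in> B" "{x, x', b} \<in> E"
  shows "n / 5 \<le> card (C - N x b)"
proof -
  let ?S = "N x b \<inter> C" and ?B = "B - {b}"
  have Sf: "finite ?S" by (simp add: N_fin)
  have "lk x' ?B ?S \<le> card ?B * (t - 1)"
  proof (rule lk_le)
    fix b' assume b': "b' \<in> ?B"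
    have "{x, b, x'} \<in> E"
      using assms(4) by (simp add: insert_commute)
    moreover have "b' \<notin> {x, b}"
      using b' assms parts by auto
    ultimately show "card (N x' b' \<inter> ?S) \<le> t - 1"
      by (rule free_bound_le) auto
  qed (use fins in auto)
  then have l: "real (lk x' ?B ?S) \<le> card ?B * real t"
    by (metis diff_le_self le_trans mult_le_mono2 of_nat_le_iff of_nat_mult)
  have "nlk x' ?B ?S \<le> nlk x' B C"
    using fins by (intro nlk_mono) auto
  then have "real (nlk x' ?B ?S) \<le> \<mu> * n\<^sup>2"
    using nlkA[OF assms(2)] by linarith
  also have "\<dots> \<le> 1/100 * n\<^sup>2"
  proof (rule mult_right_mono)
    have "0 \<le> \<mu> * n\<^sup>2"
      using nlkA[OF assms(2)] by (rule order_trans[rotated]) simp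
    then have "0 \<le> \<mu>"
      using n_pos by (simp add: zero_le_mult_iff)
    then have "\<mu> \<le> (real t + 1) * \<mu>"
      by (simp add: algebra_simps)
    then show "\<mu> \<le> 1/100"
      using mu by simp
  qed simp
  finally have m: "real (nlk x' ?B ?S) \<le> 1/100 * n\<^sup>2" .
  have "real (lk x' ?B ?S) + nlk x' ?B ?S = card ?B * real (card ?S)"
    using lk_nlk[OF _ Sf, of ?B x'] fins by (metis finite_Diff of_nat_add of_nat_mult)
  then have "card ?B * (card ?S - real t) \<le> 1/100 * n\<^sup>2"
    using l m by (simp add: algebra_simps)
  have "card ?S - real t \<le> 9/100 * n"
  proof (rule ccontr)
    assume "\<not> ?thesis"
    then have "(29/100 * n) * (9/100 * n) \<le> card ?B * (card ?S - real t)"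
      using size_minus[of B b] by (intro mult_mono) auto
    then have "n\<^sup>2 * (29/100 * (9/100)) \<le> n\<^sup>2 * (1/100)"
      using \<open>card ?B * (card ?S - real t) \<le> 1/100 * n\<^sup>2\<close> by (simp add: power2_eq_square algebra_simps)
    moreover have "n\<^sup>2 > 0"
      using n_pos by (intro zero_less_power) auto
    ultimately show False by simp
  qed
  then have "real (card ?S) \<le> n / 10"
    using big of_nat_0_le_iff[of t, where 'a = real] by argo
  moreover have "real (card C) = card (C - N x b) + real (card ?S)"
    using card_Diff_subset_Int[of C "N x b"] Sf fins card_mono[of C "C \<inter> N x b"]
    by (simp add: Int_commute)
  ultimately show ?thesis
    using size[of C] by simp
qed

lemma sparse_pairs_bound: "card (sparse_pairs A B) * (n / 5) \<le> miss A B C"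
proof -
  have sub: "sparse_pairs A B \<subseteq> A \<times> B"
    by (auto simp: sparse_pairs_def)
  have "n / 5 \<le> card (C - N (fst p) (snd p))" if "p \<in> sparse_pairs A B" for p
    using that mixed_edge_sparse by (auto simp: sparse_pairs_def N_def insert_commute)
  then have "card (sparse_pairs A B) * (n / 5) \<le> (\<Sum>p\<in>sparse_pairs A B. real (card (C - N (fst p) (snd p))))"
    using sum_bounded_below[of "sparse_pairs A B" "n / 5" "\<lambda>p. real (card (C - N (fst p) (snd p)))"] by auto
  also have "\<dots> \<le> (\<Sum>p\<in>A \<times> B. real (card (C - N (fst p) (snd p))))"
    using sub fins by (intro sum_mono2) auto
  also have "\<dots> = real (miss C A B)"
    using miss_pairs[OF fins(3,1,2)] by (simp add: case_prod_unfold)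
  also have "miss C A B = miss A B C"
    using miss_swap12[of C A B] miss_swap23[of A C B] by simp
  finally show ?thesis .
qed

text \<open>A mixed edge \<open>{x, x', y}\<close> is found from the pair \<open>(x, y)\<close> and
  the vertex \<open>x'\<close> of \<open>N x y\<close> in \<open>A\<close>, for which
  \<open>codegree_within\<close> leaves \<open>t - 1\<close> choices.\<close>

lemma card_mixed_le: "card (mixed A) \<le> (card (sparse_pairs A B) + card (sparse_pairs A C)) * (t - 1)"
proof -
  let ?P = "sparse_pairs A B \<union> sparse_pairs A C"
  have Pf: "finite (sparse_pairs A B)" "finite (sparse_pairs A C)"
    by (rule finite_subset[of _ "V \<times> V"]; use parts fin in \<open>auto simp: sparse_pairs_def\<close>)+
  have "mixed A \<subseteq> (\<Union>p\<in>?P. (\<lambda>z. {fst p, snd p, z}) ` (N (fst p) (snd p) \<inter> A))"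
  proof
    fix e assume "e \<in> mixed A"
    then obtain x x' y where e: "e \<in> E" "x \<in> A" "x' \<in> A" "y \<notin> A" "e = {x, x', y}"
      by (auto simp: mixed_def)
    then have "y \<in> B \<union> C" "x' \<in> N x y" "e = {x, y, x'}"
      using parts edge_distinct[of x x' y] by (auto simp: N_def insert_commute)
    then have "(x, y) \<in> ?P"
      using e by (auto simp: sparse_pairs_def)
    then show "e \<in> (\<Union>p\<in>?P. (\<lambda>z. {fst p, snd p, z}) ` (N (fst p) (snd p) \<inter> A))"
      using \<open>x' \<in> N x y\<close> \<open>e = {x, y, x'}\<close> e by force
  qed
  then have "card (mixed A) \<le> card (\<Union>p\<in>?P. (\<lambda>z. {fst p, snd p, z}) ` (N (fst p) (snd p) \<inter> A))"
    using Pf by (intro card_mono) (auto simp: N_fin)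
  also have "\<dots> \<le> (\<Sum>p\<in>?P. card ((\<lambda>z. {fst p, snd p, z}) ` (N (fst p) (snd p) \<inter> A)))"
    using Pf by (intro card_UN_le) auto
  also have "\<dots> \<le> (\<Sum>p\<in>?P. t - 1)"
  proof (rule sum_mono)
    fix p assume "p \<in> ?P"
    then have "fst p \<in> A" by (auto simp: sparse_pairs_def)
    have "card ((\<lambda>z. {fst p, snd p, z}) ` (N (fst p) (snd p) \<inter> A)) \<le> card (N (fst p) (snd p) \<inter> A)"
      by (intro card_image_le) (simp add: N_fin)
    also have "\<dots> \<le> t - 1"
      by (rule codegree_within[OF \<open>fst p \<in> A\<close>])
    finally show "card ((\<lambda>z. {fst p, snd p, z}) ` (N (fst p) (snd p) \<inter> A)) \<le> t - 1" .
  qed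
  also have "\<dots> = card ?P * (t - 1)"
    by simp
  also have "\<dots> \<le> (card (sparse_pairs A B) + card (sparse_pairs A C)) * (t - 1)"
    by (intro mult_le_mono card_Un_le) auto
  finally show ?thesis .
qed

lemma card_mixed: "real (card (mixed A)) * n \<le> 10 * real t * miss A B C"
proof -
  have "card (sparse_pairs A C) * (n / 5) \<le> miss A B C"
    using good_tripartition.sparse_pairs_bound[OF swap23] miss_swap23[of A B C] by simp
  then have "(real (card (sparse_pairs A B)) + card (sparse_pairs A C)) * n \<le> 10 * real (miss A B C)"
    using sparse_pairs_bound by (simp add: algebra_simps)
  have "card (mixed A) \<le> (card (sparse_pairs A B) + card (sparse_pairs A C)) * t"
    using card_mixed_le by (meson diff_le_self le_trans mult_le_mono2)
  then have "real (card (mixed A)) \<le> (real (card (sparse_pairs A B)) + card (sparse_pairs A C)) * t"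
    by (metis of_nat_add of_nat_le_iff of_nat_mult)
  then have "real (card (mixed A)) * n \<le> ((real (card (sparse_pairs A B)) + card (sparse_pairs A C)) * t) * n"
    by (intro mult_right_mono) auto
  also have "\<dots> = t * ((real (card (sparse_pairs A B)) + card (sparse_pairs A C)) * n)"
    by simp
  also have "\<dots> \<le> t * (10 * real (miss A B C))"
    by (intro mult_left_mono \<open>_ \<le> 10 * real (miss A B C)\<close>) auto
  finally show ?thesis by simp
qed

text \<open>Each part has at most \<open>10 * t / n\<close> mixed edges per missing triple, and
  \<open>n\<close> is at least \<open>30 * t\<close>.\<close>

lemma card_mixed_total: "card (mixed A) + card (mixed B) + card (mixed C) \<le> miss A B C"
proof -
  have "real (card (mixed B)) * n \<le> 10 * real t * miss A B C"
    using good_tripartition.card_mixed[OF swap12] miss_swap12[of A B C] by simp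
  moreover have "real (card (mixed C)) * n \<le> 10 * real t * miss A B C"
    using good_tripartition.card_mixed[OF good_tripartition.swap12[OF swap23]]
      miss_swap12[of A C B] miss_swap23[of A B C] by simp
  ultimately have "n * (real (card (mixed A)) + card (mixed B) + card (mixed C)) \<le> 30 * real t * miss A B C"
    using card_mixed by (simp add: algebra_simps)
  also have "\<dots> \<le> n * miss A B C"
    using big by (intro mult_right_mono) auto
  finally have "real (card (mixed A)) + card (mixed B) + card (mixed C) \<le> miss A B C"
    using n_pos by (simp add: mult_le_cancel_left)
  then show ?thesis by linarith
qed

lemma inside_pair_bounded: "pair_bounded t (A, {e \<in> E. e \<subseteq> A})"
  unfolding pair_bounded_def fst_conv snd_conv
proof (intro ballI impI)
  fix x y assume xy: "x \<in> A" "y \<in> A" "x \<noteq> y"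
  have "{e \<in> {e \<in> E. e \<subseteq> A}. {x, y} \<subseteq> e} \<subseteq> (\<lambda>z. {x, y, z}) ` (N x y \<inter> A)"
  proof
    fix e assume "e \<in> {e \<in> {e \<in> E. e \<subseteq> A}. {x, y} \<subseteq> e}"
    then have e: "e \<in> E" "e \<subseteq> A" "{x, y} \<subseteq> e" by auto
    have "card (e - {x, y}) = 1"
      using edge[OF e(1)] e(3) xy card_Diff_subset[of "{x, y}" e] by simp
    then obtain z where "e - {x, y} = {z}"
      using card_1_singletonE by blast
    then have "e = {x, y, z}"
      using e(3) by blast
    then show "e \<in> (\<lambda>z. {x, y, z}) ` (N x y \<inter> A)"
      using e by (auto simp: N_def)
  qed
  then have "card {e \<in> {e \<in> E. e \<subseteq> A}. {x, y} \<subseteq> e} \<le> card ((\<lambda>z. {x, y, z}) ` (N x y \<inter> A))"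
    by (intro card_mono) (auto simp: N_fin)
  also have "\<dots> \<le> card (N x y \<inter> A)"
    by (intro card_image_le) (simp add: N_fin)
  also have "\<dots> \<le> t - 1"
    by (rule codegree_within[OF xy(1)])
  finally show "card {e \<in> {e \<in> E. e \<subseteq> A}. {x, y} \<subseteq> e} \<le> t - 1" .
qed

text \<open>The crossing edges fall short of the full product by exactly \<open>miss A B C\<close>,
  and this deficit pays for the mixed edges.\<close>

lemma edge_count:
  "card E \<le> card A * card B * card C + card {e \<in> E. e \<subseteq> A} + card {e \<in> E. e \<subseteq> B} + card {e \<in> E. e \<subseteq> C}"
proof -
  let ?T = "{(a, b, c). a \<in> A \<and> b \<in> B \<and> c \<in> C \<and> {a, b, c} \<in> E}"
  let ?M = "{(a, b, c). a \<in> A \<and> b \<in> B \<and> c \<in> C \<and> {a, b, c} \<notin> E}"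
  define X where "X = (\<lambda>(a, b, c). {a, b, c}) ` ?T"
  have TM: "?T \<union> ?M = A \<times> B \<times> C" "?T \<inter> ?M = {}" by auto
  have f: "finite ?T" "finite ?M"
    by (rule finite_subset[of _ "A \<times> B \<times> C"]; use fins in auto)+
  have "card ?T + miss A B C = card A * card B * card C"
    unfolding miss_def using card_Un_disjoint[OF f TM(2)] TM(1) by (simp add: card_cartesian_product)
  moreover have "card X \<le> card ?T"
    unfolding X_def by (rule card_image_le[OF f(1)])
  ultimately have X: "card X + miss A B C \<le> card A * card B * card C"
    by linarith
  have "E \<subseteq> X \<union> mixed A \<union> mixed B \<union> mixed C \<union> {e \<in> E. e \<subseteq> A} \<union> {e \<in> E. e \<subseteq> B} \<union> {e \<in> E. e \<subseteq> C}"
  proof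
    fix e assume e: "e \<in> E"
    then obtain x y z where xyz: "e = {x, y, z}"
      using edge card_3_iff by metis
    note d = edge_distinct[of x y z, folded xyz, OF e]
    have perm: "e = {x, z, y}" "e = {y, x, z}" "e = {y, z, x}" "e = {z, x, y}" "e = {z, y, x}"
      using xyz by auto
    have cr: "e \<in> X" if "a \<in> A" "b \<in> B" "c \<in> C" "e = {a, b, c}" for a b c
      using that e unfolding X_def by (intro image_eqI[of _ _ "(a, b, c)"]) auto
    have mi: "e \<in> mixed P" if "a \<in> P" "b \<in> P" "c \<notin> P" "e = {a, b, c}" for a b c P
      using that e unfolding mixed_def by blast
    have ins: "e \<in> {e \<in> E. e \<subseteq> P}" if "x \<in> P" "y \<in> P" "z \<in> P" for P
      using that e xyz by blast
    have V: "x \<in> A \<or> x \<in> B \<or> x \<in> C" "y \<in> A \<or> y \<in> B \<or> y \<in> C" "z \<in> A \<or> z \<in> B \<or> z \<in> C"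
      using d parts by auto
    have two: "e \<in> mixed P \<or> e \<in> {e \<in> E. e \<subseteq> P}"
      if t: "x \<in> P \<and> y \<in> P \<or> x \<in> P \<and> z \<in> P \<or> y \<in> P \<and> z \<in> P" for P
    proof (cases "x \<in> P \<and> y \<in> P \<and> z \<in> P")
      case False
      then consider "x \<in> P" "y \<in> P" "z \<notin> P" | "x \<in> P" "z \<in> P" "y \<notin> P" | "y \<in> P" "z \<in> P" "x \<notin> P"
        using t by blast
      then show ?thesis
        using mi[OF _ _ _ xyz] mi[OF _ _ _ perm(1)] mi[OF _ _ _ perm(3)] by cases simp_all
    qed (use ins in blast)
    have "e \<in> X \<or> e \<in> mixed A \<or> e \<in> mixed B \<or> e \<in> mixed C \<or> e \<in> {e \<in> E. e \<subseteq> A} \<or>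
        e \<in> {e \<in> E. e \<subseteq> B} \<or> e \<in> {e \<in> E. e \<subseteq> C}"
      using V two[of A] two[of B] two[of C] cr[OF _ _ _ xyz] cr[OF _ _ _ perm(1)] cr[OF _ _ _ perm(2)]
        cr[OF _ _ _ perm(3)] cr[OF _ _ _ perm(4)] cr[OF _ _ _ perm(5)] by argo
    then show "e \<in> X \<union> mixed A \<union> mixed B \<union> mixed C \<union> {e \<in> E. e \<subseteq> A} \<union> {e \<in> E. e \<subseteq> B} \<union> {e \<in> E. e \<subseteq> C}"
      by blast
  qed
  then have "card E \<le> card (X \<union> mixed A \<union> mixed B \<union> mixed C \<union> {e \<in> E. e \<subseteq> A} \<union> {e \<in> E. e \<subseteq> B} \<union> {e \<in> E. e \<subseteq> C})"
    using f E_fin by (intro card_mono) (auto simp: X_def mixed_def)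
  also have "\<dots> \<le> card X + card (mixed A) + card (mixed B) + card (mixed C) +
      card {e \<in> E. e \<subseteq> A} + card {e \<in> E. e \<subseteq> B} + card {e \<in> E. e \<subseteq> C}"
    by (intro order_trans[OF card_Un_le] add_mono order_refl)
  finally show ?thesis
    using X card_mixed_total by linarith
qed

end

context blowup_free
begin

lemma exact_tripartition:
  fixes \<mu> \<epsilon> :: real
  defines "\<mu> \<equiv> 1 / (100 * (real t + 1))"
  defines "\<epsilon> \<equiv> \<mu>\<^sup>2 / 25000"
  assumes big: "10 * real t + 20 \<le> \<epsilon> * card V"
    and deg: "\<And>x. x \<in> V \<Longrightarrow> (2/9 - \<epsilon>) * (real (card V))\<^sup>2 \<le> lk x V V"
  obtains A B C where "A \<union> B \<union> C = V" "A \<inter> B = {}" "A \<inter> C = {}" "B \<inter> C = {}"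
    "\<forall>P\<in>{A, B, C}. \<bar>card P - real (card V) / 3\<bar> \<le> real (card V) / 100"
    "\<forall>P\<in>{A, B, C}. pair_bounded t (P, {e \<in> E. e \<subseteq> P})"
    "card E \<le> card A * card B * card C + card {e \<in> E. e \<subseteq> A} + card {e \<in> E. e \<subseteq> B} + card {e \<in> E. e \<subseteq> C}"
proof -
  let ?n = "real (card V)"
  \<comment> \<open>\<open>\<mu>\<close> is dictated by the condition \<open>mu\<close> of
    \<open>good_tripartition\<close>, and 25 is the factor in
    \<open>approximate_tripartition\<close>. Now \<open>\<kappa>\<close> is
    \<open>\<mu>^2 / 1000\<close>, so both \<open>4 * \<kappa> \<le> \<eta>^2\<close> and
    \<open>150 * \<kappa> + 2 * \<eta> \<le> \<mu>\<close> hold.\<close>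
  define \<kappa> \<eta> where "\<kappa> = 25 * \<epsilon>" and "\<eta> = \<mu> / 4"
  have t1: "real t \<ge> 1"
    using tpos by simp
  have mu: "\<mu> > 0" "\<mu> \<le> 1/200"
    using t1 by (auto simp: \<mu>_def field_simps)
  have mu2: "\<mu>\<^sup>2 \<le> \<mu> / 200" "\<mu>\<^sup>2 > 0"
    using mu mult_left_mono[of \<mu> "1/200" \<mu>] by (simp_all add: power2_eq_square)
  have eps: "0 < \<epsilon>" "\<epsilon> \<le> 1/1000"
    using mu mu2 by (auto simp: \<epsilon>_def)
  have en: "\<epsilon> * ?n \<le> \<kappa> * ?n"
    unfolding \<kappa>_def using eps by (intro mult_right_mono) auto
  obtain A B C where ABC: "A \<union> B \<union> C = V" "A \<inter> B = {}" "A \<inter> C = {}" "B \<inter> C = {}"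
    "\<bar>card A - ?n / 3\<bar> \<le> 20 * \<epsilon> * ?n" "\<bar>card B - ?n / 3\<bar> \<le> 20 * \<epsilon> * ?n"
    "\<bar>card C - ?n / 3\<bar> \<le> 20 * \<epsilon> * ?n" "miss A B C \<le> 25 * \<epsilon> * ?n ^ 3"
    using approximate_tripartition[OF eps big deg] by blast
  have d: "dense_blowup_free V E t \<kappa> \<eta>"
  proof unfold_locales
    show "0 < \<kappa>" "\<kappa> \<le> 1/1000" "0 < \<eta>" "\<eta> \<le> 1/100" "4 * \<kappa> \<le> \<eta>\<^sup>2"
      using mu(1) by (simp add: \<kappa>_def \<epsilon>_def, use mu mu2 in \<open>simp add: \<kappa>_def \<epsilon>_def\<close>,
        simp add: \<eta>_def, use mu in \<open>simp add: \<eta>_def\<close>, simp add: \<kappa>_def \<eta>_def \<epsilon>_def power_divide)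
    show "10 * real t + 20 \<le> \<kappa> * ?n"
      using big en by simp
    show "(2/9 - \<kappa>) * ?n\<^sup>2 \<le> lk v V V" if "v \<in> V" for v
    proof -
      have "(2/9 - \<kappa>) * ?n\<^sup>2 \<le> (2/9 - \<epsilon>) * ?n\<^sup>2"
        unfolding \<kappa>_def using eps by (intro mult_right_mono) auto
      then show ?thesis using deg[OF that] by linarith
    qed
  qed
  have k: "20 * \<epsilon> * ?n \<le> \<kappa> * ?n"
    unfolding \<kappa>_def using eps by (intro mult_right_mono) auto
  have tri: "dense_blowup_free.near_tripartition V E \<kappa> A B C"
    unfolding dense_blowup_free.near_tripartition_def[OF d] using ABC k by (auto simp: \<kappa>_def)
  obtain A' B' C' where T: "A' \<union> B' \<union> C' = V" "A' \<inter> B' = {}" "A' \<inter> C' = {}" "B' \<inter> C' = {}"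
    "\<And>P. P \<in> {A', B', C'} \<Longrightarrow> \<bar>card P - ?n / 3\<bar> \<le> 41 * \<kappa> * ?n"
    "\<And>v. v \<in> A' \<Longrightarrow> nlk v B' C' \<le> (150 * \<kappa> + 2 * \<eta>) * ?n\<^sup>2"
    "\<And>v. v \<in> B' \<Longrightarrow> nlk v A' C' \<le> (150 * \<kappa> + 2 * \<eta>) * ?n\<^sup>2"
    "\<And>v. v \<in> C' \<Longrightarrow> nlk v A' B' \<le> (150 * \<kappa> + 2 * \<eta>) * ?n\<^sup>2"
    using dense_blowup_free.vertexwise_tripartition[OF d tri] by metis
  have le: "(150 * \<kappa> + 2 * \<eta>) * ?n\<^sup>2 \<le> \<mu> * ?n\<^sup>2"
  proof (rule mult_right_mono)
    show "150 * \<kappa> + 2 * \<eta> \<le> \<mu>"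
      unfolding \<kappa>_def \<eta>_def \<epsilon>_def using mu(1) mu2(1) by argo
  qed simp
  have size: "\<bar>card P - ?n / 3\<bar> \<le> ?n / 100" if "P \<in> {A', B', C'}" for P
  proof -
    have "41 * \<kappa> * ?n \<le> 1/100 * ?n"
    proof (rule mult_right_mono)
      show "41 * \<kappa> \<le> 1/100"
        unfolding \<kappa>_def \<epsilon>_def using mu(2) mu2(1) by argo
    qed simp
    then show ?thesis using T(5)[OF that] by simp
  qed
  have nt: "1000 * (real t + 1) \<le> ?n"
  proof -
    have "\<epsilon> * ?n \<le> 1/1000 * ?n"
      using eps by (intro mult_right_mono) auto
    then show ?thesis using big t1 by argo
  qed
  have size3: "3/10 * ?n \<le> card P" if "P \<in> {A', B', C'}" for P
    using size[OF that] by linarith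
  have g: "good_tripartition V E t A' B' C' \<mu>"
  proof (intro good_tripartition.intro good_tripartition_axioms.intro)
    show "blowup_free V E t" ..
    show "(real t + 1) * \<mu> \<le> 1/100"
      by (simp add: \<mu>_def)
    show "nlk v B' C' \<le> \<mu> * ?n\<^sup>2" if "v \<in> A'" for v
      by (rule order_trans[OF T(6)[OF that] le])
    show "nlk v A' C' \<le> \<mu> * ?n\<^sup>2" if "v \<in> B'" for v
      by (rule order_trans[OF T(7)[OF that] le])
    show "nlk v A' B' \<le> \<mu> * ?n\<^sup>2" if "v \<in> C'" for v
      by (rule order_trans[OF T(8)[OF that] le])
  qed (fact T(1) T(2) T(3) T(4) size3 nt)+
  note g2 = good_tripartition.swap12[OF g] and g3 = good_tripartition.swap12[OF good_tripartition.swap23[OF g]]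
  show ?thesis
  proof (rule that[of A' B' C'])
    show "\<forall>P\<in>{A', B', C'}. pair_bounded t (P, {e \<in> E. e \<subseteq> P})"
      using g g2 g3 good_tripartition.inside_pair_bounded by auto
    show "card E \<le> card A' * card B' * card C' + card {e \<in> E. e \<subseteq> A'} + card {e \<in> E. e \<subseteq> B'} + card {e \<in> E. e \<subseteq> C'}"
      by (rule good_tripartition.edge_count[OF g])
  qed (use T size in auto)
qed

end

section \<open>Triple packings close to the trivial bound\<close>

lemma dvd_small_int:
  fixes x m :: int
  assumes "m dvd x" "\<bar>x\<bar> < m"
  shows "x = 0"
  using assms zdvd_imp_le[of m "\<bar>x\<bar>"] by (cases "x = 0") auto

text \<open>\<open>l\<close> stands for \<open>t - 1\<close>. Vertices below \<open>M\<close> are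
  residues, \<open>M\<close> and \<open>M + 1\<close> are the two points at infinity, and a colour
  is a prescribed sum \<open>s < l\<close>.\<close>

locale near_design =
  fixes M l :: nat
  assumes large: "4 * l + 10 \<le> M"
begin

text \<open>This is \<open>s - x - y\<close> modulo \<open>M\<close>, written so that no subtraction
  truncates when \<open>x\<close> and \<open>y\<close> are below \<open>M\<close>. In particular
  \<open>third s x x\<close> is the end of the arc of colour \<open>s\<close> that leaves
  \<open>x\<close>.\<close>

definition third :: "nat \<Rightarrow> nat \<Rightarrow> nat \<Rightarrow> nat" where
  "third s x y = (s + (M - x) + (M - y)) mod M"

lemma M_pos: "0 < M"
  using large by simp

lemma third_less: "third s x y < M"
  using M_pos by (simp add: third_def)

lemma third_dvd:
  assumes "x < M" "y < M"
  shows "int M dvd int x + int y + int (third s x y) - int s"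
proof -
  have "int (third s x y) = (int s - int x - int y + 2 * int M) mod int M"
    unfolding third_def using assms by (simp add: of_nat_mod of_nat_diff algebra_simps)
  also have "\<dots> = (int s - int x - int y) mod int M"
    by simp
  finally have "int M dvd int (third s x y) - (int s - int x - int y)"
    by (metis mod_eq_dvd_iff mod_mod_trivial)
  then show ?thesis
    by (simp add: algebra_simps)
qed

lemma third_unique:
  assumes "x < M" "y < M" "z < M" "int M dvd int x + int y + int z - int s"
  shows "z = third s x y"
proof -
  have "int M dvd (int x + int y + int z - int s) - (int x + int y + int (third s x y) - int s)"
    by (rule dvd_diff[OF assms(4) third_dvd[OF assms(1,2)]])
  then have "int M dvd int z - int (third s x y)"
    by (simp add: algebra_simps)
  then have "int z - int (third s x y) = 0"
    by (rule dvd_small_int) (use assms third_less[of s x y] in auto)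
  then show ?thesis by simp
qed

lemma third_commute: "third s x y = third s y x"
  by (simp add: third_def add_ac)

text \<open>Colours from \<open>l mod 2\<close> on are grouped in consecutive pairs. In each pair, the two arcs leaving
  \<open>x\<close> go to different points at infinity, and so do the two arcs entering any \<open>y\<close>: for even
  \<open>M\<close> the parity of \<open>y\<close> selects the colour, and \<open>shift\<close> separates the two solutions of
  \<open>2x + y = s\<close>. For odd \<open>l\<close> the single colour \<open>0\<close> is served by two intervals, each
  disjoint from its image under \<open>x \<mapsto> -2x\<close>.\<close>

definition shift :: "nat \<Rightarrow> nat" where
  "shift x = (if even M \<and> M \<le> 2 * x then 1 else 0)"

definition inf_point :: "nat \<Rightarrow> nat \<Rightarrow> nat" where
  "inf_point x s = (if l mod 2 \<le> s then (s - l mod 2 + shift x) mod 2 else if 3 * x < M then 0 else 1)"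

text \<open>For \<open>s = s'\<close> this rules out an arc that ends where it starts,
  \<open>3x = s\<close> modulo \<open>M\<close>. In general it rules out an arc of colour
  \<open>s\<close> from \<open>x\<close> to \<open>y\<close> with an opposite arc of colour
  \<open>s'\<close>, as \<open>y = s - 2x\<close> and \<open>x = s' - 2y\<close> give
  \<open>3x + s' - 2s = 0\<close>; opposite arcs might yield the same block.\<close>

definition good :: "nat \<Rightarrow> bool" where
  "good x \<longleftrightarrow> (\<forall>s<l. \<forall>s'<l. \<not> int M dvd 3 * int x + int s' - 2 * int s)"

text \<open>The restriction on \<open>x\<close> concerns only colour 0 for odd \<open>l\<close>,
  which has no partner colour: about a third of its arcs is given up.\<close>

definition arcs :: "(nat \<times> nat) set" where
  "arcs = {(x, s). x < M \<and> s < l \<and> good x \<and>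
     (l mod 2 \<le> s \<or> 0 < x \<and> 3 * x < M \<or> M < 3 * x \<and> 3 * x < 2 * M)}"

definition block :: "nat \<Rightarrow> nat \<Rightarrow> nat set" where
  "block x s = {M + inf_point x s, x, third s x x}"

definition sum_triples :: "(nat \<times> nat \<times> nat) set" where
  "sum_triples = {(s, x, y). s < l \<and> x < M \<and> y < M \<and> x \<noteq> y \<and> third s x y \<noteq> x \<and> third s x y \<noteq> y}"

definition sum_block :: "nat \<Rightarrow> nat \<Rightarrow> nat \<Rightarrow> nat set" where
  "sum_block s x y = {x, y, third s x y}"

definition blocks :: "nat set set" where
  "blocks = (\<lambda>(s, x, y). sum_block s x y) ` sum_triples \<union> (\<lambda>(x, s). block x s) ` arcs"

lemma arc_target:
  assumes "x < M"
  shows "int M dvd 2 * int x + int (third s x x) - int s"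
  using third_dvd[OF assms assms, of s] by (simp add: algebra_simps)

lemma inf_point_less: "inf_point x s < 2"
  by (simp add: inf_point_def)

lemma arc_ne:
  assumes "(x, s) \<in> arcs"
  shows "third s x x \<noteq> x"
proof
  assume "third s x x = x"
  then have "int M dvd 3 * int x + int s - 2 * int s"
    using arc_target[of x s] assms by (simp add: arcs_def algebra_simps)
  moreover have "good x" "s < l"
    using assms by (auto simp: arcs_def)
  ultimately show False
    unfolding good_def by blast
qed

lemma blocks_cases:
  assumes "e \<in> blocks"
  obtains s x y where "(s, x, y) \<in> sum_triples" "e = sum_block s x y"
    | x s where "(x, s) \<in> arcs" "e = block x s"
  using assms by (auto simp: blocks_def)

lemma three_graph_blocks: "three_graph ({..<M + 2}, blocks)"
proof -
  have "e \<subseteq> {..<M + 2} \<and> card e = 3" if "e \<in> blocks" for e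
  proof -
    show ?thesis
      using that
    proof (cases rule: blocks_cases)
      case (1 s x y)
      define z where "z = third s x y"
      have "x < M" "y < M" "x \<noteq> y" "z \<noteq> x" "z \<noteq> y" "z < M" "e = {x, y, z}"
        using 1 third_less[of s x y] by (simp_all add: sum_triples_def sum_block_def z_def)
      then show ?thesis by simp
    next
      case (2 x s)
      define y i where "y = third s x x" and "i = inf_point x s"
      have "x < M" "y \<noteq> x" "y < M" "i < 2" "e = {M + i, x, y}"
        using 2 arc_ne[OF 2(1)] third_less[of s x x] inf_point_less[of x s]
        by (simp_all add: arcs_def block_def y_def i_def)
      then show ?thesis by simp
    qed
  qed
  then show ?thesis
    by (auto simp: three_graph_def)
qed

text \<open>The only candidate for a block of colour \<open>s\<close> through \<open>u\<close> and
  \<open>v\<close>. If \<open>third s u v\<close> repeats one of the two vertices, the pair is the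
  arc leaving that vertex. One candidate per colour bounds the multiplicity of a pair of residues by
  \<open>l\<close>.\<close>

definition block_through :: "nat \<Rightarrow> nat \<Rightarrow> nat \<Rightarrow> nat set" where
  "block_through u v s =
    (if third s u v = u then block u s else if third s u v = v then block v s else sum_block s u v)"

lemma block_through:
  assumes uv: "u < M" "v < M" "u \<noteq> v" and e: "e \<in> blocks" "{u, v} \<subseteq> e"
  shows "e \<in> block_through u v ` {..<l}"
proof -
  show ?thesis
    using e(1)
  proof (cases rule: blocks_cases)
    case (1 s x y)
    have s: "s < l" "x < M" "y < M" "x \<noteq> y" "third s x y \<noteq> x" "third s x y \<noteq> y"
      using 1(1) by (auto simp: sum_triples_def)
    define z where "z = third s x y"
    have d: "int M dvd int x + int y + int z - int s" and z: "z < M"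
      using s third_dvd third_less by (auto simp: z_def)
    have "third s x z = y" "third s y z = x"
      using third_unique[of x z y s] third_unique[of y z x s] s z d by (simp_all add: algebra_simps)
    then have t: "third s x y = z" "third s y x = z" "third s x z = y" "third s z x = y"
        "third s y z = x" "third s z y = x"
      using third_commute by (auto simp: z_def)
    have "e = {x, y, z}" "x \<noteq> z" "y \<noteq> z"
      using 1(2) s by (auto simp: sum_block_def z_def)
    then have "(u = x \<or> u = y \<or> u = z) \<and> (v = x \<or> v = y \<or> v = z)"
      using e(2) by auto
    then have "block_through u v s = e"
      using uv(3) t \<open>e = {x, y, z}\<close> \<open>x \<noteq> z\<close> \<open>y \<noteq> z\<close> s(4)
      by (elim conjE disjE) (auto simp: block_through_def sum_block_def)
    then show ?thesis using s by auto
  next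
    case (2 x s)
    have s: "s < l" "x < M"
      using 2(1) by (auto simp: arcs_def)
    define y where "y = third s x x"
    have y: "y < M" "y \<noteq> x"
      using third_less arc_ne[OF 2(1)] by (auto simp: y_def)
    have "int M dvd int x + int y + int x - int s"
      using arc_target[OF s(2), of s] by (simp add: y_def algebra_simps)
    then have t: "third s x y = x" "third s y x = x"
      using third_unique[of x y x s] s y third_commute[of s x y] by auto
    have "u = x \<and> v = y \<or> u = y \<and> v = x"
      using e(2) 2(2) uv by (auto simp: block_def y_def)
    then have "block_through u v s = e"
      using t y 2(2) by (auto simp: block_through_def)
    then show ?thesis using s by auto
  qed
qed

lemma parity_shift:
  fixes a b i :: nat
  assumes "i = (a + b) mod 2"
  shows "(i + b) mod 2 = a mod 2"
  using assms by presburger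

lemma parity_shift_cancel:
  fixes a b i :: nat
  assumes "(i + a) mod 2 = (i + b) mod 2" "a \<le> 1" "b \<le> 1"
  shows "a = b"
  using assms by presburger

lemma parity_digit:
  fixes s s' q k a b :: nat
  assumes "s = q + 2 * k + a mod 2" "s' = q + 2 * k + b mod 2" "even s \<longleftrightarrow> even s'"
  shows "a mod 2 = b mod 2"
  using assms by presburger

text \<open>A colour is recovered from the index of its pair, the point at infinity and the shift of
  the start. So arcs at a fixed vertex and a fixed point at infinity can be counted by indices, of
  which there are \<open>l div 2\<close>.\<close>

lemma pair_index:
  assumes "l mod 2 \<le> s" "s < l" "inf_point x s = i"
  shows "(s - l mod 2) div 2 < l div 2" "s = l mod 2 + 2 * ((s - l mod 2) div 2) + (i + shift x) mod 2"
proof -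
  have "s - l mod 2 < l div 2 * 2"
    using assms(1,2) div_mult_mod_eq[of l 2] by linarith
  then show "(s - l mod 2) div 2 < l div 2"
    by (rule less_mult_imp_div_less)
  have "i = (s - l mod 2 + shift x) mod 2"
    using assms by (simp add: inf_point_def)
  moreover have "shift x \<le> 1"
    by (simp add: shift_def)
  ultimately have "(i + shift x) mod 2 = (s - l mod 2) mod 2"
    using parity_shift by metis
  then show "s = l mod 2 + 2 * ((s - l mod 2) div 2) + (i + shift x) mod 2"
    using assms(1) by (metis add.assoc le_add_diff_inverse mult_div_mod_eq)
qed

text \<open>For odd \<open>M\<close> there is no shift, so the point at infinity fixes the colour,
  and 2 is invertible. For even \<open>M\<close> the colour has the parity of \<open>u\<close>; so
  the point at infinity fixes the shift, hence the half containing the start, and on each half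
  doubling is injective modulo \<open>M\<close>.\<close>

lemma entering_arc_unique:
  assumes "x < M" "x' < M" "s < l" "s' < l" "l mod 2 \<le> s" "l mod 2 \<le> s'"
    and inf: "inf_point x s = i" "inf_point x' s' = i"
    and tgt: "third s x x = u" "third s' x' x' = u"
    and idx: "(s - l mod 2) div 2 = (s' - l mod 2) div 2"
  shows "x = x' \<and> s = s'"
proof -
  note p = pair_index(2)[OF assms(5,3) inf(1)] pair_index(2)[OF assms(6,4) inf(2)]
  have d: "int M dvd 2 * int x + int u - int s" "int M dvd 2 * int x' + int u - int s'"
    using arc_target[OF assms(1), of s] arc_target[OF assms(2), of s'] unfolding tgt by blast+
  have ss: "shift x = shift x'"
  proof (cases "even M")
    case True
    then have "2 dvd 2 * int x + int u - int s" "2 dvd 2 * int x' + int u - int s'"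
      using d dvd_trans by (metis even_of_nat)+
    then have "even s \<longleftrightarrow> even u" "even s' \<longleftrightarrow> even u"
      by simp_all
    then have "(i + shift x) mod 2 = (i + shift x') mod 2"
      using parity_digit[OF p(1) p(2)[folded idx]] by simp
    moreover have "shift x \<le> 1" "shift x' \<le> 1"
      by (simp_all add: shift_def)
    ultimately show ?thesis
      by (rule parity_shift_cancel)
  qed (simp add: shift_def)
  then have s: "s = s'"
    using p idx by metis
  have "int M dvd (2 * int x + int u - int s) - (2 * int x' + int u - int s')"
    using d by (rule dvd_diff)
  then have d2: "int M dvd 2 * (int x - int x')"
    using s by (simp add: algebra_simps)
  have "x = x'"
  proof (cases "even M")
    case True
    have "(M \<le> 2 * x) = (M \<le> 2 * x')"
      using ss True by (auto simp: shift_def split: if_splits)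
    then have "\<bar>2 * (int x - int x')\<bar> < int M"
      using assms(1,2) by (cases "M \<le> 2 * x") (simp_all add: abs_if)
    then show ?thesis
      using dvd_small_int[OF d2] by simp
  next
    case False
    then have "coprime (int M) 2"
      by (simp add: coprime_commute)
    then have "int M dvd int x - int x'"
      using d2 by (metis coprime_dvd_mult_right_iff)
    then show ?thesis
      using dvd_small_int[of "int M" "int x - int x'"] assms(1,2) by simp
  qed
  then show ?thesis using s by simp
qed

text \<open>On each interval doubling is injective modulo \<open>M\<close>, and the interval is
  disjoint from its image; so no vertex, as start or as end, meets two arcs of colour 0 with the
  same point at infinity.\<close>

lemma single_colour_unique:
  assumes "l mod 2 = 1" "(x, 0) \<in> arcs" "(x', 0) \<in> arcs" "inf_point x 0 = inf_point x' 0"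
    and "u = x \<or> u = third 0 x x" "u = x' \<or> u = third 0 x' x'"
  shows "x = x'"
proof -
  have r: "0 < x \<and> 3 * x < M \<or> M < 3 * x \<and> 3 * x < 2 * M"
      "0 < x' \<and> 3 * x' < M \<or> M < 3 * x' \<and> 3 * x' < 2 * M" "x < M" "x' < M"
  proof -
    have "\<not> l mod 2 \<le> 0"
      using assms(1) by simp
    then show "0 < x \<and> 3 * x < M \<or> M < 3 * x \<and> 3 * x < 2 * M"
        "0 < x' \<and> 3 * x' < M \<or> M < 3 * x' \<and> 3 * x' < 2 * M" "x < M" "x' < M"
      using assms(2,3) unfolding arcs_def mem_Collect_eq prod.case by blast+
  qed
  have cls: "3 * x < M \<longleftrightarrow> 3 * x' < M"
  proof -
    have "\<not> l mod 2 \<le> 0"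
      using assms(1) by simp
    then have "(if 3 * x < M then 0 else 1 :: nat) = (if 3 * x' < M then 0 else 1)"
      using assms(4) by (simp only: inf_point_def if_False)
    then show ?thesis
      by (simp split: if_splits)
  qed
  \<comment> \<open>If \<open>y\<close> and its end were in the same interval,
    \<open>2 * y + third 0 y y\<close> would lie strictly between consecutive multiples of
    \<open>M\<close>.\<close>
  have no: False if y: "3 * y < M \<longleftrightarrow> 3 * third 0 y y < M" "0 < y \<and> 3 * y < M \<or> M < 3 * y \<and> 3 * y < 2 * M"
      "0 < third 0 y y \<and> 3 * third 0 y y < M \<or> M < 3 * third 0 y y \<and> 3 * third 0 y y < 2 * M" "y < M" for y
  proof -
    have "int M dvd 2 * int y + int (third 0 y y)"
      using arc_target[OF y(4), of 0] by simp
    then obtain k where k: "2 * int y + int (third 0 y y) = int M * k"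
      by blast
    show False
    proof (cases "3 * y < M")
      case True
      then have "0 < int M * k" "int M * k < int M * 1"
        using y k by linarith+
      then have "0 < k" "k < 1"
        using M_pos by (auto simp: zero_less_mult_iff)
      then show False by simp
    next
      case False
      then have "int M * 1 < int M * k" "int M * k < int M * 2"
        using y k by linarith+
      then have "1 < k" "k < 2"
        using M_pos by (simp_all only: mult_less_cancel_left_pos of_nat_0_less_iff)
      then show False by simp
    qed
  qed
  consider "u = x" "u = x'" | "u = x" "u = third 0 x' x'" | "u = third 0 x x" "u = x'"
    | "u = third 0 x x" "u = third 0 x' x'"
    using assms(5,6) by blast
  then show ?thesis
  proof cases
    case 2
    then have "x = third 0 x' x'" by simp
    then show ?thesis using no[of x'] r cls by simp
  next
    case 3
    then have "x' = third 0 x x" by simp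
    then show ?thesis using no[of x] r cls by simp
  next
    case 4
    have "int M dvd (2 * int x + int u) - (2 * int x' + int u)"
      using arc_target[OF r(3), of 0] arc_target[OF r(4), of 0] 4 by (intro dvd_diff) auto
    then have "int M dvd 2 * (int x - int x')"
      by (simp add: algebra_simps)
    moreover have "\<bar>2 * (int x - int x')\<bar> < int M"
      using r cls by (cases "3 * x < M") (simp_all add: abs_if)
    ultimately show ?thesis
      using dvd_small_int by fastforce
  qed simp
qed

lemma card_le_of_index:
  fixes k :: nat
  assumes "inj_on f S" "f ` S \<subseteq> {..<k}"
  shows "finite S" "card S \<le> k"
  using assms inj_on_finite[OF assms] card_inj_on_le[OF assms] by auto

text \<open>Each pair of colours contributes at most one arc leaving and one arc entering
  \<open>u\<close>, and the unpaired colour at most one arc of either kind, which adds up to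
  \<open>l\<close>.\<close>

lemma blocks_through_inf:
  assumes "u < M" "i < 2"
  shows "card {e \<in> blocks. {u, M + i} \<subseteq> e} \<le> l"
proof -
  let ?Out = "{(x, s). (x, s) \<in> arcs \<and> l mod 2 \<le> s \<and> inf_point x s = i \<and> x = u}"
  let ?In = "{(x, s). (x, s) \<in> arcs \<and> l mod 2 \<le> s \<and> inf_point x s = i \<and> third s x x = u}"
  let ?L = "{(x, s). (x, s) \<in> arcs \<and> s < l mod 2 \<and> inf_point x s = i \<and> (u = x \<or> u = third s x x)}"
  let ?idx = "\<lambda>(x, s). (s - l mod 2) div 2"
  have "inj_on ?idx ?Out"
  proof (rule inj_onI)
    fix p p' assume p: "p \<in> ?Out" "p' \<in> ?Out" and idx': "?idx p = ?idx p'"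
    obtain s s' where ss: "p = (u, s)" "p' = (u, s')"
      using p by auto
    have idx: "(s - l mod 2) div 2 = (s' - l mod 2) div 2" and "l mod 2 \<le> s" "l mod 2 \<le> s'"
        "(u, s) \<in> arcs" "(u, s') \<in> arcs" "inf_point u s = i" "inf_point u s' = i"
      using p idx' ss by simp_all
    then have "s < l" "s' < l" "inf_point u s = i" "inf_point u s' = i"
      by (simp_all add: arcs_def)
    then have "s = l mod 2 + 2 * ((s - l mod 2) div 2) + (i + shift u) mod 2"
        "s' = l mod 2 + 2 * ((s' - l mod 2) div 2) + (i + shift u) mod 2"
      using pair_index(2) \<open>l mod 2 \<le> s\<close> \<open>l mod 2 \<le> s'\<close> by blast+
    then show "p = p'"
      using idx ss by metis
  qed
  moreover have "?idx ` ?Out \<subseteq> {..<l div 2}"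
    using pair_index(1) by (auto simp: arcs_def)
  ultimately have out: "finite ?Out" "card ?Out \<le> l div 2"
    using card_le_of_index[of ?idx ?Out "l div 2"] by blast+
  have "inj_on ?idx ?In"
  proof (rule inj_onI)
    fix p p' assume p: "p \<in> ?In" "p' \<in> ?In" and idx: "?idx p = ?idx p'"
    obtain x s x' s' where xs: "p = (x, s)" "p' = (x', s')"
      by (cases p, cases p')
    then show "p = p'"
      using p idx entering_arc_unique[of x x' s s' i u] by (simp add: arcs_def)
  qed
  moreover have "?idx ` ?In \<subseteq> {..<l div 2}"
    using pair_index(1) by (auto simp: arcs_def)
  ultimately have inn: "finite ?In" "card ?In \<le> l div 2"
    using card_le_of_index[of ?idx ?In "l div 2"] by blast+
  have L: "finite ?L \<and> card ?L \<le> l mod 2"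
  proof (cases "l mod 2 = 1")
    case True
    have "inj_on (\<lambda>_. 0 :: nat) ?L"
    proof (rule inj_onI)
      fix p p' assume p: "p \<in> ?L" "p' \<in> ?L"
      obtain x s x' s' where xs: "p = (x, s)" "p' = (x', s')"
        by (cases p, cases p')
      have "s = 0" "s' = 0"
        using p xs True by simp_all
      moreover from this have "x = x'"
        using p xs by (intro single_colour_unique[OF True, of x x' u]) simp_all
      ultimately show "p = p'"
        using xs by simp
    qed
    then show ?thesis
      using card_le_of_index[of "\<lambda>_. 0 :: nat" ?L 1] True by auto
  qed auto
  have "{e \<in> blocks. {u, M + i} \<subseteq> e} \<subseteq> (\<lambda>(x, s). block x s) ` (?Out \<union> ?In \<union> ?L)"
  proof
    fix e assume "e \<in> {e \<in> blocks. {u, M + i} \<subseteq> e}"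
    then have e: "e \<in> blocks" "u \<in> e" "M + i \<in> e" by auto
    have "e \<notin> (\<lambda>(s, x, y). sum_block s x y) ` sum_triples"
    proof
      assume "e \<in> (\<lambda>(s, x, y). sum_block s x y) ` sum_triples"
      then obtain s x y where "e = {x, y, third s x y}" "x < M" "y < M"
        by (auto simp: sum_block_def sum_triples_def)
      then show False
        using e(3) third_less[of s x y] by auto
    qed
    then obtain x s where xs: "(x, s) \<in> arcs" "e = block x s"
      using e(1) by (auto simp: blocks_def)
    then have "x < M" by (simp add: arcs_def)
    then have "inf_point x s = i" "u = x \<or> u = third s x x"
      using e(2,3) xs(2) assms third_less[of s x x] by (auto simp: block_def)
    then have "(x, s) \<in> ?Out \<union> ?In \<union> ?L"
      using xs(1) by auto
    then show "e \<in> (\<lambda>(x, s). block x s) ` (?Out \<union> ?In \<union> ?L)"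
      using xs(2) by (intro image_eqI[of _ _ "(x, s)"]) auto
  qed
  then have "card {e \<in> blocks. {u, M + i} \<subseteq> e} \<le> card ((\<lambda>(x, s). block x s) ` (?Out \<union> ?In \<union> ?L))"
    using out inn L by (intro card_mono) auto
  also have "\<dots> \<le> card (?Out \<union> ?In \<union> ?L)"
    using out inn L by (intro card_image_le) auto
  also have "\<dots> \<le> card ?Out + card ?In + card ?L"
    using card_Un_le[of "?Out \<union> ?In" ?L] card_Un_le[of ?Out ?In] by linarith
  also have "\<dots> \<le> l div 2 + l div 2 + l mod 2"
    using out(2) inn(2) conjunct2[OF L] by (intro add_mono)
  also have "\<dots> = l"
    using div_mult_mod_eq[of l 2] by linarith
  finally show ?thesis .
qed

lemma no_block_through_both_inf:
  assumes "e \<in> blocks" "M \<in> e" "M + 1 \<in> e"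
  shows False
proof -
  show False
    using assms(1)
  proof (cases rule: blocks_cases)
    case (1 s x y)
    then show ?thesis
      using assms(2) third_less[of s x y] by (auto simp: sum_triples_def sum_block_def)
  next
    case (2 x s)
    then show ?thesis
      using assms(2,3) third_less[of s x x] by (auto simp: arcs_def block_def)
  qed
qed

lemma pair_bounded_blocks: "pair_bounded (Suc l) ({..<M + 2}, blocks)"
  unfolding pair_bounded_def fst_conv snd_conv
proof (intro ballI impI)
  have main: "card {e \<in> blocks. {x, y} \<subseteq> e} \<le> l" if xy: "x < y" "y < M + 2" for x y
  proof (cases "y < M")
    case True
    have "{e \<in> blocks. {x, y} \<subseteq> e} \<subseteq> block_through x y ` {..<l}"
      using block_through[of x y] that True by auto
    then have "card {e \<in> blocks. {x, y} \<subseteq> e} \<le> card (block_through x y ` {..<l})"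
      by (intro card_mono) auto
    also have "\<dots> \<le> l"
      using card_image_le[of "{..<l}" "block_through x y"] by simp
    finally show ?thesis .
  next
    case False
    then obtain i where i: "y = M + i" "i < 2"
      using xy(2) by (metis le_Suc_ex nat_add_left_cancel_less not_less)
    show ?thesis
    proof (cases "x < M")
      case True
      then show ?thesis using blocks_through_inf i by simp
    next
      case False
      then have "x = M" "y = M + 1"
        using that i by auto
      then have "{e \<in> blocks. {x, y} \<subseteq> e} = {}"
        using no_block_through_both_inf by auto
      then show ?thesis by (metis card.empty le0)
    qed
  qed
  fix x y assume "x \<in> {..<M + 2}" "y \<in> {..<M + 2}" "x \<noteq> y"
  then show "card {e \<in> blocks. {x, y} \<subseteq> e} \<le> Suc l - 1"
    using main[of x y] main[of y x] by (cases "x < y") (auto simp: insert_commute)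
qed

section \<open>Counting the blocks\<close>

lemma sum_triples_fin: "finite sum_triples" and arcs_fin: "finite arcs"
  by (rule finite_subset[of _ "{..<l} \<times> {..<M} \<times> {..<M}"], auto simp: sum_triples_def)
    (rule finite_subset[of _ "{..<M} \<times> {..<l}"], auto simp: arcs_def)

text \<open>A triple is lost only to one of the coincidences \<open>x = y\<close>,
  \<open>third s x y = x\<close> and \<open>third s x y = y\<close>, and each accounts for at most
  \<open>l * M\<close> triples.\<close>

lemma card_sum_triples: "l * (M * M) \<le> card sum_triples + 3 * (l * M)"
proof -
  let ?D = "{..<l} \<times> {..<M}"
  let ?f1 = "\<lambda>(s, x). (s, x, x)" and ?f2 = "\<lambda>(s, x). (s, x, third s x x)"
    and ?f3 = "\<lambda>(s, y). (s, third s y y, y)"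
  have sub: "{..<l} \<times> {..<M} \<times> {..<M} \<subseteq> sum_triples \<union> (?f1 ` ?D \<union> (?f2 ` ?D \<union> ?f3 ` ?D))"
  proof
    fix p assume "p \<in> {..<l} \<times> {..<M} \<times> {..<M}"
    then obtain s x y where p: "p = (s, x, y)" "s < l" "x < M" "y < M" by auto
    have "y = third s x x" if "third s x y = x"
      using third_unique[of x x y s] third_dvd[of x y s] that p by (simp add: algebra_simps)
    moreover have "x = third s y y" if "third s x y = y"
      using third_unique[of y y x s] third_dvd[of x y s] that p by (simp add: algebra_simps)
    ultimately consider "p \<in> sum_triples" | "p = ?f1 (s, x)" | "p = ?f2 (s, x)" | "p = ?f3 (s, y)"
      using p unfolding sum_triples_def by fastforce
    then show "p \<in> sum_triples \<union> (?f1 ` ?D \<union> (?f2 ` ?D \<union> ?f3 ` ?D))"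
    proof cases
      case 2
      then show ?thesis using p(2-4) by blast
    next
      case 3
      then show ?thesis using p(2-4) by blast
    next
      case 4
      then show ?thesis using p(2-4) by blast
    qed blast
  qed
  have im: "card (f ` ?D) \<le> l * M" for f :: "nat \<times> nat \<Rightarrow> nat \<times> nat \<times> nat"
    using card_image_le[of ?D f] by (simp add: card_cartesian_product)
  have "l * (M * M) = card ({..<l} \<times> {..<M} \<times> {..<M})"
    by (simp add: card_cartesian_product)
  also have "\<dots> \<le> card (sum_triples \<union> (?f1 ` ?D \<union> (?f2 ` ?D \<union> ?f3 ` ?D)))"
    using sub sum_triples_fin by (intro card_mono) auto
  also have "\<dots> \<le> card sum_triples + (card (?f1 ` ?D) + (card (?f2 ` ?D) + card (?f3 ` ?D)))"
    by (intro order_trans[OF card_Un_le] add_mono order_refl)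
  also have "\<dots> \<le> card sum_triples + (l * M + (l * M + l * M))"
    by (intro add_mono im order_refl)
  finally show ?thesis by simp
qed

lemma card_sum_blocks: "card sum_triples \<le> 6 * card ((\<lambda>(s, x, y). sum_block s x y) ` sum_triples)"
proof -
  let ?f = "\<lambda>(s, x, y). sum_block s x y"
  have fibre: "card {p \<in> sum_triples. ?f p = e} \<le> 6" if "e \<in> ?f ` sum_triples" for e
  proof -
    from that obtain a b c where e: "e = {a, b, c}"
      by (auto simp: sum_block_def)
    let ?F = "{p \<in> sum_triples. ?f p = e}"
    \<comment> \<open>The colour is the sum of the block modulo \<open>M\<close>, and colours are
      below \<open>M\<close>; so within a fibre the ordered pair determines the triple.\<close>
    have "inj_on snd ?F"
    proof (rule inj_onI)
      fix p p' assume p: "p \<in> ?F" "p' \<in> ?F" "snd p = snd p'"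
      obtain s x y where sxy: "p = (s, x, y)" by (cases p) auto
      obtain s' where s': "p' = (s', x, y)" using p(3) sxy by (cases p') auto
      have q: "s < l" "s' < l" "x < M" "y < M" "third s x y \<noteq> x" "third s x y \<noteq> y"
          "{x, y, third s x y} = {x, y, third s' x y}"
        using p sxy s' by (auto simp: sum_triples_def sum_block_def)
      then have t: "third s x y = third s' x y" by blast
      have "int M dvd (int x + int y + int (third s x y) - int s) - (int x + int y + int (third s' x y) - int s')"
        by (rule dvd_diff[OF third_dvd[OF q(3,4)] third_dvd[OF q(3,4)]])
      then have "int M dvd int s' - int s"
        using t by (simp add: algebra_simps)
      then have "int s' - int s = 0"
        using q large by (intro dvd_small_int[of "int M"]) auto
      then show "p = p'" using sxy s' by simp
    qed
    then have "card ?F = card (snd ` ?F)"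
      by (simp add: card_image)
    also have "\<dots> \<le> card {(a, b), (b, a), (a, c), (c, a), (b, c), (c, b)}"
    proof (rule card_mono)
      show "snd ` ?F \<subseteq> {(a, b), (b, a), (a, c), (c, a), (b, c), (c, b)}"
      proof
        fix q assume "q \<in> snd ` ?F"
        then obtain s x y where "q = (x, y)" "x \<noteq> y" "sum_block s x y = e"
          by (auto simp: sum_triples_def)
        then have "q = (x, y)" "x \<noteq> y" "x \<in> {a, b, c}" "y \<in> {a, b, c}"
          using e by (auto simp: sum_block_def)
        then show "q \<in> {(a, b), (b, a), (a, c), (c, a), (b, c), (c, b)}"
          by auto
      qed
    qed simp
    also have "\<dots> \<le> 6"
      by (intro card_insert_le_m1) simp_all
    finally show ?thesis .
  qed
  have "card sum_triples \<le> card (\<Union>e\<in>?f ` sum_triples. {p \<in> sum_triples. ?f p = e})"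
    using sum_triples_fin by (intro card_mono) auto
  also have "\<dots> \<le> (\<Sum>e\<in>?f ` sum_triples. card {p \<in> sum_triples. ?f p = e})"
    using sum_triples_fin by (intro card_UN_le) auto
  also have "\<dots> \<le> (\<Sum>e\<in>?f ` sum_triples. 6)"
    using fibre by (rule sum_mono)
  finally show ?thesis by simp
qed

text \<open>The residues in a block give the arc up to direction. With equal directions the colours
  are congruent modulo \<open>M\<close>, and opposite directions are excluded by
  \<open>good\<close>.\<close>

lemma inj_block: "inj_on (\<lambda>(x, s). block x s) arcs"
proof (rule inj_onI, clarify)
  fix x s x' s' assume a: "(x, s) \<in> arcs" "(x', s') \<in> arcs" "block x s = block x' s'"
  define y y' where "y = third s x x" and "y' = third s' x' x'"
  have l: "x < M" "x' < M" "s < l" "s' < l" "y < M" "y' < M" "good x" "x \<noteq> y"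
    using a(1,2) third_less arc_ne[OF a(1)] by (auto simp: arcs_def y_def y'_def)
  have d: "int M dvd 2 * int x + int y - int s" "int M dvd 2 * int x' + int y' - int s'"
    using arc_target l by (auto simp: y_def y'_def)
  have "{x, y} = block x s \<inter> {..<M}" "{x', y'} = block x' s' \<inter> {..<M}"
    using l by (auto simp: block_def y_def y'_def)
  then have "{x, y} = {x', y'}"
    using a(3) by simp
  then consider "x = x'" "y = y'" | "x = y'" "y = x'"
    by (auto simp: doubleton_eq_iff)
  then show "x = x' \<and> s = s'"
  proof cases
    case 1
    have "int M dvd (2 * int x + int y - int s) - (2 * int x' + int y' - int s')"
      using d by (rule dvd_diff)
    then have "int M dvd int s' - int s"
      using 1 by (simp add: algebra_simps)
    then have "int s' - int s = 0"
      using l large by (intro dvd_small_int[of "int M"]) auto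
    then show ?thesis using 1 by simp
  next
    case 2
    have "int M dvd 2 * (2 * int x + int y - int s) - (2 * int x' + int y' - int s')"
      by (rule dvd_diff[OF dvd_mult[OF d(1)] d(2)])
    then have "int M dvd 3 * int x + int s' - 2 * int s"
      using 2 by (simp add: algebra_simps)
    then show ?thesis
      using l unfolding good_def by blast
  qed
qed

lemma card_not_good: "card {x. x < M \<and> \<not> good x} \<le> 4 * (l * l)"
proof -
  let ?B = "\<lambda>s s'. {x. x < M \<and> int M dvd 3 * int x + int s' - 2 * int s}"
  have B: "card (?B s s') \<le> 4" if "s < l" "s' < l" for s s'
  proof -
    let ?q = "\<lambda>x. (3 * int x + int s' - 2 * int s) div int M"
    have "inj_on ?q (?B s s')"
    proof (rule inj_onI)
      fix x y assume "x \<in> ?B s s'" "y \<in> ?B s s'" and q: "?q x = ?q y"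
      then have "int M * ?q x = 3 * int x + int s' - 2 * int s" "int M * ?q y = 3 * int y + int s' - 2 * int s"
        by auto
      then have "3 * int x + int s' - 2 * int s = 3 * int y + int s' - 2 * int s"
        using q by metis
      then show "x = y" by simp
    qed
    \<comment> \<open>\<open>3x + s' - 2s\<close> lies strictly between \<open>-M\<close> and
      \<open>4M\<close>, so only four multiples of \<open>M\<close> come into question.\<close>
    moreover have "?q ` ?B s s' \<subseteq> {0..3}"
    proof
      fix k assume "k \<in> ?q ` ?B s s'"
      then obtain x where x: "x < M" "int M * k = 3 * int x + int s' - 2 * int s"
        by auto
      then have "int M * k < int M * 4" "int M * (- 1) < int M * k"
        using that large by linarith+
      then have "k < 4" "- 1 < k"
        using M_pos by (simp_all only: mult_less_cancel_left_pos of_nat_0_less_iff)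
      then show "k \<in> {0..3}" by simp
    qed
    ultimately have "card (?B s s') \<le> card {0..3 :: int}"
      by (rule card_inj_on_le) simp
    then show ?thesis by simp
  qed
  have "{x. x < M \<and> \<not> good x} \<subseteq> (\<Union>p\<in>{..<l} \<times> {..<l}. ?B (fst p) (snd p))"
    by (auto simp: good_def)
  then have "card {x. x < M \<and> \<not> good x} \<le> card (\<Union>p\<in>{..<l} \<times> {..<l}. ?B (fst p) (snd p))"
    by (intro card_mono) auto
  also have "\<dots> \<le> (\<Sum>p\<in>{..<l} \<times> {..<l}. card (?B (fst p) (snd p)))"
    by (intro card_UN_le) auto
  also have "\<dots> \<le> (\<Sum>p\<in>{..<l} \<times> {..<l}. 4)"
    by (intro sum_mono B) auto
  also have "\<dots> = 4 * (l * l)"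
    by (simp add: card_cartesian_product)
  finally show ?thesis .
qed

lemma card_arcs: "3 * ((l - l mod 2) * M) + l mod 2 * (2 * M) \<le> 3 * card arcs + 12 * (l * l * l) + 6"
proof -
  \<comment> \<open>The upper limits are \<open>M/3\<close> and \<open>2M/3\<close> rounded up,
    matching the strict inequalities in \<open>arcs\<close>; rounding costs at most two elements
    altogether.\<close>
  let ?I = "{1..<(M + 2) div 3} \<union> {M div 3 + 1..<(2 * M + 2) div 3}"
  let ?J = "if l mod 2 = 1 then ?I \<times> {0 :: nat} else {}"
  let ?Bad = "{x. x < M \<and> \<not> good x} \<times> {..<l}"
  have I: "3 * card ?I + 6 \<ge> 2 * M"
  proof -
    have "card ?I = card {1..<(M + 2) div 3} + card {M div 3 + 1..<(2 * M + 2) div 3}"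
      by (intro card_Un_disjoint) auto
    then show ?thesis by simp linarith
  qed
  have "{..<M} \<times> {l mod 2..<l} \<union> ?J \<subseteq> arcs \<union> ?Bad"
  proof
    fix p assume p: "p \<in> {..<M} \<times> {l mod 2..<l} \<union> ?J"
    obtain x s where xs: "p = (x, s)" by (cases p)
    have "x < M \<and> s < l \<and> (l mod 2 \<le> s \<or> 0 < x \<and> 3 * x < M \<or> M < 3 * x \<and> 3 * x < 2 * M)"
    proof (cases "p \<in> {..<M} \<times> {l mod 2..<l}")
      case False
      then have "l mod 2 = 1" "s = 0" "x \<in> ?I"
        using p xs by (auto split: if_splits)
      moreover from this have "0 < x \<and> 3 * x < M \<or> M < 3 * x \<and> 3 * x < 2 * M"
        by (elim UnE) (simp_all, linarith+)
      moreover have "0 < l"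
        using \<open>l mod 2 = 1\<close> by (cases l) auto
      ultimately show ?thesis by auto
    qed (use xs in auto)
    then show "p \<in> arcs \<union> ?Bad"
      using xs by (auto simp: arcs_def)
  qed
  then have "card ({..<M} \<times> {l mod 2..<l} \<union> ?J) \<le> card (arcs \<union> ?Bad)"
    using arcs_fin by (intro card_mono) auto
  also have "\<dots> \<le> card arcs + card ?Bad"
    by (rule card_Un_le)
  also have "card ?Bad \<le> 4 * (l * l) * l"
    using card_not_good by (simp only: card_cartesian_product card_lessThan mult_le_mono1)
  finally have u: "card ({..<M} \<times> {l mod 2..<l} \<union> ?J) \<le> card arcs + 4 * (l * l) * l"
    by simp
  have "card ({..<M} \<times> {l mod 2..<l} \<union> ?J) = card ({..<M} \<times> {l mod 2..<l}) + card ?J"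
    by (intro card_Un_disjoint) auto
  also have "card ({..<M} \<times> {l mod 2..<l}) = (l - l mod 2) * M"
    by (simp add: card_cartesian_product)
  finally have v: "(l - l mod 2) * M + card ?J \<le> card arcs + 4 * (l * l) * l"
    using u by simp
  show ?thesis
  proof (cases "l mod 2 = 1")
    case True
    then have "card ?J = card ?I"
      by (simp add: card_cartesian_product)
    then show ?thesis
      using v I True by (simp add: algebra_simps)
  next
    case False
    then have "l mod 2 = 0" by presburger
    then show ?thesis
      using v by (simp add: algebra_simps)
  qed
qed

text \<open>There are at least \<open>l * (M^2 - 3M) / 6\<close> sum blocks, and a full set of arcs
  would add \<open>l * M\<close>; up to a constant the total is \<open>l * N * (N - 1) / 6\<close>
  for \<open>N = M + 2\<close>. The only linear loss is the third of the arcs given up in the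
  unpaired colour of odd \<open>l\<close>.\<close>

lemma card_blocks:
  "real l * real (M + 2) * real (M + 1) / 6 - real (M + 2) / 3 - (4 * real l ^ 3 + l + 2) \<le> card blocks"
proof -
  let ?S = "(\<lambda>(s, x, y). sum_block s x y) ` sum_triples" and ?A = "(\<lambda>(x, s). block x s) ` arcs"
  have "?S \<inter> ?A = {}"
  proof -
    have "e \<subseteq> {..<M}" if "e \<in> ?S" for e
      using that third_less by (auto simp: sum_triples_def sum_block_def)
    moreover have "\<not> e \<subseteq> {..<M}" if "e \<in> ?A" for e
      using that by (auto simp: block_def)
    ultimately show ?thesis by (metis disjoint_iff)
  qed
  then have "card blocks = card ?S + card ?A"
    unfolding blocks_def by (intro card_Un_disjoint) (auto simp: sum_triples_fin arcs_fin)
  also have "card ?A = card arcs"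
    by (rule card_image[OF inj_block])
  finally have "6 * card blocks \<ge> card sum_triples + 6 * card arcs"
    using card_sum_blocks by simp
  then have "6 * card blocks + 3 * (l * M) + 24 * (l * l * l) + 12
      \<ge> l * (M * M) + 6 * ((l - l mod 2) * M) + l mod 2 * (4 * M)"
    using card_sum_triples card_arcs by linarith
  moreover have "6 * ((l - l mod 2) * M) + l mod 2 * (6 * M) = 6 * (l * M)"
    by (simp add: algebra_simps flip: distrib_right)
  moreover have "l mod 2 * (2 * M) \<le> 2 * M"
    using mult_le_mono1[of "l mod 2" 1 "2 * M"] by auto
  ultimately have "l * (M * M) + 6 * (l * M) \<le> 6 * card blocks + 3 * (l * M) + 24 * (l * l * l) + 12 + 2 * M"
    by linarith
  then have "real (l * (M * M) + 6 * (l * M)) \<le> real (6 * card blocks + 3 * (l * M) + 24 * (l * l * l) + 12 + 2 * M)"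
    by (rule of_nat_mono)
  then show ?thesis
    by (simp add: field_simps power3_eq_cube)
qed

end

lemma ex_near_design:
  fixes t :: nat
  assumes "t > 0"
  obtains K where "\<And>N. \<exists>E. three_graph ({..<N}, E) \<and> pair_bounded t ({..<N}, E) \<and>
    (real t - 1) * N * (real N - 1) / 6 - N / 3 - K \<le> card E"
proof -
  define l where "l = t - 1"
  have t: "t = Suc l" "real t - 1 = l"
    using assms by (auto simp: l_def)
  \<comment> \<open>The last summand covers \<open>N\<close> below \<open>4 * l + 12\<close>, where
    \<open>M = N - 2\<close> is too small for the construction and the empty 3-graph serves.\<close>
  define K where "K = 4 * real l ^ 3 + l + 2 + real l * (4 * l + 12) * (4 * l + 12)"
  show ?thesis
  proof (rule that[of K])
    fix N
    show "\<exists>E. three_graph ({..<N}, E) \<and> pair_bounded t ({..<N}, E) \<and>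
      (real t - 1) * N * (real N - 1) / 6 - N / 3 - K \<le> card E"
    proof (cases "4 * l + 12 \<le> N")
      case True
      define M where "M = N - 2"
      have N: "N = M + 2"
        using True by (simp add: M_def)
      interpret near_design M l
        by unfold_locales (use True N in simp)
      have "0 \<le> real l * (4 * l + 12) * (4 * l + 12)"
        by simp
      then have "(real t - 1) * N * (real N - 1) / 6 - N / 3 - K \<le> card blocks"
      proof -
        have eq: "real (M + 2) - 1 = real (M + 1)"
          by simp
        show ?thesis
          unfolding K_def t(2) N eq
          using card_blocks \<open>0 \<le> real l * (4 * l + 12) * (4 * l + 12)\<close> by linarith
      qed
      then show ?thesis
        using three_graph_blocks pair_bounded_blocks unfolding N t by blast
    next
      case False
      have "real l * N * (real N - 1) \<le> real l * (4 * l + 12) * (4 * l + 12)"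
        using False by (cases "N = 0") (auto intro!: mult_mono)
      moreover have "0 \<le> real l * N * (real N - 1)"
        by (cases "N = 0") auto
      moreover have "0 \<le> 4 * real l ^ 3 + l + 2" "0 \<le> real N"
        by simp_all
      ultimately have "(real t - 1) * N * (real N - 1) / 6 - N / 3 - K \<le> card ({} :: nat set set)"
        unfolding K_def t(2) card.empty of_nat_0 by argo
      moreover have "three_graph ({..<N}, {})" "pair_bounded t ({..<N}, {})"
        by (auto simp: three_graph_def pair_bounded_def)
      ultimately show ?thesis by blast
    qed
  qed
qed

section \<open>Packing numbers and balanced parts\<close>

lemma three_graph_image:
  assumes "bij_betw f V W" "three_graph (V, E)"
  shows "three_graph (W, (`) f ` E)" "card ((`) f ` E) = card E"
proof -
  have inj: "inj_on f V" and im: "f ` V = W"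
    using assms(1) by (auto simp: bij_betw_def)
  have E: "e \<subseteq> V" "card e = 3" if "e \<in> E" for e
    using assms(2) that by (auto simp: three_graph_def)
  have "card (f ` e) = 3" "f ` e \<subseteq> W" if "e \<in> E" for e
    using E[OF that] inj im by (auto simp: card_image inj_on_subset)
  then show "three_graph (W, (`) f ` E)"
    using assms by (auto simp: three_graph_def bij_betw_finite)
  have "inj_on ((`) f) E"
    using inj E by (intro inj_onI) (metis inj_on_image_eq_iff)
  then show "card ((`) f ` E) = card E"
    by (rule card_image)
qed

lemma pair_bounded_image:
  assumes "bij_betw f V W" "three_graph (V, E)" "pair_bounded t (V, E)"
  shows "pair_bounded t (W, (`) f ` E)"
  unfolding pair_bounded_def fst_conv snd_conv
proof (intro ballI impI)
  fix x y assume xy: "x \<in> W" "y \<in> W" "x \<noteq> y"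
  have inj: "inj_on f V" and im: "f ` V = W"
    using assms(1) by (auto simp: bij_betw_def)
  have E: "e \<subseteq> V" if "e \<in> E" for e
    using assms(2) that by (auto simp: three_graph_def)
  then have Ef: "finite E"
    using assms(2) by (intro finite_subset[of E "Pow V"]) (auto simp: three_graph_def)
  obtain a b where ab: "a \<in> V" "b \<in> V" "x = f a" "y = f b"
    using xy im by blast
  have "{e \<in> (`) f ` E. {x, y} \<subseteq> e} \<subseteq> (`) f ` {e \<in> E. {a, b} \<subseteq> e}"
  proof
    fix e' assume "e' \<in> {e \<in> (`) f ` E. {x, y} \<subseteq> e}"
    then obtain e where e: "e \<in> E" "e' = f ` e" "f a \<in> f ` e" "f b \<in> f ` e"
      using ab by auto
    then have "a \<in> e" "b \<in> e"
      using inj E ab(1,2) by (auto simp: inj_on_image_mem_iff)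
    then show "e' \<in> (`) f ` {e \<in> E. {a, b} \<subseteq> e}"
      using e by auto
  qed
  then have "card {e \<in> (`) f ` E. {x, y} \<subseteq> e} \<le> card ((`) f ` {e \<in> E. {a, b} \<subseteq> e})"
    using Ef by (intro card_mono) auto
  also have "\<dots> \<le> card {e \<in> E. {a, b} \<subseteq> e}"
    using Ef by (intro card_image_le) auto
  also have "\<dots> \<le> t - 1"
    using assms(3) ab xy(3) by (auto simp: pair_bounded_def)
  finally show "card {e \<in> (`) f ` E. {x, y} \<subseteq> e} \<le> t - 1" .
qed

lemma contains_copy_image:
  assumes "bij_betw f V W" "three_graph (V, E)" "contains_copy (W, (`) f ` E) F"
  shows "contains_copy (V, E) F"
proof -
  have inj: "inj_on f V" and im: "f ` V = W"
    using assms(1) by (auto simp: bij_betw_def)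
  obtain g where g: "inj_on g (verts F)" "g ` verts F \<subseteq> W" "\<And>e. e \<in> edges F \<Longrightarrow> g ` e \<in> (`) f ` E"
    using assms(3) by (auto simp: contains_copy_def)
  let ?h = "inv_into V f"
  have "inj_on (?h \<circ> g) (verts F)"
    using g(1,2) im by (intro comp_inj_on) (auto intro: inj_on_subset[OF inj_on_inv_into[of W f V]])
  moreover have "(?h \<circ> g) ` verts F \<subseteq> V"
    using g(2) im inv_into_into[of _ f V] by auto
  moreover have "(?h \<circ> g) ` e \<in> E" if "e \<in> edges F" for e
  proof -
    from g(3)[OF that] obtain e' where e': "e' \<in> E" "g ` e = f ` e'"
      by auto
    then have "e' \<subseteq> V"
      using assms(2) by (auto simp: three_graph_def)
    then have "?h ` f ` e' = e'"
      using inj by (rule inv_into_image_cancel[rotated])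
    then show ?thesis
      using e' image_comp[of ?h g e] by metis
  qed
  ultimately show ?thesis
    unfolding contains_copy_def fst_conv snd_conv by blast
qed

lemma card_le_is_D:
  assumes "is_D t (W, D)" "card V = card W" "three_graph (V, E)" "pair_bounded t (V, E)"
  shows "card E \<le> card D"
proof -
  have "finite V" "finite W"
    using assms by (auto simp: is_D_def three_graph_def)
  then obtain f where f: "bij_betw f V W"
    using assms(2) finite_same_card_bij by blast
  have "card ((`) f ` E) \<le> card D"
    using assms(1) three_graph_image(1)[OF f assms(3)] pair_bounded_image[OF f assms(3,4)]
    by (auto simp: is_D_def)
  then show ?thesis
    using three_graph_image(2)[OF f assms(3)] by simp
qed

text \<open>The number called d in the overview. The choice is immaterial: by
  \<open>card_is_D\<close> every 3-graph with \<open>is_D\<close> on \<open>N\<close> vertices has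
  this many edges.\<close>

definition packing_number :: "nat \<Rightarrow> nat \<Rightarrow> nat" where
  "packing_number t N = card (SOME E. is_D t ({..<N}, E))"

lemma card_le_packing_number:
  assumes "three_graph (V, E)" "pair_bounded t (V, E)"
  shows "card E \<le> packing_number t (card V)"
proof -
  have "is_D t ({..<card V}, SOME E. is_D t ({..<card V}, E))"
    by (rule someI_ex[OF ex_D]) simp
  then show ?thesis
    unfolding packing_number_def by (rule card_le_is_D) (use assms in auto)
qed

lemma packing_number_attained:
  obtains E where "three_graph ({..<N}, E)" "pair_bounded t ({..<N}, E)" "card E = packing_number t N"
proof -
  have "is_D t ({..<N}, SOME E. is_D t ({..<N}, E))"
    by (rule someI_ex[OF ex_D]) simp
  then show ?thesis
    using that by (auto simp: is_D_def packing_number_def)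
qed

lemma card_is_D:
  assumes "is_D t (V, D)"
  shows "card D = packing_number t (card V)"
proof (rule antisym)
  show "card D \<le> packing_number t (card V)"
    using assms by (intro card_le_packing_number) (auto simp: is_D_def)
  obtain E where "three_graph ({..<card V}, E)" "pair_bounded t ({..<card V}, E)"
      "card E = packing_number t (card V)"
    by (rule packing_number_attained)
  then show "packing_number t (card V) \<le> card D"
    using card_le_is_D[OF assms] by (metis card_lessThan)
qed

lemma packing_number_mono: "packing_number t N \<le> packing_number t (Suc N)"
proof -
  obtain E where E: "three_graph ({..<N}, E)" "pair_bounded t ({..<N}, E)" "card E = packing_number t N"
    by (rule packing_number_attained)
  have "three_graph ({..<Suc N}, E)"
    using E(1) by (force simp: three_graph_def)
  moreover have "pair_bounded t ({..<Suc N}, E)"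
    unfolding pair_bounded_def fst_conv snd_conv
  proof (intro ballI impI)
    fix x y assume xy: "x \<in> {..<Suc N}" "y \<in> {..<Suc N}" "x \<noteq> y"
    show "card {e \<in> E. {x, y} \<subseteq> e} \<le> t - 1"
    proof (cases "x < N \<and> y < N")
      case True
      then show ?thesis
        using E(2) xy by (auto simp: pair_bounded_def)
    next
      case False
      then have "{e \<in> E. {x, y} \<subseteq> e} = {}"
        using E(1) xy by (force simp: three_graph_def)
      then show ?thesis by (metis card.empty le0)
    qed
  qed
  ultimately show ?thesis
    using card_le_packing_number[of "{..<Suc N}" E t] E(3) by simp
qed

text \<open>Double counting: an edge holds six ordered pairs, and each of the
  \<open>N * (N - 1)\<close> ordered pairs lies in at most \<open>t - 1\<close> edges.\<close>

lemma packing_number_upper: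
  "6 * packing_number t N \<le> (t - 1) * (N * (N - 1))"
proof -
  obtain E where E: "three_graph ({..<N}, E)" "pair_bounded t ({..<N}, E)" "card E = packing_number t N"
    by (rule packing_number_attained)
  let ?P = "{(x, y). x \<in> {..<N} \<and> y \<in> {..<N} \<and> x \<noteq> y}"
  have e: "e \<subseteq> {..<N}" "card e = 3" if "e \<in> E" for e
    using E(1) that by (auto simp: three_graph_def)
  have Ef: "finite E"
    by (rule finite_subset[of _ "Pow {..<N}"]) (use e in auto)
  have six: "6 \<le> card {(x, y). x \<in> e \<and> y \<in> e \<and> x \<noteq> y}" if "e \<in> E" for e
  proof -
    from e(2)[OF that] obtain a b c where abc: "e = {a, b, c}" "a \<noteq> b" "b \<noteq> c" "a \<noteq> c"
      using card_3_iff by metis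
    have "card {(a, b), (b, a), (a, c), (c, a), (b, c), (c, b)} \<le> card {(x, y). x \<in> e \<and> y \<in> e \<and> x \<noteq> y}"
    proof (rule card_mono)
      show "finite {(x, y). x \<in> e \<and> y \<in> e \<and> x \<noteq> y}"
        by (rule finite_subset[of _ "e \<times> e"]) (auto simp: abc)
    qed (use abc in auto)
    then show ?thesis using abc by simp
  qed
  have Pf: "finite ?P" and Pc: "card ?P = N * (N - 1)"
  proof -
    have "?P = (SIGMA x:{..<N}. {..<N} - {x})" by auto
    then show "finite ?P" "card ?P = N * (N - 1)"
      by simp_all
  qed
  have "6 * card E = (\<Sum>e\<in>E. 6)"
    by simp
  also have "\<dots> \<le> (\<Sum>e\<in>E. card {p \<in> ?P. {fst p, snd p} \<subseteq> e})"
  proof (rule sum_mono)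
    fix d assume d: "d \<in> E"
    have "{(x, y). x \<in> d \<and> y \<in> d \<and> x \<noteq> y} = {p \<in> ?P. {fst p, snd p} \<subseteq> d}"
      using e(1)[OF d] by auto
    then show "6 \<le> card {p \<in> ?P. {fst p, snd p} \<subseteq> d}"
      using six[OF d] by simp
  qed
  also have "\<dots> = (\<Sum>p\<in>?P. card {e \<in> E. {fst p, snd p} \<subseteq> e})"
    by (rule sum_multicount_gen) (use Ef Pf in auto)
  also have "\<dots> \<le> (\<Sum>p\<in>?P. t - 1)"
    using E(2) by (intro sum_mono) (auto simp: pair_bounded_def)
  finally show ?thesis
    using E(3) Pc by (simp add: mult.commute)
qed

section \<open>Edge numbers as functions of the part sizes\<close>

definition tripartite_size :: "nat \<Rightarrow> nat \<Rightarrow> nat \<Rightarrow> nat \<Rightarrow> nat" where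
  "tripartite_size t a b c = a * b * c + packing_number t a + packing_number t b + packing_number t c"

text \<open>The three quotients are the balanced part sizes in increasing order.\<close>

definition T3_plus_size :: "nat \<Rightarrow> nat \<Rightarrow> nat" where
  "T3_plus_size t n = tripartite_size t (n div 3) ((n + 1) div 3) ((n + 2) div 3)"

lemma sorted_balanced:
  fixes a b c :: nat
  assumes "a \<le> b" "b \<le> c" "c \<le> a + 1"
  shows "(a + b + c) div 3 = a" "(a + b + c + 1) div 3 = b" "(a + b + c + 2) div 3 = c"
  by (intro div_nat_eqI; use assms in simp)+

lemma balanced_size:
  assumes "a \<le> b + 1" "b \<le> a + 1" "a \<le> c + 1" "c \<le> a + 1" "b \<le> c + 1" "c \<le> b + 1"
  shows "tripartite_size t a b c = T3_plus_size t (a + b + c)"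
proof -
  have sorted: "tripartite_size t a b c = T3_plus_size t (a + b + c)"
    if "a \<le> b" "b \<le> c" "c \<le> a + 1" for a b c
    unfolding T3_plus_size_def using sorted_balanced[OF that] by simp
  consider "a \<le> b" "b \<le> c" | "a \<le> c" "c \<le> b" | "b \<le> a" "a \<le> c" | "b \<le> c" "c \<le> a"
    | "c \<le> a" "a \<le> b" | "c \<le> b" "b \<le> a"
    by linarith
  then show ?thesis
  proof cases
    case 1
    then show ?thesis using sorted[of a b c] assms by simp
  next
    case 2
    then show ?thesis using sorted[of a c b] assms by (simp add: tripartite_size_def algebra_simps)
  next
    case 3
    then show ?thesis using sorted[of b a c] assms by (simp add: tripartite_size_def algebra_simps)
  next
    case 4
    then show ?thesis using sorted[of b c a] assms by (simp add: tripartite_size_def algebra_simps)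
  next
    case 5
    then show ?thesis using sorted[of c a b] assms by (simp add: tripartite_size_def algebra_simps)
  next
    case 6
    then show ?thesis using sorted[of c b a] assms by (simp add: tripartite_size_def algebra_simps)
  qed
qed

text \<open>One more vertex enlarges the smallest part, and it forms crossing triples with all pairs
  from the other two parts, which have at least \<open>m div 3\<close> vertices each. This growth is
  the degree threshold for deleting vertices.\<close>

lemma T3_plus_size_Suc: "T3_plus_size t m + (m div 3)\<^sup>2 \<le> T3_plus_size t (Suc m)"
proof -
  let ?p = "m div 3" and ?q = "(m + 1) div 3" and ?r = "(m + 2) div 3"
  have "(Suc m + 2) div 3 = Suc ?p" by presburger
  then have "T3_plus_size t (Suc m) = tripartite_size t ?q ?r (Suc ?p)"
    by (simp add: T3_plus_size_def)
  also have "\<dots> \<ge> ?q * ?r * Suc ?p + packing_number t ?p + packing_number t ?q + packing_number t ?r"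
    using packing_number_mono[of t ?p] by (simp add: tripartite_size_def)
  moreover have "?q * ?r * Suc ?p = ?p * ?q * ?r + ?q * ?r"
    by simp
  moreover have "?p * ?p \<le> ?q * ?r"
    by (intro mult_le_mono div_le_mono) auto
  ultimately show ?thesis
    by (simp add: T3_plus_size_def tripartite_size_def power2_eq_square)
qed

text \<open>Moving a vertex from the larger to the smaller part gains \<open>(a - b - 1) c\<close> crossing triples,
  about \<open>n/3\<close> when \<open>a = b + 2\<close>, and costs at most \<open>(a + b)/3\<close>, about \<open>2n/9\<close>, in the packings.\<close>

lemma tripartite_size_step:
  fixes K :: real
  assumes t: "t > 0"
    and K: "\<And>N. (real t - 1) * N * (real N - 1) / 6 - N / 3 - K \<le> packing_number t N"
    and big: "15 * (2 * K + t) \<le> real (a + b + c)"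
    and c: "3/10 * real (a + b + c) \<le> c"
    and ab: "b + 2 \<le> a"
  shows "tripartite_size t a b c \<le> tripartite_size t (a - 1) (b + 1) c"
proof -
  let ?l = "real t - 1" and ?d = "\<lambda>N. real (packing_number t N)"
  have up: "?d N \<le> ?l * N * (real N - 1) / 6" for N
  proof -
    have "real (6 * packing_number t N) \<le> real ((t - 1) * (N * (N - 1)))"
      using packing_number_upper of_nat_le_iff by blast
    moreover have "real ((t - 1) * (N * (N - 1))) = ?l * N * (real N - 1)"
      using t by (cases "N = 0") (simp_all add: of_nat_diff)
    ultimately have "real (6 * packing_number t N) \<le> ?l * N * (real N - 1)"
      by (simp only:)
    moreover have "real (6 * packing_number t N) = 6 * ?d N"
      by simp
    ultimately show ?thesis by linarith
  qed
  define x where "x = real a - real b - 1"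
  have a1: "real (a - 1) = real a - 1" and b1: "real (b + 1) = real b + 1"
    using ab by simp_all
  have x: "x \<ge> 1" using ab by (simp add: x_def)
  have "?d a + ?d b \<le> ?l * a * (real a - 1) / 6 + ?l * b * (real b - 1) / 6"
    using up by (intro add_mono)
  moreover have "?d (a - 1) + ?d (b + 1) \<ge> ?l * (real a - 1) * (real a - 1 - 1) / 6 - (real a - 1) / 3 - K
      + (?l * (real b + 1) * (real b + 1 - 1) / 6 - (real b + 1) / 3 - K)"
    by (rule add_mono[OF K[of "a - 1", unfolded a1] K[of "b + 1", unfolded b1]])
  \<comment> \<open>The quadratic terms cancel up to \<open>?l * x / 3\<close>, a constant for
    \<open>x = 1\<close>; the linear loss comes only from the defects \<open>N / 3\<close> of the
    packings.\<close>
  moreover have "?l * a * (real a - 1) / 6 + ?l * b * (real b - 1) / 6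
      - (?l * (real a - 1) * (real a - 1 - 1) / 6 + ?l * (real b + 1) * (real b + 1 - 1) / 6) = ?l * x / 3"
    by (simp add: x_def field_simps)
  ultimately have d: "?d a + ?d b \<le> ?d (a - 1) + ?d (b + 1) + ?l * x / 3 + (real a + b) / 3 + 2 * K"
    by argo
  \<comment> \<open>The loss \<open>(a + b) / 3 + 2 * K\<close> does not grow with \<open>x\<close>,
    so \<open>x = 1\<close> is the critical case.\<close>
  have "1 * (c - ?l / 3) \<le> x * (c - ?l / 3)"
  proof (rule mult_right_mono[OF x])
    have "0 \<le> K"
      using K[of 0] up[of 0] by simp
    then have "t / 3 \<le> c"
      using big c by simp
    then show "0 \<le> c - ?l / 3" by simp
  qed
  \<comment> \<open>With \<open>n = a + b + c\<close>, the bound \<open>c \<ge> 3n/10\<close> gives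
    \<open>(a + b) / 3 \<le> 7n/30\<close> and leaves \<open>n/15\<close> for the constants; hence
    the factor 15 in \<open>big\<close>.\<close>
  moreover have "(real a + b) / 3 + 2 * K \<le> c - ?l / 3"
    using big c of_nat_0_le_iff[of t, where 'a = real] unfolding of_nat_add by argo
  ultimately have "?l * x / 3 + (real a + b) / 3 + 2 * K \<le> x * c"
    by (simp add: algebra_simps)
  then have "?d a + ?d b \<le> ?d (a - 1) + ?d (b + 1) + x * c"
    using d by linarith
  moreover have "real (a - 1) * real (b + 1) * c = real a * b * c + x * c"
    unfolding a1 by (simp add: x_def algebra_simps)
  ultimately have "real (tripartite_size t a b c) \<le> real (tripartite_size t (a - 1) (b + 1) c)"
    unfolding tripartite_size_def of_nat_add of_nat_mult by (simp add: algebra_simps)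
  then show ?thesis by simp
qed

lemma square_step:
  fixes a b :: nat
  assumes "b + 2 \<le> a"
  shows "(a - 1)\<^sup>2 + (b + 1)\<^sup>2 < a\<^sup>2 + b\<^sup>2"
proof -
  obtain k where "a = b + 2 + k" using assms le_Suc_ex by blast
  then show ?thesis by (simp add: power2_eq_square algebra_simps)
qed

text \<open>Moving a vertex to a part smaller by at least two decreases the sum of squares, so such
  moves end in balanced parts. The bounds 3/10 persist because the donor remains at least as large
  as the recipient was.\<close>

lemma tripartite_size_le_T3_plus:
  fixes K :: real
  assumes t: "t > 0"
    and K: "\<And>N. (real t - 1) * N * (real N - 1) / 6 - N / 3 - K \<le> packing_number t N"
    and big: "15 * (2 * K + t) \<le> real (a + b + c)"
    and abc: "3/10 * real (a + b + c) \<le> a" "3/10 * real (a + b + c) \<le> b" "3/10 * real (a + b + c) \<le> c"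
  shows "tripartite_size t a b c \<le> T3_plus_size t (a + b + c)"
  using big abc
proof (induction "a\<^sup>2 + b\<^sup>2 + c\<^sup>2" arbitrary: a b c rule: less_induct)
  case less
  have move: "tripartite_size t x y z \<le> T3_plus_size t (x + y + z)"
    if xyz: "y + 2 \<le> x" "x\<^sup>2 + y\<^sup>2 + z\<^sup>2 = a\<^sup>2 + b\<^sup>2 + c\<^sup>2" "x + y + z = a + b + c"
      and r: "3/10 * real (a + b + c) \<le> y" "3/10 * real (a + b + c) \<le> z" for x y z
  proof -
    have s: "x - 1 + (y + 1) + z = a + b + c"
      using xyz by simp
    have "tripartite_size t x y z \<le> tripartite_size t (x - 1) (y + 1) z"
      using less.prems(1) r xyz by (intro tripartite_size_step[OF t K]) simp_all
    also have "\<dots> \<le> T3_plus_size t (x - 1 + (y + 1) + z)"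
    proof (rule less.hyps)
      show "(x - 1)\<^sup>2 + (y + 1)\<^sup>2 + z\<^sup>2 < a\<^sup>2 + b\<^sup>2 + c\<^sup>2"
        using square_step[OF xyz(1)] xyz(2) by linarith
      have "real y \<le> real (x - 1)" using xyz(1) by simp
      then show "3/10 * real (x - 1 + (y + 1) + z) \<le> real (x - 1)"
        unfolding s using r(1) by linarith
    qed (unfold s, use less.prems(1) r in simp_all)
    finally show ?thesis using s xyz(3) by simp
  qed
  consider "a \<le> b + 1" "b \<le> a + 1" "a \<le> c + 1" "c \<le> a + 1" "b \<le> c + 1" "c \<le> b + 1"
    | "b + 2 \<le> a" | "a + 2 \<le> b" | "c + 2 \<le> a" | "a + 2 \<le> c" | "c + 2 \<le> b" | "b + 2 \<le> c"
    by linarith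
  then show ?case
  proof cases
    case 1
    then show ?thesis using balanced_size by simp
  next
    case 2
    then show ?thesis using move[of b a c] less.prems by simp
  next
    case 3
    then show ?thesis using move[of a b c] less.prems by (simp add: tripartite_size_def algebra_simps)
  next
    case 4
    then show ?thesis using move[of c a b] less.prems by (simp add: tripartite_size_def algebra_simps)
  next
    case 5
    then show ?thesis using move[of a c b] less.prems by (simp add: tripartite_size_def algebra_simps)
  next
    case 6
    then show ?thesis using move[of c b a] less.prems by (simp add: tripartite_size_def algebra_simps)
  next
    case 7
    then show ?thesis using move[of b c a] less.prems by (simp add: tripartite_size_def algebra_simps)
  qed
qed

section \<open>The extremal number\<close>

context blowup_free
begin

section \<open>Degrees and vertex deletion\<close>

definition degree :: "'a \<Rightarrow> nat" where
  "degree x = card {e \<in> E. x \<in> e}"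

lemma degree_le_lk: "2 * degree x \<le> lk x V V"
proof -
  let ?F = "{e \<in> E. x \<in> e}"
  let ?L = "{(s, u). s \<in> V \<and> u \<in> V \<and> {x, s, u} \<in> E}"
  let ?R = "\<lambda>e. {p \<in> ?L. {x, fst p, snd p} = e}"
  have two: "2 \<le> card (?R e)" if "e \<in> ?F" for e
  proof -
    from that have e: "e \<in> E" "x \<in> e" by auto
    then have "card (e - {x}) = 2"
      using edge[of e] by simp
    then obtain y z where yz: "e - {x} = {y, z}" "y \<noteq> z"
      by (auto simp: card_2_iff)
    then have "e = {x, y, z}" "e = {x, z, y}"
      using e by auto
    then have "{(y, z), (z, y)} \<subseteq> ?R e"
      using e edge[of e] by auto
    then have "card {(y, z), (z, y)} \<le> card (?R e)"
      using lk_fin[of V V x] by (intro card_mono) auto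
    then show ?thesis using yz(2) by simp
  qed
  have "2 * degree x = (\<Sum>e\<in>?F. 2)"
    by (simp add: degree_def)
  also have "\<dots> \<le> (\<Sum>e\<in>?F. card (?R e))"
    using two by (rule sum_mono)
  also have "\<dots> = card (\<Union>e\<in>?F. ?R e)"
    using E_fin lk_fin[of V V x] by (intro card_UN_disjoint[symmetric]) auto
  also have "\<dots> \<le> card ?L"
    using lk_fin[of V V x] by (intro card_mono) auto
  finally show ?thesis
    by (simp add: lk_def)
qed

lemma delete_vertex: "blowup_free (V - {v}) {e \<in> E. v \<notin> e} t"
proof
  show "finite (V - {v})" using fin by simp
  show "e \<subseteq> V - {v} \<and> card e = 3" if "e \<in> {e \<in> E. v \<notin> e}" for e
    using edge that by auto
  show "\<not> contains_copy (V - {v}, {e \<in> E. v \<notin> e}) (F5_blowup t)"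
    using free unfolding contains_copy_def by fastforce
qed (rule tpos)

lemma card_delete_vertex: "card E = card {e \<in> E. v \<notin> e} + degree v"
proof -
  have "E = {e \<in> E. v \<notin> e} \<union> {e \<in> E. v \<in> e}" by auto
  then have "card E = card ({e \<in> E. v \<notin> e} \<union> {e \<in> E. v \<in> e})" by simp
  also have "\<dots> = card {e \<in> E. v \<notin> e} + card {e \<in> E. v \<in> e}"
    using E_fin by (intro card_Un_disjoint) auto
  finally show ?thesis by (simp add: degree_def)
qed

lemma card_E_le: "card E \<le> 2 ^ card V"
proof -
  have "card E \<le> card (Pow V)"
    using edge fin by (intro card_mono) auto
  then show ?thesis by (simp add: card_Pow fin)
qed

end

text \<open>The degree condition is the growth bound of \<open>T3_plus_size_Suc\<close> at
  \<open>card V - 1\<close>, which vertex deletion can secure. It is about n^2/9, so the link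
  condition of \<open>exact_tripartition\<close> follows for many vertices.\<close>

lemma edge_bound_of_min_degree:
  fixes t :: nat
  assumes t: "t > 0"
  obtains n1 where "\<And>(V :: nat set) E. blowup_free V E t \<Longrightarrow> n1 \<le> card V \<Longrightarrow>
    (\<And>x. x \<in> V \<Longrightarrow> ((card V - 1) div 3)\<^sup>2 \<le> blowup_free.degree E x) \<Longrightarrow>
    card E \<le> T3_plus_size t (card V)"
proof -
  obtain K where K: "\<And>N. \<exists>E. three_graph ({..<N}, E) \<and> pair_bounded t ({..<N}, E) \<and>
      (real t - 1) * N * (real N - 1) / 6 - N / 3 - K \<le> card E"
    using ex_near_design[OF t] by blast
  have K': "(real t - 1) * N * (real N - 1) / 6 - N / 3 - K \<le> packing_number t N" for N
  proof -
    from K[of N] obtain E where E: "three_graph ({..<N}, E)" "pair_bounded t ({..<N}, E)"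
        "(real t - 1) * N * (real N - 1) / 6 - N / 3 - K \<le> card E"
      by blast
    then show ?thesis
      using card_le_packing_number[OF E(1,2)] by simp
  qed
  \<comment> \<open>The \<open>\<epsilon>\<close> of \<open>exact_tripartition\<close> with its
    \<open>\<mu>\<close> inserted.\<close>
  define \<epsilon> where "\<epsilon> = (1 / (100 * (real t + 1)))\<^sup>2 / 25000"
  have eps: "\<epsilon> > 0"
    using t by (simp add: \<epsilon>_def)
  define n1 where "n1 = nat \<lceil>(10 * real t + 20) / \<epsilon>\<rceil> + nat \<lceil>15 * (2 * K + t)\<rceil>"
  show ?thesis
  proof (rule that[of n1])
    fix V :: "nat set" and E
    assume "blowup_free V E t" and n: "n1 \<le> card V"
      and deg: "\<And>x. x \<in> V \<Longrightarrow> ((card V - 1) div 3)\<^sup>2 \<le> blowup_free.degree E x"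
    then interpret blowup_free V E t by simp
    let ?n = "real (card V)"
    have n1: "(10 * real t + 20) / \<epsilon> \<le> ?n" "15 * (2 * K + t) \<le> ?n"
      using n unfolding n1_def by linarith+
    then have big: "10 * real t + 20 \<le> \<epsilon> * ?n"
      using eps by (simp add: divide_le_eq mult.commute)
    have lk: "(2/9 - \<epsilon>) * ?n\<^sup>2 \<le> lk x V V" if "x \<in> V" for x
    proof -
      let ?k = "(card V - 1) div 3"
      have "card V \<noteq> 0"
        using that fin by auto
      have "card V \<le> 3 * ?k + 3"
        using mult_div_mod_eq[of 3 "card V - 1"] mod_less_divisor[of 3 "card V - 1"] by linarith
      then have "?n \<le> 3 * real ?k + 3"
        by linarith
      then have k: "?n / 3 - 1 \<le> real ?k" by simp
      have "?n \<ge> 3"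
      proof (rule ccontr)
        assume "\<not> ?thesis"
        then have "\<epsilon> * ?n \<le> \<epsilon> * 3"
          using eps by (intro mult_left_mono) auto
        moreover have "\<epsilon> \<le> 1"
          unfolding \<epsilon>_def using power_le_one[of "1 / (100 * (real t + 1))" 2] by simp
        ultimately show False
          using big by linarith
      qed
      then have "(?n / 3 - 1)\<^sup>2 \<le> (real ?k)\<^sup>2"
        using k by (intro power_mono) auto
      \<comment> \<open>Expanding \<open>2 * (n/3 - 1)^2\<close> shows the linear loss
        \<open>4n/3\<close>, which \<open>\<epsilon> * n^2\<close> covers.\<close>
      have "4/3 * ?n \<le> (\<epsilon> * ?n) * ?n"
        using big by (intro mult_right_mono) auto
      then have "(2/9 - \<epsilon>) * ?n\<^sup>2 \<le> 2 * (?n / 3 - 1)\<^sup>2"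
        by (simp add: power2_eq_square field_simps)
      also have "\<dots> \<le> 2 * (real ?k)\<^sup>2"
        using \<open>(?n / 3 - 1)\<^sup>2 \<le> (real ?k)\<^sup>2\<close> by simp
      also have "\<dots> \<le> real (2 * degree x)"
        using deg[OF that] by (simp flip: of_nat_power)
      also have "\<dots> \<le> lk x V V"
        using degree_le_lk of_nat_le_iff by blast
      finally show ?thesis .
    qed
    obtain A B C where ABC: "A \<union> B \<union> C = V" "A \<inter> B = {}" "A \<inter> C = {}" "B \<inter> C = {}"
      "\<forall>P\<in>{A, B, C}. \<bar>card P - ?n / 3\<bar> \<le> ?n / 100"
      "\<forall>P\<in>{A, B, C}. pair_bounded t (P, {e \<in> E. e \<subseteq> P})"
      "card E \<le> card A * card B * card C + card {e \<in> E. e \<subseteq> A} + card {e \<in> E. e \<subseteq> B} + card {e \<in> E. e \<subseteq> C}"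
      by (rule exact_tripartition[OF big[unfolded \<epsilon>_def] lk[unfolded \<epsilon>_def]])
    have f: "finite A" "finite B" "finite C"
      using ABC(1) fin by auto
    have inside: "card {e \<in> E. e \<subseteq> P} \<le> packing_number t (card P)" if "P \<in> {A, B, C}" for P
    proof (rule card_le_packing_number)
      show "three_graph (P, {e \<in> E. e \<subseteq> P})"
        using that f edge by (auto simp: three_graph_def)
    qed (rule bspec[OF ABC(6) that])
    have "card E \<le> tripartite_size t (card A) (card B) (card C)"
      using ABC(7) inside[of A] inside[of B] inside[of C] unfolding tripartite_size_def by simp
    also have "\<dots> \<le> T3_plus_size t (card A + card B + card C)"
    proof (rule tripartite_size_le_T3_plus[OF t K'])
      have "card V = card (A \<union> B) + card C"
        using ABC f card_Un_disjoint[of "A \<union> B" C] by (simp add: Int_Un_distrib2)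
      then have s: "card A + card B + card C = card V"
        using ABC(2) f card_Un_disjoint[of A B] by simp
      show "15 * (2 * K + t) \<le> real (card A + card B + card C)"
        unfolding s by (rule n1(2))
      have r: "3/10 * real (card A + card B + card C) \<le> card P" if "P \<in> {A, B, C}" for P
        using bspec[OF ABC(5) that] unfolding s by linarith
      show "3/10 * real (card A + card B + card C) \<le> card A"
        "3/10 * real (card A + card B + card C) \<le> card B"
        "3/10 * real (card A + card B + card C) \<le> card C"
        using r by auto
    qed
    also have "card A + card B + card C = card V"
      using ABC f card_Un_disjoint[of "A \<union> B" C] card_Un_disjoint[of A B] by (simp add: Int_Un_distrib2)
    finally show "card E \<le> T3_plus_size t (card V)" .
  qed
qed

text \<open>Deleting a vertex of degree less than \<open>T(m) - T(m - 1)\<close> increases the excess over the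
  conjectured extremal number \<open>T\<close>, so a positive excess on many vertices would exceed the
  trivial bound by the time \<open>n1\<close> vertices are left.\<close>

lemma edge_bound:
  fixes t :: nat
  assumes t: "t > 0"
  obtains n0 where "\<And>(V :: nat set) E. blowup_free V E t \<Longrightarrow> n0 \<le> card V \<Longrightarrow>
    card E \<le> T3_plus_size t (card V)"
proof -
  obtain n1 where n1: "\<And>(V :: nat set) E. blowup_free V E t \<Longrightarrow> n1 \<le> card V \<Longrightarrow>
    (\<And>x. x \<in> V \<Longrightarrow> ((card V - 1) div 3)\<^sup>2 \<le> blowup_free.degree E x) \<Longrightarrow>
    card E \<le> T3_plus_size t (card V)"
    using edge_bound_of_min_degree[OF t] by metis
  define B :: nat where "B = 2 ^ n1"
  \<comment> \<open>\<open>B\<close> bounds the number of edges on \<open>n1\<close> vertices. The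
    second alternative avoids truncated differences; for \<open>m \<ge> n1 + B\<close> it implies
    the first.\<close>
  have excess: "card E \<le> T3_plus_size t m \<or> card E + (m - n1) \<le> T3_plus_size t m + B"
    if "n1 \<le> m" "blowup_free V E t" "card V = m" for m and V :: "nat set" and E
    using that
  proof (induction m arbitrary: V E rule: dec_induct)
    case base
    then show ?case
      using blowup_free.card_E_le[of V E t] by (simp add: B_def)
  next
    case (step m)
    interpret blowup_free V E t by (rule step.prems(1))
    show ?case
    proof (cases "\<forall>x\<in>V. ((card V - 1) div 3)\<^sup>2 \<le> degree x")
      case True
      then show ?thesis
        using n1[OF step.prems(1)] step.prems(2) step.hyps by auto
    next
      case False
      then obtain v where v: "v \<in> V" "degree v < (m div 3)\<^sup>2"
        using step.prems(2) by (auto simp: not_le)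
      have "card (V - {v}) = m"
        using v fin step.prems(2) by simp
      then have "card {e \<in> E. v \<notin> e} \<le> T3_plus_size t m \<or>
          card {e \<in> E. v \<notin> e} + (m - n1) \<le> T3_plus_size t m + B"
        by (rule step.IH[OF delete_vertex])
      then show ?thesis
        using card_delete_vertex[of v] v(2) T3_plus_size_Suc[of t m] step.hyps(1) by linarith
    qed
  qed
  show ?thesis
  proof (rule that[of "n1 + B"])
    fix V :: "nat set" and E
    assume "blowup_free V E t" "n1 + B \<le> card V"
    then show "card E \<le> T3_plus_size t (card V)"
      using excess[of "card V" V E] by linarith
  qed
qed

text \<open>If every edge is monochromatic or rainbow, then \<open>f\<^sub>1, f\<^sub>2\<close> of equal colour lie in the
  \<open>t\<close> monochromatic edges \<open>f\<^sub>1f\<^sub>2h\<^sub>i\<close>, and otherwise \<open>f\<^sub>4\<close> and all \<open>h\<^sub>i\<close> have the third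
  colour, so that \<open>f\<^sub>4, f\<^sub>5\<close> lie in the \<open>t\<close> monochromatic edges \<open>h\<^sub>if\<^sub>4f\<^sub>5\<close>.\<close>

lemma not_contains_F5_blowup:
  fixes col :: "'a \<Rightarrow> nat"
  assumes G: "three_graph (V, E)" and t: "t > 0"
    and col: "\<And>v. v \<in> V \<Longrightarrow> col v < 3"
    and edges: "\<And>u v w. {u, v, w} \<in> E \<Longrightarrow>
      col u = col v \<and> col v = col w \<or> col u \<noteq> col v \<and> col v \<noteq> col w \<and> col u \<noteq> col w"
    and codeg: "\<And>u v. u \<in> V \<Longrightarrow> v \<in> V \<Longrightarrow> u \<noteq> v \<Longrightarrow> col u = col v \<Longrightarrow> card {e \<in> E. {u, v} \<subseteq> e} < t"
  shows "\<not> contains_copy (V, E) (F5_blowup t)"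
proof
  assume "contains_copy (V, E) (F5_blowup t)"
  then obtain f where inj: "inj_on f (verts (F5_blowup t))" and im: "f ` verts (F5_blowup t) \<subseteq> V"
    and e: "\<And>e. e \<in> edges (F5_blowup t) \<Longrightarrow> f ` e \<in> E"
    unfolding contains_copy_def by auto
  have E: "finite E"
    by (rule finite_subset[of _ "Pow V"]) (use G in \<open>auto simp: three_graph_def\<close>)
  define h where "h i = f (H i)" for i
  have V: "f F1 \<in> V" "f F2 \<in> V" "f F4 \<in> V" "f F5 \<in> V" "i \<in> {1..t} \<Longrightarrow> h i \<in> V" for i
    using im by (auto simp: F5_blowup_def h_def)
  have ne: "f F1 \<noteq> f F2" "f F4 \<noteq> f F5"
    using inj by (auto simp: F5_blowup_def inj_on_def)
  have hne: "h i \<notin> {f F1, f F2, f F4, f F5}" if "i \<in> {1..t}" for i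
  proof -
    have "H i \<in> verts (F5_blowup t)" "{F1, F2, F4, F5} \<subseteq> verts (F5_blowup t)"
      using that by (auto simp: F5_blowup_def)
    then show ?thesis
      unfolding h_def using inj_onD[OF inj] by blast
  qed
  have hinj: "inj_on h {1..t}"
  proof (rule inj_onI)
    fix i j assume "i \<in> {1..t}" "j \<in> {1..t}" "h i = h j"
    then have "H i = H j"
      unfolding h_def by (intro inj_onD[OF inj]) (auto simp: F5_blowup_def)
    then show "i = j" by simp
  qed
  have e0: "{f F1, f F2, f F4} \<in> E"
    using e[of "{F1, F2, F4}"] by (simp add: F5_blowup_def)
  have e1: "{f F1, f F2, h i} \<in> E" and e2: "{f F4, f F5, h i} \<in> E" if "i \<in> {1..t}" for i
  proof -
    have "{F1, F2, H i} \<in> edges (F5_blowup t)" "{H i, F4, F5} \<in> edges (F5_blowup t)"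
      using that by (auto simp: F5_blowup_def)
    from e[OF this(1)] e[OF this(2)]
    show "{f F1, f F2, h i} \<in> E" "{f F4, f F5, h i} \<in> E"
      by (simp_all add: h_def insert_commute)
  qed
  have many: "t \<le> card {e \<in> E. {u, v} \<subseteq> e}"
    if "\<And>i. i \<in> {1..t} \<Longrightarrow> {u, v, h i} \<in> E" "\<And>i. i \<in> {1..t} \<Longrightarrow> h i \<notin> {u, v}" for u v
  proof -
    have "inj_on (\<lambda>i. {u, v, h i}) {1..t}"
    proof (rule inj_onI)
      fix i j assume ij: "i \<in> {1..t}" "j \<in> {1..t}" "{u, v, h i} = {u, v, h j}"
      then have "h i = h j"
        using that(2)[OF ij(1)] by blast
      then show "i = j"
        using inj_onD[OF hinj] ij by blast
    qed
    moreover have "(\<lambda>i. {u, v, h i}) ` {1..t} \<subseteq> {e \<in> E. {u, v} \<subseteq> e}"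
      using that(1) by auto
    ultimately have "card {1..t} \<le> card {e \<in> E. {u, v} \<subseteq> e}"
      using E by (intro card_inj_on_le) auto
    then show ?thesis by simp
  qed
  show False
  proof (cases "col (f F1) = col (f F2)")
    case True
    then show False
      using codeg[OF V(1,2) ne(1)] many[of "f F1" "f F2"] e1 hne by fastforce
  next
    case False
    have "1 \<in> {1..t}" using t by simp
    then have "col (f F4) = col (h 1)"
      using edges[OF e0] edges[OF e1[of 1]] False col[OF V(1)] col[OF V(2)] col[OF V(3)] col[OF V(5)[of 1]]
      by linarith
    then have "col (f F4) = col (f F5)"
      using edges[OF e2[OF \<open>1 \<in> {1..t}\<close>]] by argo
    then show False
      using codeg[OF V(3,4) ne(2)] many[of "f F4" "f F5"] e2 hne by fastforce
  qed
qed

text \<open>Balanced part sizes agree up to order and all optimal packings on equally many vertices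
  have equal size, so the edge number depends only on \<open>n\<close> and \<open>t\<close>. For
  freeness the colour of a vertex is the index of its part.\<close>

lemma T3_plus_properties:
  assumes "is_T3_plus n t G" and t: "t > 0"
  shows "three_graph G" "card (verts G) = n" "card (edges G) = T3_plus_size t n"
    "\<not> contains_copy G (F5_blowup t)"
proof -
  obtain A B C DA DB DC where bal: "balanced_parts n A B C"
    and D: "is_D t (A, DA)" "is_D t (B, DB)" "is_D t (C, DC)"
    and G: "G = (A \<union> B \<union> C, edges (complete_3partite A B C) \<union> DA \<union> DB \<union> DC)"
    using assms(1) unfolding is_T3_plus_def by blast
  have f: "finite A" "finite B" "finite C" and dis: "A \<inter> B = {}" "A \<inter> C = {}" "B \<inter> C = {}"
    and n: "card (A \<union> B \<union> C) = n"
    using bal by (auto simp: balanced_parts_def)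
  let ?X = "{{a, b, c} | a b c. a \<in> A \<and> b \<in> B \<and> c \<in> C}"
  have E: "edges G = ?X \<union> (DA \<union> (DB \<union> DC))"
    by (auto simp: G complete_3partite_def)
  have DA: "e \<subseteq> A" "card e = 3" if "e \<in> DA" for e
    using D(1) that by (auto simp: is_D_def three_graph_def)
  have DB: "e \<subseteq> B" "card e = 3" if "e \<in> DB" for e
    using D(2) that by (auto simp: is_D_def three_graph_def)
  have DC: "e \<subseteq> C" "card e = 3" if "e \<in> DC" for e
    using D(3) that by (auto simp: is_D_def three_graph_def)
  have X: "e \<subseteq> A \<union> B \<union> C" "card e = 3" "\<not> e \<subseteq> A" "\<not> e \<subseteq> B" "\<not> e \<subseteq> C" if "e \<in> ?X" for e
  proof -
    from that obtain a b c where e: "e = {a, b, c}" "a \<in> A" "b \<in> B" "c \<in> C" by blast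
    then have "a \<noteq> b" "a \<noteq> c" "b \<noteq> c" "b \<notin> A" "c \<notin> B" "a \<notin> C"
      using dis by auto
    then show "e \<subseteq> A \<union> B \<union> C" "card e = 3" "\<not> e \<subseteq> A" "\<not> e \<subseteq> B" "\<not> e \<subseteq> C"
      using e by auto
  qed
  show three: "three_graph G"
    unfolding three_graph_def
  proof (intro conjI ballI)
    show "finite (verts G)" using f by (simp add: G)
    fix e assume "e \<in> edges G"
    then have "e \<in> ?X \<or> e \<in> DA \<or> e \<in> DB \<or> e \<in> DC"
      unfolding E by blast
    then have "e \<subseteq> A \<union> B \<union> C \<and> card e = 3"
    proof (elim disjE)
      assume "e \<in> ?X"
      then show ?thesis using X(1,2) by (intro conjI)
    next
      assume "e \<in> DA"
      then show ?thesis using DA[of e] by (simp add: le_supI1)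
    next
      assume "e \<in> DB"
      then show ?thesis using DB[of e] by (simp add: le_supI1 le_supI2)
    next
      assume "e \<in> DC"
      then show ?thesis using DC[of e] by (simp add: le_supI2)
    qed
    then show "e \<subseteq> verts G" "card e = 3"
      by (simp_all add: G)
  qed
  show "card (verts G) = n"
    by (simp add: G n)
  have s: "card A + card B + card C = n"
    using n dis f card_Un_disjoint[of "A \<union> B" C] card_Un_disjoint[of A B] by (simp add: Int_Un_distrib2)
  have "card ?X = card A * card B * card C"
  proof -
    have "?X = (\<lambda>(a, b, c). {a, b, c}) ` (A \<times> B \<times> C)"
      by auto
    moreover have "inj_on (\<lambda>(a, b, c). {a, b, c}) (A \<times> B \<times> C)"
    proof (rule inj_onI)
      fix p q assume pq: "p \<in> A \<times> B \<times> C" "q \<in> A \<times> B \<times> C"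
        "(\<lambda>(a, b, c). {a, b, c}) p = (\<lambda>(a, b, c). {a, b, c}) q"
      obtain a b c a' b' c' where p: "p = (a, b, c)" "q = (a', b', c')"
        by (cases p, cases q)
      then have eq: "{a, b, c} = {a', b', c'}"
          and m: "a \<in> A" "b \<in> B" "c \<in> C" "a' \<in> A" "b' \<in> B" "c' \<in> C"
        using pq by simp_all
      have "{x, y, z} \<inter> A = {x} \<and> {x, y, z} \<inter> B = {y} \<and> {x, y, z} \<inter> C = {z}"
        if "x \<in> A" "y \<in> B" "z \<in> C" for x y z
        using that dis by auto
      from this[OF m(1-3)] this[OF m(4-6)] have "{a} = {a'}" "{b} = {b'}" "{c} = {c'}"
        unfolding eq by simp_all
      then show "p = q"
        using p by simp
    qed
    ultimately show ?thesis
      by (simp add: card_image card_cartesian_product)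
  qed
  moreover have "?X \<inter> (DA \<union> (DB \<union> DC)) = {}"
    using X(3-5) DA(1) DB(1) DC(1) by blast
  moreover have "DA \<inter> (DB \<union> DC) = {}" "DB \<inter> DC = {}"
  proof -
    have no: False if "P \<inter> Q = {}" "e \<subseteq> P" "e \<subseteq> Q" "card e = 3" for e P Q :: "'a set"
    proof -
      have "e = {}" using that(1-3) by blast
      then show False using that(4) by simp
    qed
    show "DA \<inter> (DB \<union> DC) = {}"
      using no[OF dis(1) DA(1) DB(1) DA(2)] no[OF dis(2) DA(1) DC(1) DA(2)] by auto
    show "DB \<inter> DC = {}"
      using no[OF dis(3) DB(1) DC(1) DB(2)] by auto
  qed
  moreover have "finite (edges G)"
    by (rule finite_subset[of _ "Pow (verts G)"]) (use three f in \<open>auto simp: three_graph_def\<close>)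
  ultimately have "card (edges G) = card A * card B * card C + (card DA + (card DB + card DC))"
    unfolding E by (simp add: card_Un_disjoint)
  also have "\<dots> = tripartite_size t (card A) (card B) (card C)"
    using card_is_D[OF D(1)] card_is_D[OF D(2)] card_is_D[OF D(3)] by (simp add: tripartite_size_def)
  also have "\<dots> = T3_plus_size t (card A + card B + card C)"
  proof -
    have "\<lceil>real n / 3\<rceil> \<le> \<lfloor>real n / 3\<rfloor> + 1" "\<lfloor>real n / 3\<rfloor> \<le> \<lceil>real n / 3\<rceil>"
      by linarith+
    moreover have "int (card P) = \<lfloor>real n / 3\<rfloor> \<or> int (card P) = \<lceil>real n / 3\<rceil>" if "P \<in> {A, B, C}" for P
      using bal that unfolding balanced_parts_def by blast
    ultimately have "card P \<le> card Q + 1" if "P \<in> {A, B, C}" "Q \<in> {A, B, C}" for P Q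
      using that by (smt (verit) of_nat_1 of_nat_add of_nat_le_iff)
    then show ?thesis
      by (intro balanced_size) auto
  qed
  finally show "card (edges G) = T3_plus_size t n"
    by (simp add: s)
  define col :: "'a \<Rightarrow> nat" where "col v = (if v \<in> A then 0 else if v \<in> B then 1 else 2)" for v
  have colA: "col v = 0" if "v \<in> A" for v using that by (simp add: col_def)
  have colB: "col v = 1" if "v \<in> B" for v using that dis by (auto simp: col_def)
  have colC: "col v = 2" if "v \<in> C" for v using that dis by (auto simp: col_def)
  have mono: "e \<in> DA \<or> e \<in> DB \<or> e \<in> DC" if e: "e \<in> edges G" and uv: "u \<in> e" "v \<in> e" "u \<noteq> v" "col u = col v" for e u v
  proof (rule ccontr)
    assume "\<not> ?thesis"
    then have "e \<in> ?X" using e unfolding E by blast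
    then obtain a b c where "e = {a, b, c}" "a \<in> A" "b \<in> B" "c \<in> C" by blast
    then show False
      using uv colA[of a] colB[of b] colC[of c] by auto
  qed
  have "\<not> contains_copy (verts G, edges G) (F5_blowup t)"
  proof (rule not_contains_F5_blowup[where col = col])
    show "three_graph (verts G, edges G)" using three by simp
    show "t > 0" by fact
    show "col v < 3" for v by (simp add: col_def)
    show "col u = col v \<and> col v = col w \<or> col u \<noteq> col v \<and> col v \<noteq> col w \<and> col u \<noteq> col w"
      if e: "{u, v, w} \<in> edges G" for u v w
    proof (rule ccontr)
      assume c: "\<not> ?thesis"
      have "card {u, v, w} = 3"
        using three e by (auto simp: three_graph_def)
      then have ne: "u \<noteq> v" "v \<noteq> w" "u \<noteq> w"
        by (auto simp: card_insert_if split: if_splits)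
      then have "{u, v, w} \<in> DA \<or> {u, v, w} \<in> DB \<or> {u, v, w} \<in> DC"
        using c mono[OF e, of u v] mono[OF e, of v w] mono[OF e, of u w] by auto
      then have "{u, v, w} \<subseteq> A \<or> {u, v, w} \<subseteq> B \<or> {u, v, w} \<subseteq> C"
        using DA DB DC by blast
      then show False
        using c colA colB colC by auto
    qed
    show "card {e \<in> edges G. {u, v} \<subseteq> e} < t"
      if uv: "u \<in> verts G" "v \<in> verts G" "u \<noteq> v" "col u = col v" for u v
    proof -
      have part: "card {e \<in> edges G. {u, v} \<subseteq> e} < t"
        if "u \<in> P" "v \<in> P" "is_D t (P, DP)" "{e \<in> edges G. {u, v} \<subseteq> e} \<subseteq> {e \<in> DP. {u, v} \<subseteq> e}" for P DP
      proof -
        have "finite DP"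
          by (rule finite_subset[of _ "Pow P"]) (use that(3) in \<open>auto simp: is_D_def three_graph_def\<close>)
        then have "card {e \<in> edges G. {u, v} \<subseteq> e} \<le> card {e \<in> DP. {u, v} \<subseteq> e}"
          using that(4) by (intro card_mono) auto
        also have "\<dots> \<le> t - 1"
          using that(1-3) uv(3) by (auto simp: is_D_def pair_bounded_def)
        finally show ?thesis using t by simp
      qed
      \<comment> \<open>An edge with two vertices of equal colour belongs to a packing, so the
        codegree of such a pair is that in the packing of its part.\<close>
      have m: "e \<in> DA \<or> e \<in> DB \<or> e \<in> DC" "u \<in> e" if "e \<in> edges G" "{u, v} \<subseteq> e" for e
        using mono[OF that(1), of u v] that(2) uv(3,4) by simp_all
      have "u \<in> A \<and> v \<in> A \<or> u \<in> B \<and> v \<in> B \<or> u \<in> C \<and> v \<in> C"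
        using uv colA colB colC by (fastforce simp: G)
      then show ?thesis
      proof (elim disjE conjE)
        assume p: "u \<in> A" "v \<in> A"
        have "e \<in> DA" if "e \<in> edges G" "{u, v} \<subseteq> e" for e
          using m[OF that] DB(1)[of e] DC(1)[of e] p(1) dis(1,2) by auto
        then show ?thesis
          by (intro part[OF p D(1)]) auto
      next
        assume p: "u \<in> B" "v \<in> B"
        have "e \<in> DB" if "e \<in> edges G" "{u, v} \<subseteq> e" for e
          using m[OF that] DA(1)[of e] DC(1)[of e] p(1) dis(1,3) by auto
        then show ?thesis
          by (intro part[OF p D(2)]) auto
      next
        assume p: "u \<in> C" "v \<in> C"
        have "e \<in> DC" if "e \<in> edges G" "{u, v} \<subseteq> e" for e
          using m[OF that] DA(1)[of e] DB(1)[of e] p(1) dis(2,3) by auto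
        then show ?thesis
          by (intro part[OF p D(3)]) auto
      qed
    qed
  qed
  then show "\<not> contains_copy G (F5_blowup t)" by simp
qed

theorem theorem1p4:
  fixes t :: nat
  assumes "t > 0"
  shows "\<exists>n\<^sub>0. \<forall>n\<ge>n\<^sub>0. \<forall>G :: nat hypergraph.
    is_T3_plus n t G \<longrightarrow> ex3 n (F5_blowup t) = card (edges G)"
proof -
  obtain n0 where n0: "\<And>(V :: nat set) E. blowup_free V E t \<Longrightarrow> n0 \<le> card V \<Longrightarrow>
    card E \<le> T3_plus_size t (card V)"
    using edge_bound[OF assms] by metis
  have "ex3 n (F5_blowup t) = card (edges G)" if n: "n \<ge> n0" and G: "is_T3_plus n t G"
    for n and G :: "nat hypergraph"
  proof -
    note T = T3_plus_properties[OF G assms]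
    have "edges (F5_blowup t) \<noteq> {}"
      by (simp add: F5_blowup_def)
    note fin = ex3_well_defined(1)[OF this, of n]
    have fG: "finite (verts G)"
      using T(1) by (simp add: three_graph_def)
    \<comment> \<open>\<open>G\<close> may live on any \<open>n\<close> naturals while
      \<open>ex3\<close> fixes the vertex set \<open>{..<n}\<close>, so \<open>G\<close> is
      relabelled.\<close>
    then obtain f where f: "bij_betw f (verts G) {..<n}"
      using T(2) finite_same_card_bij[of "verts G" "{..<n}"] by auto
    have G': "three_graph (verts G, edges G)" "\<not> contains_copy (verts G, edges G) (F5_blowup t)"
      using T by simp_all
    show ?thesis
      unfolding ex3_def
    proof (rule Max_eqI[OF fin])
      fix m assume "m \<in> {card (edges G) | G :: nat hypergraph.
        three_graph G \<and> verts G = {..<n} \<and> \<not> contains_copy G (F5_blowup t)}"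
      then obtain G' :: "nat hypergraph" where H: "m = card (edges G')" "three_graph G'" "verts G' = {..<n}"
        "\<not> contains_copy G' (F5_blowup t)"
        by blast
      have "\<not> contains_copy (verts G', edges G') (F5_blowup t)"
        using H(4) by simp
      then have "blowup_free (verts G') (edges G') t"
        using H(2) assms by (auto simp: blowup_free_def three_graph_def)
      then have "card (edges G') \<le> T3_plus_size t n"
        using n0[of "verts G'" "edges G'"] H(3) n by simp
      then show "m \<le> card (edges G)"
        using H(1) T(3) by simp
    next
      have "three_graph ({..<n}, (`) f ` edges G)" "card ((`) f ` edges G) = card (edges G)"
        using three_graph_image[OF f G'(1)] .
      moreover have "\<not> contains_copy ({..<n}, (`) f ` edges G) (F5_blowup t)"
        using contains_copy_image[OF f G'(1)] G'(2) by blast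
      ultimately show "card (edges G) \<in> {card (edges G) | G :: nat hypergraph.
        three_graph G \<and> verts G = {..<n} \<and> \<not> contains_copy G (F5_blowup t)}"
        by (intro CollectI exI[of _ "({..<n}, (`) f ` edges G)"]) simp
    qed
  qed
  then show ?thesis by blast
qed

end
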